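(* Let $X$ be a Polish metric space with an action $\theta$ of $\mathbb R^n$, let $\{\omega_\varepsilon\}_\varepsilon$ be a family of domains of $\mathbb R^n$ and let $\{f_\varepsilon\}_\varepsilon$, $f$ be functions on $X$, all satisfying the assumptions listed in the context. Let $$F_\varepsilon(u)=\frac1{|\omega_\varepsilon|}\int_{\omega_\varepsilon}f_\varepsilon(\theta_\lambda u)\,d\lambda .$$ Let $\{u_\varepsilon\}_\varepsilon$ be a family in $X$ such that $\{F_\varepsilon(u_\varepsilon)\}_\varepsilon$ is bounded, and let $P_\varepsilon$ be the image of the normalized Lebesgue measure on $\omega_\varepsilon$ under the map $\lambda\mapsto\theta_\lambda u_\varepsilon$. Then $P_\varepsilon$ converges weakly along a subsequence $\varepsilon\to0$ to a Borel probability measure $P$ on $X$ which is invariant under the action $\theta$ and such that $$\liminf_{\varepsilon\to0}F_\varepsilon(u_\varepsilon)\ge\int f(u)\,dP(u).$$ Moreover, for any averaging family $\{\mathbf U_R\}_{R>0}$ (see context), $$\int f(u)\,dP(u)=\int f^*(u)\,dP(u),\qquad f^*(u):=\lim_{R\to+\infty}\frac1{|\mathbf U_R|}\int_{\mathbf U_R}f(\theta_\lambda u)\,d\lambda,$$ where the limit defining $f^*(u)$ exists for $P$-almost every $u$. In particular $\int f^*\,dP$ is independent of the choice of $\{\mathbf U_R\}_{R>0}$.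
   Context: Measurable means Borel measurable; weak convergence of probability measures is convergence against bounded continuous functions. Assumptions on $\theta$: for all $u\in X$ and $\lambda,\mu\in\mathbb R^n$, $\theta_\lambda(\theta_\mu u)=\theta_{\lambda+\mu}u$ and $\theta_0u=u$; the map $(\lambda,u)\mapsto\theta_\lambda u$ is measurable on $\mathbb R^n\times X$ and continuous with respect to each variable. Assumption on $\{\omega_\varepsilon\}$: for any $R>0$, letting $\omega_{\varepsilon,R}=\{x\in\omega_\varepsilon:\operatorname{dist}(x,\partial\omega_\varepsilon)>R\}$, one has $|\omega_\varepsilon|\sim|\omega_{\varepsilon,R}|$ as $\varepsilon\to0$. Assumptions on $f_\varepsilon,f$: they are measurable nonnegative functions on $X$, and for any family $\{u_\varepsilon\}_\varepsilon$ in $X$ such that for all $R>0$, $\limsup_{\varepsilon\to0}\int_{B_R}f_\varepsilon(\theta_\lambda u_\varepsilon)\,d\lambda<+\infty$ ($B_R$ the ball of center $0$, radius $R$ in $\mathbb R^n$), the following holds: (1) (coercivity) $\{u_\varepsilon\}_\varepsilon$ admits a convergent subsequence; (2) ($\Gamma$-liminf) if $\{u_\varepsilon\}_\varepsilon$ is a convergent subsequence and $u$ is its limit, then $\liminf_{\varepsilon\to0}f_\varepsilon(u_\varepsilon)\ge f(u)$. Averaging family: an increasing family $\{\mathbf U_R\}_{R>0}$ of bounded open sets of $\mathbb R^n$ which is a Vitali family (the intersection of the closures is $\{0\}$, $R\mapsto|\mathbf U_R|$ is left continuous, and $|\mathbf U_R-\mathbf U_R|\le C|\mathbf U_R|$ with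 $C$ independent of $R$, $\mathbf U_R-\mathbf U_R$ being the set of differences) and such that $\lim_{R\to\infty}|(\lambda+\mathbf U_R)\triangle\mathbf U_R|/|\mathbf U_R|=0$ for every $\lambda\in\mathbb R^n$. *)

theory Defs
  imports "HOL-Probability.Probability" "HOL-Library.Landau_Symbols"
begin

definition continuous_action :: "(real^'n \<Rightarrow> 'a::polish_space \<Rightarrow> 'a) \<Rightarrow> bool" where
  "continuous_action \<theta> \<longleftrightarrow>
     (\<forall>l m u. \<theta> l (\<theta> m u) = \<theta> (l + m) u) \<and>
     (\<forall>u. \<theta> 0 u = u) \<and>
     (\<lambda>(l, u). \<theta> l u) \<in> borel_measurable borel \<and>
     (\<forall>u. continuous_on UNIV (\<lambda>l. \<theta> l u)) \<and>
     (\<forall>l. continuous_on UNIV (\<theta> l))"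

definition inner_part :: "real \<Rightarrow> (real^'n) set \<Rightarrow> (real^'n) set" where
  "inner_part R \<omega> = {x \<in> \<omega>. infdist x (frontier \<omega>) > R}"

text \<open>Domains are nonempty connected open sets. Finite volume is required for the normalized
  Lebesgue measure to make sense; it also forces \<open>frontier (\<omega> \<epsilon>) \<noteq> {}\<close>, so that
  \<^const>\<open>infdist\<close> is the true distance to the boundary.\<close>

definition domain_family :: "(real \<Rightarrow> (real^'n) set) \<Rightarrow> bool" where
  "domain_family \<omega> \<longleftrightarrow>
     (\<forall>\<epsilon>>0. open (\<omega> \<epsilon>) \<and> connected (\<omega> \<epsilon>) \<and> \<omega> \<epsilon> \<noteq> {} \<and> emeasure lborel (\<omega> \<epsilon>) < \<infinity>) \<and>
     (\<forall>R>0. (\<lambda>\<epsilon>. measure lborel (\<omega> \<epsilon>)) \<sim>[at_right 0]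
             (\<lambda>\<epsilon>. measure lborel (inner_part R (\<omega> \<epsilon>))))"

text \<open>The families \<open>{u\<^sub>\<epsilon>}\<close> tested here are indexed by arbitrary sequences of parameters
  \<open>e k \<rightarrow> 0\<close>, so that the condition passes to subsequences \<open>\<epsilon> \<rightarrow> 0\<close>. Functions on
  the space take values in \<open>[0, \<infinity>]\<close>.\<close>

definition coercive_Gamma_liminf ::
  "(real^'n \<Rightarrow> 'a::polish_space \<Rightarrow> 'a) \<Rightarrow> (real \<Rightarrow> 'a \<Rightarrow> ennreal) \<Rightarrow> ('a \<Rightarrow> ennreal) \<Rightarrow> bool" where
  "coercive_Gamma_liminf \<theta> fe f \<longleftrightarrow>
     (\<forall>e v. (\<forall>k. 0 < e k) \<and> e \<longlonglongrightarrow> 0 \<and>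
        (\<forall>R>0. limsup (\<lambda>k. \<integral>\<^sup>+ l \<in> ball 0 R. fe (e k) (\<theta> l (v k)) \<partial>lborel) < \<infinity>) \<longrightarrow>
        (\<exists>r w. strict_mono r \<and> (\<lambda>k. v (r k)) \<longlonglongrightarrow> w) \<and>
        (\<forall>r w. strict_mono r \<and> (\<lambda>k. v (r k)) \<longlonglongrightarrow> w \<longrightarrow>
           f w \<le> liminf (\<lambda>k. fe (e (r k)) (v (r k)))))"

definition orbit_average ::
  "(real^'n \<Rightarrow> 'a \<Rightarrow> 'a) \<Rightarrow> (real^'n) set \<Rightarrow> ('a \<Rightarrow> ennreal) \<Rightarrow> 'a \<Rightarrow> ennreal" where
  "orbit_average \<theta> A g u = (\<integral>\<^sup>+ l \<in> A. g (\<theta> l u) \<partial>lborel) / emeasure lborel A"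

definition orbit_measure ::
  "(real^'n \<Rightarrow> 'a::topological_space \<Rightarrow> 'a) \<Rightarrow> (real^'n) set \<Rightarrow> 'a \<Rightarrow> 'a measure" where
  "orbit_measure \<theta> A u = distr (uniform_measure lborel A) borel (\<lambda>l. \<theta> l u)"

definition weakly_converges :: "(nat \<Rightarrow> 'a::topological_space measure) \<Rightarrow> 'a measure \<Rightarrow> bool" where
  "weakly_converges Q P \<longleftrightarrow>
     (\<forall>g :: 'a \<Rightarrow> real. continuous_on UNIV g \<and> bounded (range g) \<longrightarrow>
        (\<lambda>k. \<integral>x. g x \<partial>Q k) \<longlonglongrightarrow> (\<integral>x. g x \<partial>P))"

definition averaging_family :: "(real \<Rightarrow> (real^'n) set) \<Rightarrow> bool" where
  "averaging_family U \<longleftrightarrow>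
     (\<forall>R>0. open (U R) \<and> bounded (U R)) \<and>
     (\<forall>R S. 0 < R \<and> R \<le> S \<longrightarrow> U R \<subseteq> U S) \<and>
     (\<Inter>R\<in>{0<..}. closure (U R)) = {0} \<and>
     (\<forall>R>0. continuous (at_left R) (\<lambda>S. measure lborel (U S))) \<and>
     (\<exists>C. \<forall>R>0. measure lborel {x - y | x y. x \<in> U R \<and> y \<in> U R} \<le> C * measure lborel (U R)) \<and>
     (\<forall>l. ((\<lambda>R. measure lborel (sym_diff ((+) l ` U R) (U R)) / measure lborel (U R)) \<longlongrightarrow> 0) at_top)"

definition ergodic_limit ::
  "(real^'n \<Rightarrow> 'a \<Rightarrow> 'a) \<Rightarrow> (real \<Rightarrow> (real^'n) set) \<Rightarrow> ('a \<Rightarrow> ennreal) \<Rightarrow> 'a \<Rightarrow> ennreal" where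
  "ergodic_limit \<theta> U g u = Lim at_top (\<lambda>R. orbit_average \<theta> (U R) g u)"

end

theory Submission
  imports Defs
begin

text \<open>
  For \<open>R > 0\<close>, Fubini's theorem and Chebyshev's inequality show that for all but a small proportion
  of \<open>\<lambda> \<in> \<omega>\<^sub>\<epsilon>\<close> the integral of \<open>f\<^sub>\<epsilon>\<close> along the piece of radius \<open>R\<close> of the orbit of
  \<open>\<theta>\<^sub>\<lambda> u\<^sub>\<epsilon>\<close> is bounded. Coercivity turns this into tightness of \<open>P\<^sub>\<epsilon>\<close>, Prokhorov's theorem gives
  a weak limit \<open>P\<close>, and \<open>\<Gamma>\<close>-convergence on the good set gives the lower bound. Since the boundary
  layers of \<open>\<omega>\<^sub>\<epsilon>\<close> are negligible, \<open>P\<close> is invariant.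

  The ergodic part is the multiparameter ergodic theorem. The Vitali property yields a maximal
  inequality on \<open>\<real>\<^sup>n\<close>, which is transferred to \<open>P\<close> along orbits. For bounded \<open>f\<close> the averages
  are Cauchy in \<open>L\<^sup>2\<close> by the parallelogram identity; their limit is an invariant function, and the
  maximal inequality upgrades the convergence to almost everywhere. Truncation gives integrable \<open>f\<close>.
\<close>

section \<open>Weak convergence on Polish spaces\<close>

text \<open>The functions \<open>fe (e k)\<close> change with \<open>k\<close> and need not be
  continuous, so weak convergence says nothing directly about their integrals; the passage to the
  limit uses Lipschitz envelopes built from the values on good sets only. One good set per parameter
  has to control every radius, while the assumption on boundary layers is for fixed radii and gives
  no rate. Hence the parameters \<open>e k\<close> are chosen diagonally: the layer of width
  \<open>k\<close> occupies a fraction at most \<open>(1/2)^k / (k + 1)\<close>, small enough to pay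
  for the radii \<open>1, ..., k\<close> together. The same choice makes \<open>F (e k)\<close>
  approach the liminf over the whole family, so a bound along a subsequence is a bound by the full
  liminf; as the averages are bounded, \<open>f\<close> is then integrable for \<open>P\<close>, as
  the ergodic theorem requires. There the averages run over a continuum of radii, so almost
  everywhere statements cannot be collected radius by radius: approximations are uniform in the
  point, or hold outside one exceptional set that serves all radii.\<close>

lemma measure_eqI_bounded_continuous:
  fixes P Q :: "'a::metric_space measure"
  assumes P: "finite_measure P" "sets P = sets borel"
    and Q: "finite_measure Q" "sets Q = sets borel"
    and eq: "\<And>g :: 'a \<Rightarrow> real. continuous_on UNIV g \<Longrightarrow> bounded (range g) \<Longrightarrow>
      (\<integral>x. g x \<partial>P) = (\<integral>x. g x \<partial>Q)"
  shows "P = Q"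
proof -
  interpret P: finite_measure P by fact
  interpret Q: finite_measure Q by fact
  have [measurable_cong]: "sets P = sets borel" "sets Q = sets borel" by fact+
  have sp: "space P = UNIV" "space Q = UNIV"
    using P(2) Q(2) by (metis sets_eq_imp_space_eq space_borel)+
  \<comment> \<open>\<open>infdist x {} = 0\<close>, so the cut-off functions below would be
    constantly 1 for an empty \<open>C\<close>; that case is settled separately at the end.\<close>
  have closed_eq: "measure P C = measure Q C" if C: "closed C" "C \<noteq> {}" for C
  proof -
    define g where "g n x = max 0 (1 - real n * infdist x C)" for n :: nat and x
    have lim: "(\<lambda>n. g n x) \<longlonglongrightarrow> indicator C x" for x
    proof (cases "x \<in> C")
      case True
      then show ?thesis by (simp add: g_def)
    next
      case False
      then have d: "infdist x C > 0"
        using C by (meson in_closed_iff_infdist_zero infdist_nonneg less_eq_real_def not_less)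
      obtain N :: nat where N: "real N * infdist x C > 1"
        using ex_less_of_nat_mult[OF d, of 1] by auto
      have "g n x = 0" if "n \<ge> N" for n
      proof -
        have "real N * infdist x C \<le> real n * infdist x C"
          using that d by (intro mult_right_mono) auto
        then show ?thesis using N by (simp add: g_def)
      qed
      then show ?thesis using False
        by (intro tendsto_eventually) (auto simp: eventually_sequentially)
    qed
    have cont: "continuous_on UNIV (g n)" for n
      unfolding g_def by (intro continuous_intros)
    have bd: "0 \<le> g n x" "g n x \<le> 1" for n x
      by (auto simp: g_def infdist_nonneg)
    have [measurable]: "g n \<in> borel_measurable borel" for n
      using cont by (rule borel_measurable_continuous_onI)
    have [measurable]: "C \<in> sets borel" using C by auto
    have "(\<lambda>n. \<integral>x. g n x \<partial>P) \<longlonglongrightarrow> (\<integral>x. indicator C x \<partial>P)"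
      by (rule integral_dominated_convergence[where w="\<lambda>_. 1"]) (use bd lim in auto)
    moreover have "(\<lambda>n. \<integral>x. g n x \<partial>Q) \<longlonglongrightarrow> (\<integral>x. indicator C x \<partial>Q)"
      by (rule integral_dominated_convergence[where w="\<lambda>_. 1"]) (use bd lim in auto)
    moreover have "(\<integral>x. g n x \<partial>P) = (\<integral>x. g n x \<partial>Q)" for n
      by (intro eq cont) (use bd in \<open>auto simp: bounded_iff intro!: exI[of _ 1]\<close>)
    ultimately have "(\<integral>x. indicator C x \<partial>P) = (\<integral>x. indicator C x \<partial>Q :: real)"
      using LIMSEQ_unique by fastforce
    then show ?thesis by (simp add: sp)
  qed
  show ?thesis
  proof (rule measure_eqI_generator_eq[where E="Collect closed" and \<Omega>=UNIV and A="\<lambda>_. UNIV"])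
    show "Int_stable (Collect closed :: 'a set set)" by (auto simp: Int_stable_def)
    show "sets P = sigma_sets UNIV (Collect closed)" "sets Q = sigma_sets UNIV (Collect closed)"
      unfolding P(2) Q(2) borel_eq_closed by simp_all
    show "emeasure P X = emeasure Q X" if "X \<in> Collect closed" for X
      using closed_eq[of X] that by (cases "X = {}") (auto simp: P.emeasure_eq_measure Q.emeasure_eq_measure)
  qed auto
qed

section \<open>Coding a Polish space in the real line; Prokhorov's theorem\<close>

lemma ex_countable_open_refining_sequence:
  obtains b :: "nat \<Rightarrow> 'a::{second_countable_topology, metric_space} set"
  where "\<And>p. open (b p)" "\<And>x e. 0 < e \<Longrightarrow> \<exists>p. x \<in> b p \<and> b p \<subseteq> ball x e"
proof -
  obtain B :: "'a set set" where B: "countable B" "topological_basis B"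
    using ex_countable_basis by auto
  have ne: "B \<noteq> {}"
    using B(2) open_UNIV topological_basisE by blast
  show ?thesis
  proof (rule that[of "from_nat_into B"])
    show "open (from_nat_into B p)" for p
      using from_nat_into[OF ne] B(2) topological_basis_open by blast
    show "\<exists>p. x \<in> from_nat_into B p \<and> from_nat_into B p \<subseteq> ball x e" if e: "0 < e" for x e
    proof -
      obtain b where "b \<in> B" "x \<in> b" "b \<subseteq> ball x e"
        by (rule topological_basisE[OF B(2) open_ball, of x x e]) (use e in auto)
      then show ?thesis
        using from_nat_into_surj[OF B(1), of b] by auto
    qed
  qed
qed

text \<open>At the first index \<open>q\<close> where the digits differ, that term contributes
  \<open>(1/3)^q\<close> in absolute value, and all later terms together at most
  \<open>(1/3)^q / 2\<close>. In base 2 the tail could cancel the leading term; base 3 with digits 0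
  and 1 leaves a gap.\<close>

lemma ternary_code_bits_eq:
  fixes c d :: "nat \<Rightarrow> bool"
  assumes close: "\<bar>(\<Sum>p. of_bool (c p) * (1/3::real)^p) - (\<Sum>p. of_bool (d p) * (1/3)^p)\<bar> < (1/3)^n / 2"
    and "p \<le> n"
  shows "c p = d p"
proof (rule ccontr)
  assume "c p \<noteq> d p"
  define q where "q = (LEAST q. c q \<noteq> d q)"
  have q: "c q \<noteq> d q" "q \<le> p" "\<And>i. i < q \<Longrightarrow> c i = d i"
    using LeastI[of "\<lambda>q. c q \<noteq> d q" p] Least_le[of "\<lambda>q. c q \<noteq> d q" p] \<open>c p \<noteq> d p\<close>
      not_less_Least[of _ "\<lambda>q. c q \<noteq> d q"] unfolding q_def by blast+
  define a where "a p = (of_bool (c p) - of_bool (d p)) * (1/3::real)^p" for p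
  have geo: "summable (\<lambda>p. (1/3::real)^p)" by (rule summable_geometric) simp
  have sc: "summable (\<lambda>p. of_bool (e p) * (1/3::real)^p)" for e :: "nat \<Rightarrow> bool"
    by (rule summable_comparison_test'[OF geo, of 0]) auto
  have sa: "summable a"
    unfolding a_def left_diff_distrib by (intro summable_diff sc)
  have diff: "(\<Sum>p. of_bool (c p) * (1/3::real)^p) - (\<Sum>p. of_bool (d p) * (1/3)^p) = suminf a"
    unfolding a_def left_diff_distrib by (rule suminf_diff[OF sc sc])
  have "suminf a = (\<Sum>p. a (p + Suc q)) + (\<Sum>p<Suc q. a p)"
    by (rule suminf_split_initial_segment[OF sa])
  moreover have "(\<Sum>p<Suc q. a p) = a q"
    using q(3) by (simp add: a_def)
  moreover have "\<bar>a q\<bar> = (1/3)^q"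
    using q(1) by (auto simp: a_def)
  moreover have "\<bar>\<Sum>p. a (p + Suc q)\<bar> \<le> (1/3)^q / 2"
  proof -
    have le: "norm (a (p + Suc q)) \<le> (1/3)^Suc q * (1/3)^p" for p
      by (auto simp: a_def power_add of_bool_def)
    have sg: "summable (\<lambda>p. (1/3)^Suc q * (1/3::real)^p)"
      by (intro summable_mult geo)
    have "norm (\<Sum>p. a (p + Suc q)) \<le> (\<Sum>p. norm (a (p + Suc q)))"
      by (rule summable_norm) (rule summable_comparison_test'[OF sg, of 0], use le in auto)
    also have "\<dots> \<le> (\<Sum>p. (1/3)^Suc q * (1/3::real)^p)"
      by (rule suminf_le[OF le _ sg]) (rule summable_comparison_test'[OF sg, of 0], use le in auto)
    also have "\<dots> = (1/3)^q / 2"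
      using suminf_mult[OF geo, of "(1/3)^Suc q"] by (simp add: suminf_geometric)
    finally show ?thesis by simp
  qed
  ultimately have "\<bar>suminf a\<bar> \<ge> (1/3)^q / 2" by linarith
  moreover have "(1/3::real)^n \<le> (1/3)^q"
    using q(2) \<open>p \<le> n\<close> by (intro power_decreasing) auto
  ultimately show False using close diff by linarith
qed

text \<open>The space is coded by real numbers through ternary expansions whose digits are membership in
  basic open sets. The code is Borel, and on each compact set its inverse is uniformly continuous, so
  Helly's selection theorem on the line can be used. The summand \<open>2 * J x\<close> separates the codes of
  the compact sets exhausting the mass, which makes the closure of all codes locally finite.\<close>

theorem tight_imp_weakly_convergent_subsequence:
  fixes Q :: "nat \<Rightarrow> 'a::polish_space measure"
  assumes prob: "\<And>k. prob_space (Q k)" and sets: "\<And>k. sets (Q k) = sets borel"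
    and tight: "\<And>d. 0 < d \<Longrightarrow> \<exists>K. compact K \<and> (\<forall>k. measure (Q k) (- K) \<le> d)"
  shows "\<exists>r P. strict_mono r \<and> prob_space P \<and> sets P = sets borel \<and>
    weakly_converges (\<lambda>k. Q (r k)) P"
proof -
  interpret prob_space "Q k" for k by fact
  have [measurable_cong]: "sets (Q k) = sets borel" for k by fact
  have sp: "space (Q k) = UNIV" for k
    using sets[of k] by (metis sets_eq_imp_space_eq space_borel)
  have "\<forall>j. \<exists>K. compact K \<and> (\<forall>k. measure (Q k) (- K) \<le> inverse (real (Suc j)))"
    by (intro allI tight) auto
  then obtain K where K: "\<And>j. compact (K j)" "\<And>j k. measure (Q k) (- K j) \<le> inverse (real (Suc j))"
    by metis
  obtain b :: "nat \<Rightarrow> 'a set" where b: "\<And>p. open (b p)"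
    "\<And>x e. 0 < e \<Longrightarrow> \<exists>p. x \<in> b p \<and> b p \<subseteq> ball x e"
    using ex_countable_open_refining_sequence by blast
  define s where "s x = (\<Sum>p. of_bool (x \<in> b p) * (1/3::real)^p)" for x
  define J where "J x = (LEAST j. x \<in> K j)" for x
  define \<sigma> where "\<sigma> x = 2 * real (J x) + s x" for x
  define Y where "Y = (\<Union>j. K j)"
  \<comment> \<open>The sets \<open>E j\<close> split \<open>Y\<close> according to the first
    \<open>K j\<close> that contains the point. Outside \<open>Y\<close> the \<open>LEAST\<close> in
    \<open>J\<close> is unspecified, which affects only a null set.\<close>
  define E where "E j = {x \<in> Y. J x = j}" for j
  have Kc [measurable]: "K j \<in> sets borel" for j
    using borel_compact[OF K(1)[of j]] by simp
  have [measurable]: "b p \<in> sets borel" for p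
    using borel_open[OF b(1)[of p]] by simp
  have [measurable]: "J \<in> measurable borel (count_space UNIV)"
    unfolding J_def by measurable
  have [measurable]: "s \<in> borel_measurable borel"
    unfolding s_def by measurable
  have [measurable]: "\<sigma> \<in> borel_measurable borel"
    unfolding \<sigma>_def by measurable
  have [measurable]: "Y \<in> sets borel"
    unfolding Y_def by measurable
  have s_bounds: "0 \<le> s x" "s x \<le> 3/2" for x
  proof -
    have geo: "summable (\<lambda>p. (1/3::real)^p)" by (rule summable_geometric) simp
    have sc: "summable (\<lambda>p. of_bool (x \<in> b p) * (1/3::real)^p)"
      by (rule summable_comparison_test'[OF geo, of 0]) auto
    show "0 \<le> s x" unfolding s_def by (rule suminf_nonneg[OF sc]) auto
    have "s x \<le> (\<Sum>p. (1/3::real)^p)"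
      unfolding s_def by (rule suminf_le[OF _ sc geo]) auto
    then show "s x \<le> 3/2" by (simp add: suminf_geometric)
  qed
  have EK: "E j \<subseteq> K j" for j
    unfolding E_def Y_def J_def by (auto intro: LeastI)
  have sep: "\<exists>d>0. \<forall>x\<in>E j. \<forall>y\<in>E j. \<bar>\<sigma> x - \<sigma> y\<bar> < d \<longrightarrow> dist x y < e" if e: "0 < e" for e j
  proof -
    \<comment> \<open>Finitely many basic sets of diameter controlled by \<open>e\<close> cover
      \<open>K j\<close>. If two codes agree in all digits up to the largest index \<open>n\<close>
      used, a covering set that contains \<open>x\<close> also contains \<open>y\<close>.\<close>
    define I where "I = {p. \<forall>x\<in>b p. \<forall>y\<in>b p. dist x y < e}"
    have "K j \<subseteq> (\<Union>p\<in>I. b p)"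
    proof
      fix x assume "x \<in> K j"
      obtain p where p: "x \<in> b p" "b p \<subseteq> ball x (e/2)"
        using b(2)[of "e/2" x] e by auto
      have "dist y z < e" if "y \<in> b p" "z \<in> b p" for y z
        using p(2) that by (intro dist_triangle_half_r[of x y e z]) auto
      then show "x \<in> (\<Union>p\<in>I. b p)" using p(1) by (auto simp: I_def)
    qed
    then obtain I' where I': "I' \<subseteq> I" "finite I'" "K j \<subseteq> (\<Union>p\<in>I'. b p)"
      using compactE_image[OF K(1), of I b j] b(1) by metis
    define n where "n = Max (insert 0 I')"
    show ?thesis
    proof (intro exI[of _ "(1/3)^n / 2"] conjI ballI impI)
      fix x y assume xy: "x \<in> E j" "y \<in> E j" and cl: "\<bar>\<sigma> x - \<sigma> y\<bar> < (1/3)^n / 2"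
      obtain p where p: "p \<in> I'" "x \<in> b p" using I'(3) EK xy(1) by blast
      have "p \<le> n" using p(1) I'(2) by (auto simp: n_def)
      have "\<bar>s x - s y\<bar> < (1/3)^n / 2" using cl xy by (auto simp: \<sigma>_def E_def)
      then have "(x \<in> b p) = (y \<in> b p)"
        unfolding s_def by (rule ternary_code_bits_eq[OF _ \<open>p \<le> n\<close>])
      then show "dist x y < e" using p I'(1) by (auto simp: I_def)
    qed simp
  qed
  have inj: "inj_on \<sigma> (E j)" for j
  proof (rule inj_onI)
    fix x y assume xy: "x \<in> E j" "y \<in> E j" "\<sigma> x = \<sigma> y"
    have "dist x y < e" if "0 < e" for e
      using sep[OF that, of j] xy by auto
    then show "x = y" by (metis dist_pos_lt less_irrefl)
  qed
  \<comment> \<open>The image of \<open>E j\<close> need not be closed, so a weak limit of the coded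
    measures may charge its closure. Uniform continuity extends the inverse of the code to that
    closure.\<close>
  have "uniformly_continuous_on (\<sigma> ` E j) (inv_into (E j) \<sigma>)" for j
    unfolding uniformly_continuous_on_def
  proof (intro allI impI)
    fix e :: real assume "0 < e"
    then obtain d where "d > 0" "\<forall>x\<in>E j. \<forall>y\<in>E j. \<bar>\<sigma> x - \<sigma> y\<bar> < d \<longrightarrow> dist x y < e"
      using sep[of e j] by blast
    then show "\<exists>d>0. \<forall>x\<in>\<sigma> ` E j. \<forall>x'\<in>\<sigma> ` E j. dist x' x < d \<longrightarrow>
        dist (inv_into (E j) \<sigma> x') (inv_into (E j) \<sigma> x) < e"
      using inj[of j] by (intro exI[of _ d]) (auto simp: dist_real_def)
  qed
  then have "\<exists>\<phi>. uniformly_continuous_on (closure (\<sigma> ` E j)) \<phi> \<and> (\<forall>x\<in>E j. \<phi> (\<sigma> x) = x)" for j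
    using uniformly_continuous_on_extension_on_closure[of "\<sigma> ` E j" "inv_into (E j) \<sigma>"] inj[of j]
    by (metis inv_into_f_f imageI)
  then obtain \<phi> where \<phi>: "\<And>j. uniformly_continuous_on (closure (\<sigma> ` E j)) (\<phi> j)"
    "\<And>j x. x \<in> E j \<Longrightarrow> \<phi> j (\<sigma> x) = x"
    by metis
  define C where "C j = closure (\<sigma> ` E j)" for j
  have C_sub: "C j \<subseteq> {2 * real j .. 2 * real j + 3/2}" for j
    unfolding C_def using s_bounds by (intro closure_minimal) (auto simp: E_def \<sigma>_def)
  have C_index: "nat \<lfloor>y / 2\<rfloor> = j" if "y \<in> C j" for y j
  proof -
    have "\<lfloor>y / 2\<rfloor> = int j"
      using C_sub[of j] that by (intro floor_unique) auto
    then show ?thesis by simp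
  qed
  define CU where "CU = (\<Union>j. C j)"
  \<comment> \<open>The blocks \<open>C j\<close> lie in \<open>[2j, 2j + 3/2]\<close>, hence the
    floor of \<open>y / 2\<close> recovers the block index and the local inverses glue to one
    function.\<close>
  define \<Phi> where "\<Phi> y = \<phi> (nat \<lfloor>y / 2\<rfloor>) y" for y
  have \<Phi>_C: "\<Phi> y = \<phi> j y" if "y \<in> C j" for y j
    using C_index[OF that] by (simp add: \<Phi>_def)
  have locfin: "\<exists>j. l \<in> C j \<and> (\<forall>\<^sub>F n in sequentially. y n \<in> C j)"
    if y: "\<And>n. y n \<in> CU" "y \<longlonglongrightarrow> l" for y l
  proof -
    \<comment> \<open>Consecutive blocks are separated by gaps of length at least
      \<open>1/2\<close>; terms within \<open>1/8\<close> of the limit differ by less than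
      \<open>1/4\<close> and so lie in one block.\<close>
    obtain N where N: "\<And>n. n \<ge> N \<Longrightarrow> dist (y n) l < 1/8"
      using y(2) unfolding lim_sequentially by (meson zero_less_divide_1_iff zero_less_numeral)
    obtain j where j: "y N \<in> C j" using y(1)[of N] by (auto simp: CU_def)
    have "y n \<in> C j" if "n \<ge> N" for n
    proof -
      obtain i where i: "y n \<in> C i" using y(1)[of n] by (auto simp: CU_def)
      have "2 * real i \<le> y n" "y n \<le> 2 * real i + 3/2" "2 * real j \<le> y N" "y N \<le> 2 * real j + 3/2"
        using i j C_sub[of i] C_sub[of j] by auto
      moreover have "\<bar>y n - y N\<bar> < 1/4"
        using N[OF that] N[of N] unfolding dist_real_def by linarith
      ultimately have "i = j" by linarith
      then show ?thesis using i by simp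
    qed
    then have ev: "\<forall>\<^sub>F n in sequentially. y n \<in> C j"
      by (auto simp: eventually_sequentially)
    moreover have "l \<in> C j"
      by (rule Lim_in_closed_set[OF _ ev _ y(2)]) (auto simp: C_def)
    ultimately show ?thesis by blast
  qed
  have CU_closed: "closed CU"
    unfolding closed_sequential_limits
  proof (intro allI impI, elim conjE)
    fix y l assume "\<forall>n. y n \<in> CU" "y \<longlonglongrightarrow> l"
    then show "l \<in> CU" using locfin[of y l] by (auto simp: CU_def)
  qed
  have \<Phi>_cont: "continuous_on CU \<Phi>"
    unfolding continuous_on_sequentially
  proof (intro allI ballI impI, elim conjE)
    fix y l assume "l \<in> CU" and y: "\<forall>n. y n \<in> CU" "y \<longlonglongrightarrow> l"
    obtain j where j: "l \<in> C j" "\<forall>\<^sub>F n in sequentially. y n \<in> C j"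
      using locfin[of y l] y by auto
    have "(\<lambda>n. \<phi> j (y n)) \<longlonglongrightarrow> \<phi> j l"
      by (rule continuous_on_tendsto_compose[OF _ y(2) j])
        (use \<phi>(1)[of j] in \<open>auto simp: C_def intro: uniformly_continuous_imp_continuous\<close>)
    then have "(\<lambda>n. \<Phi> (y n)) \<longlonglongrightarrow> \<phi> j l"
      by (rule Lim_transform_eventually) (use j(2) in eventually_elim, simp add: \<Phi>_C)
    then show "(\<Phi> \<circ> y) \<longlonglongrightarrow> \<Phi> l" using \<Phi>_C[OF j(1)] by (simp add: o_def)
  qed
  have \<sigma>_CU: "\<sigma> x \<in> CU" and \<Phi>_\<sigma>: "\<Phi> (\<sigma> x) = x" if "x \<in> Y" for x
  proof -
    have "x \<in> E (J x)" using that by (simp add: E_def)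
    then have "\<sigma> x \<in> C (J x)" unfolding C_def by (intro subsetD[OF closure_subset] imageI)
    then show "\<sigma> x \<in> CU" "\<Phi> (\<sigma> x) = x"
      using \<Phi>_C[of "\<sigma> x" "J x"] \<phi>(2)[OF \<open>x \<in> E (J x)\<close>] by (auto simp: CU_def)
  qed
  have AE_Y: "AE x in Q k. x \<in> Y" for k
  proof (rule AE_I[of _ _ "- Y"])
    have "measure (Q k) (- Y) \<le> inverse (real (Suc j))" for j
      by (rule order_trans[OF finite_measure_mono K(2)[of k j]]) (auto simp: Y_def)
    then have "measure (Q k) (- Y) \<le> 0"
      by (intro LIMSEQ_le_const[OF LIMSEQ_inverse_real_of_nat]) auto
    then show "emeasure (Q k) (- Y) = 0"
      by (simp add: emeasure_eq_measure measure_le_0_iff)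
  qed (auto simp: sets)

  define Q' where "Q' k = distr (Q k) borel \<sigma>" for k
  have rd: "real_distribution (Q' k)" for k
    unfolding Q'_def by (intro real_distribution_distr) measurable
  interpret Q': real_distribution "Q' k" for k by (rule rd)
  have "tight Q'"
    unfolding tight_def
  proof (intro conjI allI impI rd)
    fix e :: real assume "0 < e"
    then obtain j where j: "inverse (real (Suc j)) < e"
      using reals_Archimedean by blast
    \<comment> \<open>On \<open>K j\<close> the index \<open>J\<close> is at most \<open>j\<close>,
      so codes stay below \<open>2j + 2\<close>; the left end \<open>-1\<close> puts the code 0
      inside a half-open interval.\<close>
    have "1 - e < measure (Q' k) {- 1 <.. 2 * real j + 2}" for k
    proof -
      have "1 - e < measure (Q k) (K j)"
        using K(2)[of k j] j prob_compl[of "K j" k] by (auto simp: sp sets Compl_eq_Diff_UNIV)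
      also have "\<dots> \<le> measure (Q k) (\<sigma> -` {- 1 <.. 2 * real j + 2} \<inter> space (Q k))"
      proof (rule finite_measure_mono)
        have "J x \<le> j" if "x \<in> K j" for x
          unfolding J_def using that by (rule Least_le)
        then have "- 1 < \<sigma> x \<and> \<sigma> x \<le> 2 * real j + 2" if "x \<in> K j" for x
          using that s_bounds[of x] by (fastforce simp: \<sigma>_def)
        then show "K j \<subseteq> \<sigma> -` {- 1<..2 * real j + 2} \<inter> space (Q k)"
          by (auto simp: sp)
      qed measurable
      also have "\<dots> = measure (Q' k) {- 1 <.. 2 * real j + 2}"
        unfolding Q'_def by (subst measure_distr) auto
      finally show ?thesis .
    qed
    then show "\<exists>a b. a < b \<and> (\<forall>k. 1 - e < measure (Q' k) {a<..b})"
      by (intro exI[of _ "-1"] exI[of _ "2 * real j + 2"]) auto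
  qed
  from tight_imp_convergent_subsubsequence[OF this strict_mono_id]
  obtain r M where r: "strict_mono (r :: nat \<Rightarrow> nat)" and M: "real_distribution M"
    and conv: "weak_conv_m (\<lambda>k. Q' (r k)) M"
    by (auto simp: o_def)
  interpret M: real_distribution M by fact
  have conv_int: "(\<lambda>k. \<integral>y. G y \<partial>Q' (r k)) \<longlonglongrightarrow> (\<integral>y. G y \<partial>M)"
    if "continuous_on UNIV G" "\<And>y. norm (G y) \<le> c" for G :: "real \<Rightarrow> real" and c
    by (rule weak_conv_imp_integral_bdd_continuous_conv[OF rd M conv])
      (use that in \<open>auto simp: continuous_on_eq_continuous_at\<close>)
  have int_Q': "(\<integral>y. G y \<partial>Q' k) = (\<integral>x. G (\<sigma> x) \<partial>Q k)" if [measurable]: "G \<in> borel_measurable borel" for G :: "real \<Rightarrow> real" and k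
    unfolding Q'_def by (rule integral_distr) auto
  have "Y \<noteq> {}"
    using AE_Y[of 0] prob_space.AE_False[OF prob] by auto
  then have CU_ne: "CU \<noteq> {}" using \<sigma>_CU by blast
  have [measurable]: "CU \<in> sets borel" using CU_closed by auto
  have AE_CU: "AE y in M. y \<in> CU"
  proof -
    \<comment> \<open>A bounded continuous function whose zero set is exactly \<open>CU\<close>: its
      mean is 0 for all coded measures, hence for \<open>M\<close>. Here \<open>CU\<close> has to be
      nonempty, as the distance to the empty set is 0 by convention.\<close>
    define G where "G y = min 1 (infdist y CU)" for y
    have cont: "continuous_on UNIV G" unfolding G_def by (intro continuous_intros)
    have [measurable]: "G \<in> borel_measurable borel"
      using cont by (rule borel_measurable_continuous_onI)
    have G_bd: "0 \<le> G y" "G y \<le> 1" for y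
      by (auto simp: G_def infdist_nonneg)
    have "(\<integral>y. G y \<partial>Q' k) = 0" for k
    proof -
      have "(\<integral>x. G (\<sigma> x) \<partial>Q k) = (\<integral>x. 0 \<partial>Q k)"
      proof (rule integral_cong_AE)
        show "AE x in Q k. G (\<sigma> x) = 0"
          using AE_Y[of k] by eventually_elim (simp add: G_def \<sigma>_CU)
      qed simp_all
      then show ?thesis by (simp add: int_Q')
    qed
    moreover have "(\<lambda>k. \<integral>y. G y \<partial>Q' (r k)) \<longlonglongrightarrow> (\<integral>y. G y \<partial>M)"
      by (rule conv_int[OF cont, of 1]) (use G_bd in auto)
    ultimately have "(\<integral>y. G y \<partial>M) = 0"
      by (simp add: LIMSEQ_const_iff)
    moreover have "integrable M G"
      by (rule M.integrable_const_bound[of _ 1]) (use G_bd in auto)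
    ultimately have "AE y in M. G y = 0"
      using integral_nonneg_eq_0_iff_AE[of M G] G_bd by auto
    then show ?thesis
      by eventually_elim
        (use CU_closed CU_ne in \<open>auto simp: G_def min_def in_closed_iff_infdist_zero split: if_splits\<close>)
  qed
  obtain x0 where "x0 \<in> Y" using \<open>Y \<noteq> {}\<close> by blast
  \<comment> \<open>\<open>x0\<close> fills in the \<open>M\<close>-null complement of
    \<open>CU\<close>, where no decoding exists.\<close>
  define \<psi> where "\<psi> y = (if y \<in> CU then \<Phi> y else x0)" for y
  have [measurable]: "\<psi> \<in> borel_measurable borel"
    unfolding \<psi>_def by (rule borel_measurable_continuous_on_if) (use \<Phi>_cont in auto)
  define P where "P = distr M borel \<psi>"
  have P: "prob_space P" unfolding P_def by (rule M.prob_space_distr) simp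
  have "weakly_converges (\<lambda>k. Q (r k)) P"
    unfolding weakly_converges_def
  proof (intro allI impI, elim conjE)
    fix g :: "'a \<Rightarrow> real" assume g: "continuous_on UNIV g" "bounded (range g)"
    have [measurable]: "g \<in> borel_measurable borel"
      using g(1) by (rule borel_measurable_continuous_onI)
    obtain c where c: "0 < c" "\<And>x. norm (g x) \<le> c"
      using g(2) unfolding bounded_pos by auto
    have "continuous_on CU (\<lambda>y. g (\<Phi> y))"
      by (rule continuous_on_compose2[OF g(1) \<Phi>_cont]) auto
    \<comment> \<open>\<open>g (\<Phi> y)\<close> is continuous only on the closed set
      \<open>CU\<close>; its Tietze extension is a test function on the whole line with the same
      bound and the same integrals, since all measures involved live on \<open>CU\<close>.\<close>
    then obtain G where G: "continuous_on UNIV G" "\<And>y. y \<in> CU \<Longrightarrow> G y = g (\<Phi> y)"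
      "\<And>y. norm (G y) \<le> c"
      by (rule Tietze[of CU "\<lambda>y. g (\<Phi> y)" UNIV c]) (use CU_closed c in auto)
    have [measurable]: "G \<in> borel_measurable borel"
      using G(1) by (rule borel_measurable_continuous_onI)
    have "(\<integral>x. g x \<partial>Q k) = (\<integral>y. G y \<partial>Q' k)" for k
      unfolding int_Q'[OF \<open>G \<in> borel_measurable borel\<close>]
      by (rule integral_cong_AE) (use AE_Y[of k] G(2) \<sigma>_CU \<Phi>_\<sigma> in auto)
    moreover have "(\<integral>x. g x \<partial>P) = (\<integral>y. G y \<partial>M)"
    proof -
      have "(\<integral>x. g x \<partial>P) = (\<integral>y. g (\<psi> y) \<partial>M)"
        unfolding P_def by (rule integral_distr) simp_all
      also have "\<dots> = (\<integral>y. G y \<partial>M)"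
      proof (rule integral_cong_AE)
        show "AE y in M. g (\<psi> y) = G y"
          using AE_CU by eventually_elim (simp add: G(2) \<psi>_def)
      qed simp_all
      finally show ?thesis .
    qed
    ultimately show "(\<lambda>k. \<integral>x. g x \<partial>Q (r k)) \<longlonglongrightarrow> (\<integral>x. g x \<partial>P)"
      using conv_int[OF G(1,3)] by simp
  qed
  moreover have "sets P = sets borel" by (simp add: P_def)
  ultimately show ?thesis using r P by blast
qed

section \<open>Tightness from sequential precompactness\<close>

lemma ex_strict_mono_compose:
  fixes \<kappa> :: "nat \<Rightarrow> nat"
  assumes "filterlim \<kappa> at_top sequentially"
  obtains \<rho> :: "nat \<Rightarrow> nat" where "strict_mono \<rho>" "strict_mono (\<kappa> \<circ> \<rho>)"
proof -
  have "\<exists>\<rho>. \<forall>n::nat. True \<and> \<rho> n < \<rho> (Suc n) \<and> \<kappa> (\<rho> n) < \<kappa> (\<rho> (Suc n))"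
  proof (rule dependent_nat_choice)
    fix x n :: nat
    have "\<forall>\<^sub>F y in sequentially. x < y" by (rule eventually_gt_at_top)
    moreover have "\<forall>\<^sub>F y in sequentially. Suc (\<kappa> x) \<le> \<kappa> y"
      using assms unfolding filterlim_at_top by blast
    ultimately have "\<forall>\<^sub>F y in sequentially. x < y \<and> \<kappa> x < \<kappa> y"
      by eventually_elim simp
    then show "\<exists>y. True \<and> x < y \<and> \<kappa> x < \<kappa> y"
      by (auto dest: eventually_happens)
  qed simp
  then obtain \<rho> where "\<forall>n::nat. \<rho> n < \<rho> (Suc n) \<and> \<kappa> (\<rho> n) < \<kappa> (\<rho> (Suc n))" by blast
  then show ?thesis by (intro that[of \<rho>]) (auto simp: strict_mono_Suc_iff)
qed

text \<open>A sequence in the closure is replaced by points of \<open>S\<close> within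
  \<open>1 / (n + 1)\<close>, which have the same subsequential limits. The limits in the assumption
  may lie outside \<open>S\<close>.\<close>

lemma compact_closure_sequentially:
  fixes S :: "'a::metric_space set"
  assumes S: "\<And>y :: nat \<Rightarrow> 'a. (\<And>n. y n \<in> S) \<Longrightarrow> \<exists>l r. strict_mono r \<and> (\<lambda>n. y (r n)) \<longlonglongrightarrow> l"
  shows "compact (closure S)"
  unfolding compact_eq_seq_compact_metric seq_compact_def
proof (intro allI impI)
  fix x :: "nat \<Rightarrow> 'a" assume x: "\<forall>n. x n \<in> closure S"
  have "\<exists>y\<in>S. dist y (x n) < inverse (real (Suc n))" for n
    using x by (meson closure_approachable inverse_positive_iff_positive of_nat_0_less_iff zero_less_Suc)
  then obtain y where y: "\<And>n. y n \<in> S" "\<And>n. dist (y n) (x n) < inverse (real (Suc n))"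
    by metis
  obtain l r where r: "strict_mono r" "(\<lambda>n. y (r n)) \<longlonglongrightarrow> l"
    using S[of y] y(1) by blast
  have "(\<lambda>n. dist (x n) (y n)) \<longlonglongrightarrow> 0"
    by (rule tendsto_sandwich[OF _ _ tendsto_const LIMSEQ_inverse_real_of_nat])
      (use y(2) in \<open>auto simp: dist_commute less_imp_le intro!: always_eventually\<close>)
  then have "(\<lambda>n. dist (x (r n)) (y (r n))) \<longlonglongrightarrow> 0"
    by (rule LIMSEQ_subseq_LIMSEQ[OF _ r(1), unfolded o_def])
  moreover have "(\<lambda>n. dist (y (r n)) l) \<longlonglongrightarrow> 0"
    using r(2) by (rule iffD1[OF tendsto_dist_iff])
  ultimately have "(\<lambda>n. dist (x (r n)) (y (r n)) + dist (y (r n)) l) \<longlonglongrightarrow> 0"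
    using tendsto_add by fastforce
  then have "(\<lambda>n. dist (x (r n)) l) \<longlonglongrightarrow> 0"
    by (rule tendsto_sandwich[OF _ _ tendsto_const, rotated 2]) (auto intro!: always_eventually dist_triangle)
  then have lim: "(\<lambda>n. x (r n)) \<longlonglongrightarrow> l"
    by (rule iffD2[OF tendsto_dist_iff])
  moreover have "l \<in> closure S"
    by (rule closed_sequentially[OF closed_closure _ lim]) (use x in auto)
  ultimately show "\<exists>l\<in>closure S. \<exists>r. strict_mono r \<and> (x \<circ> r) \<longlonglongrightarrow> l"
    using r(1) by (auto simp: o_def)
qed

text \<open>Precompactness is available only for points picked along strictly increasing stages, so
  an individual \<open>Y k\<close> may be far from compact. Inner regularity replaces each
  \<open>Y k\<close> by a compact subset at the price of a second \<open>d\<close>. A sequence in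
  the union of these compact sets either has stages tending to infinity, where the assumption
  applies after thinning, or returns infinitely often to finitely many of them.\<close>

lemma tight_of_sequentially_precompact:
  fixes Q :: "nat \<Rightarrow> 'a::polish_space measure"
  assumes prob: "\<And>k. prob_space (Q k)" and sets: "\<And>k. sets (Q k) = sets borel"
    and Y: "\<And>k. Y k \<in> sets borel" "\<And>k. measure (Q k) (- Y k) \<le> d" and d: "0 < d"
    and precompact: "\<And>(t :: nat \<Rightarrow> nat) v. strict_mono t \<Longrightarrow> (\<And>j. v j \<in> Y (t j)) \<Longrightarrow>
      \<exists>(r :: nat \<Rightarrow> nat) w. strict_mono r \<and> (\<lambda>j. v (r j)) \<longlonglongrightarrow> w"
  shows "\<exists>K. compact K \<and> (\<forall>k. measure (Q k) (- K) \<le> 2 * d)"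
proof -
  interpret prob_space "Q k" for k by fact
  have sp: "space (Q k) = UNIV" for k
    using sets[of k] by (metis sets_eq_imp_space_eq space_borel)
  have "\<exists>K. K \<subseteq> Y k \<and> compact K \<and> measure (Q k) (- K) \<le> 2 * d" for k
  proof -
    have eq: "emeasure (Q k) (Y k) = (SUP K \<in> {K. K \<subseteq> Y k \<and> compact K}. emeasure (Q k) K)"
      by (rule inner_regular) (use sets Y in \<open>auto simp: emeasure_eq_measure\<close>)
    have 1: "measure (Q k) (Y k) \<ge> 1 - d"
      using Y(2)[of k] prob_compl[of "Y k" k] Y(1)[of k] by (simp add: sp sets Compl_eq_Diff_UNIV)
    show ?thesis
    \<comment> \<open>If \<open>2 * d\<close> is at least 1 the empty set works; otherwise
      \<open>1 - 2 * d\<close> is positive and \<open>ennreal\<close> does not truncate it.\<close>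
    proof (cases "1 \<le> 2 * d")
      case True
      then show ?thesis by (intro exI[of _ "{}"] conjI order_trans[OF prob_le_1 True]) auto
    next
      case False
      then have "ennreal (1 - 2 * d) < emeasure (Q k) (Y k)"
        using 1 d by (simp add: emeasure_eq_measure ennreal_less_iff)
      then obtain K where K: "K \<subseteq> Y k" "compact K" "ennreal (1 - 2 * d) < emeasure (Q k) K"
        unfolding eq less_SUP_iff by blast
      then have "1 - 2 * d < measure (Q k) K"
        using False by (simp add: emeasure_eq_measure ennreal_less_iff)
      then show ?thesis
        using K(1,2) prob_compl[of K k] borel_compact[of K]
        by (intro exI[of _ K]) (auto simp: sp sets Compl_eq_Diff_UNIV)
    qed
  qed
  then obtain K where K: "\<And>k. K k \<subseteq> Y k" "\<And>k. compact (K k)" "\<And>k. measure (Q k) (- K k) \<le> 2 * d"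
    by metis
  have "compact (closure (\<Union>k. K k))"
  proof (rule compact_closure_sequentially)
    fix y :: "nat \<Rightarrow> 'a" assume "\<And>n. y n \<in> (\<Union>k. K k)"
    then have "\<forall>n. \<exists>k. y n \<in> K k" by auto
    then obtain \<kappa> where \<kappa>: "\<And>n. y n \<in> K (\<kappa> n)" by metis
    show "\<exists>l r. strict_mono r \<and> (\<lambda>n. y (r n)) \<longlonglongrightarrow> l"
    proof (cases "filterlim \<kappa> at_top sequentially")
      case True
      then obtain \<rho> :: "nat \<Rightarrow> nat" where \<rho>: "strict_mono \<rho>" "strict_mono (\<kappa> \<circ> \<rho>)"
        by (rule ex_strict_mono_compose)
      obtain r w where "strict_mono r" "(\<lambda>j. y (\<rho> (r j))) \<longlonglongrightarrow> w"
        using precompact[OF \<rho>(2), of "y \<circ> \<rho>"] \<kappa> K(1) by (auto simp: subset_eq)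
      then show ?thesis using \<rho>(1) strict_mono_o[of \<rho> r] by (auto simp: o_def)
    next
      case False
      then obtain N where N: "\<exists>\<^sub>F n in sequentially. \<kappa> n \<le> N"
        unfolding filterlim_at_top by (auto simp: not_eventually not_le intro: frequently_elim1 less_imp_le)
      define \<rho> where "\<rho> = enumerate {n. \<kappa> n \<le> N}"
      have inf: "infinite {n. \<kappa> n \<le> N}"
        using N by (simp add: frequently_cofinite flip: cofinite_eq_sequentially)
      have \<rho>: "strict_mono \<rho>" "\<kappa> (\<rho> n) \<le> N" for n
        unfolding \<rho>_def using inf strict_mono_enumerate enumerate_in_set[OF inf, of n] by auto
      have "compact (\<Union>k\<le>N. K k)" using K(2) by (intro compact_UN) auto
      moreover have "\<forall>n. y (\<rho> n) \<in> (\<Union>k\<le>N. K k)" using \<kappa> \<rho>(2) by auto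
      ultimately obtain l r where "strict_mono r" "((\<lambda>n. y (\<rho> n)) \<circ> r) \<longlonglongrightarrow> l"
        unfolding compact_eq_seq_compact_metric seq_compact_def by meson
      then show ?thesis using \<rho>(1) strict_mono_o[of \<rho> r] by (auto simp: o_def)
    qed
  qed
  moreover have "measure (Q k) (- closure (\<Union>k. K k)) \<le> 2 * d" for k
  proof (rule order_trans[OF finite_measure_mono K(3)])
    show "- closure (\<Union>k. K k) \<subseteq> - K k" using closure_subset[of "\<Union>k. K k"] by auto
    show "- K k \<in> Sigma_Algebra.sets (Q k)"
      using borel_comp[OF borel_compact[OF K(2)[of k]]] by (simp add: sets)
  qed
  ultimately show ?thesis by blast
qed

section \<open>Passing to the limit with varying integrands\<close>

lemma nn_integral_SUP_min:
  fixes f :: "'a \<Rightarrow> ennreal"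
  assumes [measurable]: "f \<in> borel_measurable M"
  shows "(\<integral>\<^sup>+x. f x \<partial>M) = (SUP n::nat. \<integral>\<^sup>+x. min (f x) (of_nat n) \<partial>M)"
proof -
  have "f x = (SUP n::nat. min (f x) (of_nat n))" for x
    by (simp add: inf_min[symmetric] inf_SUP[symmetric] ennreal_SUP_of_nat_eq_top)
  then have "(\<integral>\<^sup>+x. f x \<partial>M) = (\<integral>\<^sup>+x. (SUP n::nat. min (f x) (of_nat n)) \<partial>M)"
    by simp
  also have "\<dots> = (SUP n::nat. \<integral>\<^sup>+x. min (f x) (of_nat n) \<partial>M)"
    by (rule nn_integral_monotone_convergence_SUP)
      (auto simp: incseq_def le_fun_def min.coboundedI2)
  finally show ?thesis .
qed

text \<open>The truncated envelopes \<open>h j\<close> below are \<open>j\<close>-Lipschitz minorants of \<open>min M (g k)\<close> on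
  \<open>Y k\<close> for all \<open>k \<ge> j\<close>; the \<open>\<Gamma>\<close>-liminf inequality says that they increase to at least
  \<open>min M f\<close>, so weak convergence can be applied to each of them.\<close>

lemma nn_integral_le_liminf_of_Gamma_liminf:
  fixes Q :: "nat \<Rightarrow> 'a::polish_space measure" and g :: "nat \<Rightarrow> 'a \<Rightarrow> ennreal"
  assumes prob: "\<And>k. prob_space (Q k)" and sets: "\<And>k. sets (Q k) = sets borel"
    and P: "prob_space P" "sets P = sets borel" and conv: "weakly_converges Q P"
    and f: "f \<in> borel_measurable borel"
    and g: "\<And>k. g k \<in> borel_measurable borel"
    and Gamma: "\<And>d. 0 < d \<Longrightarrow> \<exists>Y. (\<forall>k. Y k \<in> sets borel \<and> measure (Q k) (- Y k) \<le> d) \<and>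
      (\<forall>t v w. strict_mono t \<longrightarrow> (\<forall>j. v j \<in> Y (t j)) \<longrightarrow> v \<longlonglongrightarrow> w \<longrightarrow>
        f w \<le> liminf (\<lambda>j. g (t j) (v j)))"
  shows "(\<integral>\<^sup>+x. f x \<partial>P) \<le> liminf (\<lambda>k. \<integral>\<^sup>+x. g k x \<partial>Q k)"
proof -
  interpret prob_space "Q k" for k by fact
  interpret P: prob_space P by fact
  have [measurable_cong]: "sets (Q k) = sets borel" "sets P = sets borel" for k by fact+
  note [measurable] = f g
  let ?L = "liminf (\<lambda>k. \<integral>\<^sup>+x. g k x \<partial>Q k)"
  \<comment> \<open>The error \<open>M * d\<close> bounds what the truncated integrand can
    contribute off the good sets. At the end \<open>d\<close> is made small for fixed
    \<open>M\<close>, and only then is the truncation removed.\<close>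
  have bound: "(\<integral>\<^sup>+x. min (f x) (ennreal M) \<partial>P) \<le> ?L + ennreal (M * d)" if M: "0 < M" and d: "0 < d" for M d
  proof -
    obtain Y where Y: "\<forall>k. Y k \<in> sets borel \<and> measure (Q k) (- Y k) \<le> d"
      and lim: "\<forall>t v w. strict_mono t \<longrightarrow> (\<forall>j. v j \<in> Y (t j)) \<longrightarrow> v \<longlonglongrightarrow> w \<longrightarrow>
        f w \<le> liminf (\<lambda>j. g (t j) (v j))"
      using Gamma[OF d] by blast
    have [measurable]: "Y k \<in> sets borel" for k using Y by simp
    define c where "c k y = enn2real (min (ennreal M) (g k y))" for k y
    have c_eq: "ennreal (c k y) = min (ennreal M) (g k y)" and c_nonneg: "0 \<le> c k y" for k y
      by (simp_all add: c_def ennreal_enn2real_if min_def top_unique)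
    \<comment> \<open>Including \<open>M\<close> keeps the set nonempty and the infimum at most
      \<open>M\<close>, even when no \<open>Y k\<close> with \<open>k \<ge> j\<close> has
      points.\<close>
    define H where "H j x = insert M {c k y + real j * dist x y | k y. j \<le> k \<and> y \<in> Y k}" for j x
    define h where "h j x = Inf (H j x)" for j x
    have bdd: "bdd_below (H j x)" for j x
      using c_nonneg M by (intro bdd_belowI[of _ 0]) (auto simp: H_def)
    have h_le_M: "h j x \<le> M" for j x
      unfolding h_def by (rule cInf_lower[OF _ bdd]) (simp add: H_def)
    have h_le: "h j x \<le> c k y + real j * dist x y" if "j \<le> k" "y \<in> Y k" for j x k y
      unfolding h_def by (rule cInf_lower[OF _ bdd]) (use that in \<open>auto simp: H_def\<close>)
    have h_greatest: "z \<le> h j x"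
      if "z \<le> M" "\<And>k y. j \<le> k \<Longrightarrow> y \<in> Y k \<Longrightarrow> z \<le> c k y + real j * dist x y" for z j x
      unfolding h_def by (rule cInf_greatest) (use that in \<open>auto simp: H_def\<close>)
    have h_nonneg: "0 \<le> h j x" for j x
      by (rule h_greatest) (use M c_nonneg in auto)
    have h_mono: "h i x \<le> h j x" if "i \<le> j" for i j x
    proof (rule h_greatest[OF h_le_M])
      fix k y assume "j \<le> k" "y \<in> Y k"
      then have "h i x \<le> c k y + real i * dist x y" using that by (intro h_le) auto
      also have "\<dots> \<le> c k y + real j * dist x y"
        using that by (intro add_left_mono mult_right_mono) auto
      finally show "h i x \<le> c k y + real j * dist x y" .
    qed
    have h_lip: "h j x - real j * dist x x' \<le> h j x'" for j x x'
    proof (rule h_greatest)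
      show "h j x - real j * dist x x' \<le> M"
        using h_le_M[of j x] by (smt (verit) mult_nonneg_nonneg of_nat_0_le_iff zero_le_dist)
      fix k y assume "j \<le> k" "y \<in> Y k"
      then have "h j x \<le> c k y + real j * dist x y" by (rule h_le)
      also have "\<dots> \<le> c k y + real j * (dist x x' + dist x' y)"
        by (intro add_left_mono mult_left_mono dist_triangle) auto
      finally show "h j x - real j * dist x x' \<le> c k y + real j * dist x' y"
        by (simp add: distrib_left)
    qed
    have h_cont: "continuous_on UNIV (h j)" for j
    proof (rule lipschitz_on_continuous_on)
      show "(real j)-lipschitz_on UNIV (h j)"
      proof (rule lipschitz_onI)
        fix x y show "dist (h j x) (h j y) \<le> real j * dist x y"
          using h_lip[of j x y] h_lip[of j y x] by (simp add: dist_real_def dist_commute abs_le_iff)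
      qed simp
    qed
    then have [measurable]: "h j \<in> borel_measurable borel" for j
      by (rule borel_measurable_continuous_onI)
    have sup: "min (f x) (ennreal M) \<le> (SUP j. ennreal (h j x))" for x
    proof (rule ccontr)
      assume "\<not> ?thesis"
      then obtain a where a: "(SUP j. ennreal (h j x)) < a" "a < min (f x) (ennreal M)"
        using dense[of "SUP j. ennreal (h j x)" "min (f x) (ennreal M)"] by (auto simp: not_le)
      then have "a < top" using less_trans[of a "ennreal M" top] by simp
      then obtain r where r: "0 \<le> r" "a = ennreal r" by (cases a rule: ennreal_cases) auto
      have rM: "r < M" using a(2) r by (simp add: ennreal_less_iff)
      \<comment> \<open>If the envelopes stayed below \<open>a\<close>, every \<open>h j x\<close>
        would have a near-minimiser at a stage at least \<open>j\<close>. Its penalty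
        \<open>j * dist x (y j)\<close> is below \<open>r\<close>, so these points converge to
        \<open>x\<close>, while \<open>g\<close> at them is at most \<open>a\<close>; the liminf
        inequality then contradicts \<open>a < f x\<close>.\<close>
      have "\<exists>k y. j \<le> k \<and> y \<in> Y k \<and> c k y + real j * dist x y < r" for j
      proof (rule ccontr)
        assume "\<not> ?thesis"
        then have "r \<le> h j x" using rM by (intro h_greatest) (auto simp: not_less)
        then have "ennreal r \<le> (SUP j. ennreal (h j x))"
          by (intro SUP_upper2[of j]) (auto intro: ennreal_leI)
        then show False using a(1) r(2) by simp
      qed
      then obtain \<kappa> y where \<kappa>: "\<And>j. j \<le> \<kappa> j" and y: "\<And>j. y j \<in> Y (\<kappa> j)"
        and small: "\<And>j. c (\<kappa> j) (y j) + real j * dist x (y j) < r"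
        by metis
      have "filterlim \<kappa> at_top sequentially"
        using \<kappa> by (intro filterlim_at_top_mono[OF filterlim_ident]) auto
      then obtain \<rho> :: "nat \<Rightarrow> nat" where \<rho>: "strict_mono \<rho>" "strict_mono (\<kappa> \<circ> \<rho>)"
        by (rule ex_strict_mono_compose)
      have "(\<lambda>j. dist (y j) x) \<longlonglongrightarrow> 0"
      proof (rule tendsto_sandwich[OF _ _ tendsto_const])
        show "(\<lambda>j. r * inverse (real j)) \<longlonglongrightarrow> 0"
          by (rule tendsto_mult_right_zero[OF lim_inverse_n])
        have "dist (y j) x \<le> r * inverse (real j)" if "j \<ge> 1" for j
        proof -
          have "real j * dist x (y j) \<le> r"
            using small[of j] c_nonneg[of "\<kappa> j" "y j"] by linarith
          then show ?thesis using that by (simp add: field_simps dist_commute)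
        qed
        then show "\<forall>\<^sub>F j in sequentially. dist (y j) x \<le> r * inverse (real j)"
          by (auto simp: eventually_sequentially)
      qed simp
      then have "y \<longlonglongrightarrow> x" by (rule iffD2[OF tendsto_dist_iff])
      then have "(\<lambda>j. y (\<rho> j)) \<longlonglongrightarrow> x"
        by (rule LIMSEQ_subseq_LIMSEQ[OF _ \<rho>(1), unfolded o_def])
      then have "f x \<le> liminf (\<lambda>j. g ((\<kappa> \<circ> \<rho>) j) (y (\<rho> j)))"
        using y \<rho>(2) \<open>(\<lambda>j. y (\<rho> j)) \<longlonglongrightarrow> x\<close> by (intro lim[rule_format]) (auto simp: o_def)
      also have "\<dots> \<le> liminf (\<lambda>j::nat. a)"
      proof (intro Liminf_mono always_eventually allI)
        fix j
        have "c (\<kappa> (\<rho> j)) (y (\<rho> j)) < r"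
          using small[of "\<rho> j"] by (smt (verit) mult_nonneg_nonneg of_nat_0_le_iff zero_le_dist)
        then have "min (ennreal M) (g (\<kappa> (\<rho> j)) (y (\<rho> j))) < a"
          using r c_nonneg by (simp add: ennreal_less_iff flip: c_eq)
        moreover have "a < ennreal M" using a(2) by simp
        ultimately show "g ((\<kappa> \<circ> \<rho>) j) (y (\<rho> j)) \<le> a"
          by (auto simp: min_def split: if_splits)
      qed
      also have "\<dots> = a" by (simp add: Liminf_const)
      finally show False using a(2) by (simp add: leD)
    qed
    have step: "(\<integral>\<^sup>+x. ennreal (h j x) \<partial>P) \<le> ?L + ennreal (M * d)" for j
    proof -
      have int: "integrable (Q k) (h j)" "integrable P (h j)" for k
        using h_nonneg h_le_M
        by (auto intro!: integrable_const_bound[of _ M] P.integrable_const_bound[of _ M])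
      have "(\<lambda>k. \<integral>x. h j x \<partial>Q k) \<longlonglongrightarrow> (\<integral>x. h j x \<partial>P)"
        using conv h_cont[of j] h_nonneg h_le_M unfolding weakly_converges_def
        by (auto simp: bounded_iff intro!: exI[of _ M])
      then have "(\<lambda>k. \<integral>\<^sup>+x. ennreal (h j x) \<partial>Q k) \<longlonglongrightarrow> (\<integral>\<^sup>+x. ennreal (h j x) \<partial>P)"
        using int h_nonneg by (simp add: nn_integral_eq_integral tendsto_ennrealI)
      then have "(\<integral>\<^sup>+x. ennreal (h j x) \<partial>P) = liminf (\<lambda>k. \<integral>\<^sup>+x. ennreal (h j x) \<partial>Q k)"
        by (intro lim_imp_Liminf[symmetric]) auto
      also have "\<dots> \<le> liminf (\<lambda>k. (\<integral>\<^sup>+x. g k x \<partial>Q k) + ennreal (M * d))"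
      proof (rule Liminf_mono, rule eventually_mono[OF eventually_ge_at_top[of j]])
        fix k assume "j \<le> k"
        \<comment> \<open>On \<open>Y k\<close> the infimum is tested with \<open>y = x\<close>; off
          \<open>Y k\<close> only the bound \<open>M\<close> remains.\<close>
        have "ennreal (h j x) \<le> g k x + ennreal M * indicator (- Y k) x" for x
        proof (cases "x \<in> Y k")
          case True
          then have "h j x \<le> c k x" using h_le[OF \<open>j \<le> k\<close> True, of x] by simp
          then have "ennreal (h j x) \<le> min (ennreal M) (g k x)" by (simp add: ennreal_leI flip: c_eq)
          then show ?thesis using True by simp
        qed (use h_le_M[of j x] in \<open>auto intro!: add_increasing ennreal_leI\<close>)
        then have "(\<integral>\<^sup>+x. ennreal (h j x) \<partial>Q k) \<le> (\<integral>\<^sup>+x. g k x + ennreal M * indicator (- Y k) x \<partial>Q k)"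
          by (intro nn_integral_mono)
        also have "\<dots> = (\<integral>\<^sup>+x. g k x \<partial>Q k) + ennreal M * emeasure (Q k) (- Y k)"
          by (simp add: nn_integral_add nn_integral_cmult_indicator sets)
        also have "\<dots> \<le> (\<integral>\<^sup>+x. g k x \<partial>Q k) + ennreal (M * d)"
        proof (rule add_left_mono)
          have "ennreal M * emeasure (Q k) (- Y k) \<le> ennreal M * ennreal d"
            using Y by (intro mult_left_mono) (auto simp: emeasure_eq_measure intro: ennreal_leI)
          then show "ennreal M * emeasure (Q k) (- Y k) \<le> ennreal (M * d)"
            using M d by (simp add: ennreal_mult)
        qed
        finally show "(\<integral>\<^sup>+x. ennreal (h j x) \<partial>Q k) \<le> (\<integral>\<^sup>+x. g k x \<partial>Q k) + ennreal (M * d)" .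
      qed
      also have "\<dots> = ?L + ennreal (M * d)" by (intro Liminf_add_const) simp
      finally show ?thesis .
    qed
    have "(\<integral>\<^sup>+x. min (f x) (ennreal M) \<partial>P) \<le> (\<integral>\<^sup>+x. (SUP j. ennreal (h j x)) \<partial>P)"
      by (intro nn_integral_mono sup)
    also have "\<dots> = (SUP j. \<integral>\<^sup>+x. ennreal (h j x) \<partial>P)"
      by (rule nn_integral_monotone_convergence_SUP)
        (auto simp: incseq_def le_fun_def intro!: ennreal_leI h_mono)
    also have "\<dots> \<le> ?L + ennreal (M * d)" by (intro SUP_least step)
    finally show ?thesis .
  qed
  have "(\<integral>\<^sup>+x. min (f x) (of_nat n) \<partial>P) \<le> ?L" for n
  proof (rule ennreal_le_epsilon)
    fix e :: real assume "0 < e"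
    have "(\<integral>\<^sup>+x. min (f x) (of_nat n) \<partial>P) \<le> (\<integral>\<^sup>+x. min (f x) (ennreal (real (Suc n))) \<partial>P)"
      by (intro nn_integral_mono min.mono) (auto simp: ennreal_of_nat_eq_real_of_nat intro!: ennreal_leI)
    also have "\<dots> \<le> ?L + ennreal (real (Suc n) * (e / real (Suc n)))"
      using \<open>0 < e\<close> by (intro bound) auto
    also have "real (Suc n) * (e / real (Suc n)) = e" by simp
    finally show "(\<integral>\<^sup>+x. min (f x) (of_nat n) \<partial>P) \<le> ?L + ennreal e" .
  qed
  then show ?thesis
    by (subst nn_integral_SUP_min) (auto intro: SUP_least)
qed

section \<open>Orbit measures\<close>

lemma integral_uniform_measure:
  fixes \<phi> :: "'a \<Rightarrow> real"
  assumes [measurable]: "\<phi> \<in> borel_measurable M" "A \<in> sets M"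
    and A: "emeasure M A \<noteq> 0" "emeasure M A \<noteq> \<infinity>"
  shows "(\<integral>x. \<phi> x \<partial>uniform_measure M A) = (\<integral>x. indicator A x * \<phi> x \<partial>M) / measure M A"
proof -
  have pos: "0 < measure M A"
    using A by (simp add: measure_def enn2real_positive_iff zero_less_iff_neq_zero less_top)
  have "uniform_measure M A = density M (\<lambda>x. ennreal (indicator A x / measure M A))"
    unfolding uniform_measure_def using A pos
    by (intro density_cong AE_I2)
      (auto simp: emeasure_eq_ennreal_measure divide_ennreal indicator_def
        simp flip: ennreal_1)
  then have "(\<integral>x. \<phi> x \<partial>uniform_measure M A) = (\<integral>x. (indicator A x / measure M A) * \<phi> x \<partial>M)"
    by (simp add: integral_density)
  also have "\<dots> = (\<integral>x. (indicator A x * \<phi> x) / measure M A \<partial>M)"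
    by simp
  finally show ?thesis by simp
qed

lemma sets_borel_translation:
  fixes A :: "'a::euclidean_space set"
  assumes "A \<in> sets borel"
  shows "(+) l ` A \<in> sets borel"
proof -
  have "(+) l ` A = (\<lambda>x. x - l) -` A \<inter> space borel"
    by (force simp: image_iff)
  also have "\<dots> \<in> sets borel"
    by (rule measurable_sets[OF _ assms]) measurable
  finally show ?thesis .
qed

lemma emeasure_lborel_translation:
  fixes A :: "'a::euclidean_space set"
  assumes "A \<in> sets borel"
  shows "emeasure lborel ((+) l ` A) = emeasure lborel A"
proof -
  have "emeasure lborel ((+) l ` A) = emeasure (distr lborel borel ((+) l)) ((+) l ` A)"
    by (simp add: lborel_distr_plus)
  also have "\<dots> = emeasure lborel ((+) l -` ((+) l ` A))"
    by (subst emeasure_distr) (use assms in \<open>auto intro: sets_borel_translation\<close>)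
  also have "(+) l -` ((+) l ` A) = A" by auto
  finally show ?thesis .
qed

lemma emeasure_lborel_open_pos:
  fixes A :: "'a::euclidean_space set"
  assumes "open A" "A \<noteq> {}"
  shows "0 < emeasure lborel A"
proof -
  obtain x e where "0 < e" "ball x e \<subseteq> A"
    using assms by (meson ex_in_conv open_contains_ball)
  have "0 < measure lborel (ball x e)" using content_ball_pos[OF \<open>0 < e\<close>] .
  then have "0 < emeasure lborel (ball x e)"
    by (metis enn2real_0 less_irrefl measure_def zero_less_iff_neq_zero)
  also have "\<dots> \<le> emeasure lborel A"
    using assms by (intro emeasure_mono) (use \<open>ball x e \<subseteq> A\<close> in auto)
  finally show ?thesis .
qed

text \<open>Translation invariance turns the shifted integral over \<open>A\<close> into one over
  the translate, so only the symmetric difference survives. The invariance of weak limits and the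
  asymptotic invariance of averages both rest on this estimate.\<close>

lemma integral_uniform_measure_translate_le:
  fixes \<phi> :: "'a::euclidean_space \<Rightarrow> real"
  assumes [measurable]: "\<phi> \<in> borel_measurable borel" "A \<in> sets borel"
    and A: "emeasure lborel A \<noteq> 0" "emeasure lborel A \<noteq> \<infinity>"
    and B: "\<And>x. \<bar>\<phi> x\<bar> \<le> B"
  shows "\<bar>(\<integral>x. \<phi> (l + x) \<partial>uniform_measure lborel A) - (\<integral>x. \<phi> x \<partial>uniform_measure lborel A)\<bar>
    \<le> B * measure lborel (sym_diff ((+) l ` A) A) / measure lborel A"
proof -
  have [measurable]: "(+) l ` A \<in> sets borel"
    by (rule sets_borel_translation) fact
  have em: "emeasure lborel ((+) l ` A) = emeasure lborel A"
    by (rule emeasure_lborel_translation) fact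
  have "emeasure lborel (sym_diff ((+) l ` A) A) \<le> emeasure lborel ((+) l ` A \<union> A)"
    by (intro emeasure_mono) auto
  also have "\<dots> \<le> emeasure lborel ((+) l ` A) + emeasure lborel A"
    by (intro emeasure_subadditive) auto
  also have "\<dots> < top" using A(2) em by (simp add: less_top)
  finally have fin: "emeasure lborel (sym_diff ((+) l ` A) A) < \<infinity>" by simp
  have int: "integrable lborel (\<lambda>x. indicator D x * \<phi> x)"
    if [measurable]: "D \<in> sets borel" and "emeasure lborel D \<noteq> \<infinity>" for D
  proof (rule Bochner_Integration.integrable_bound[of _ "\<lambda>x. B * indicator D x"])
    show "integrable lborel (\<lambda>x. B * indicator D x :: real)"
      using that by (intro integrable_mult_right integrable_real_indicator) (auto simp: less_top)
    show "AE x in lborel. norm (indicator D x * \<phi> x) \<le> norm (B * indicator D x)"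
      using order_trans[OF B abs_ge_self] by (intro AE_I2) (auto simp: indicator_def)
  qed simp
  have "(\<integral>x. indicator A x * \<phi> (l + x) \<partial>lborel) = (\<integral>x. indicator ((+) l ` A) (l + x) * \<phi> (l + x) \<partial>lborel)"
    by (intro Bochner_Integration.integral_cong) (auto simp: indicator_def)
  also have "\<dots> = (\<integral>x. indicator ((+) l ` A) x * \<phi> x \<partial>distr lborel borel ((+) l))"
    by (subst integral_distr) auto
  finally have "(\<integral>x. indicator A x * \<phi> (l + x) \<partial>lborel) = (\<integral>x. indicator ((+) l ` A) x * \<phi> x \<partial>lborel)"
    by (simp add: lborel_distr_plus)
  then have "\<bar>(\<integral>x. indicator A x * \<phi> (l + x) \<partial>lborel) - (\<integral>x. indicator A x * \<phi> x \<partial>lborel)\<bar>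
     = \<bar>\<integral>x. indicator ((+) l ` A) x * \<phi> x - indicator A x * \<phi> x \<partial>lborel\<bar>"
    using A(2) em by (subst Bochner_Integration.integral_diff) (auto intro: int)
  also have "\<dots> \<le> (\<integral>x. B * indicator (sym_diff ((+) l ` A) A) x \<partial>lborel)"
  proof (rule integral_abs_bound_integral)
    show "integrable lborel (\<lambda>x. indicator ((+) l ` A) x * \<phi> x - indicator A x * \<phi> x)"
      using A(2) em by (intro Bochner_Integration.integrable_diff int) auto
    show "integrable lborel (\<lambda>x. B * indicator (sym_diff ((+) l ` A) A) x :: real)"
      using fin by (intro integrable_mult_right integrable_real_indicator) auto
    show "\<bar>indicator ((+) l ` A) x * \<phi> x - indicator A x * \<phi> x\<bar> \<le> B * indicator (sym_diff ((+) l ` A) A) x" for x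
      using B[of x] by (auto simp: indicator_def)
  qed
  also have "\<dots> = B * measure lborel (sym_diff ((+) l ` A) A)"
    by simp
  finally have *: "\<bar>(\<integral>x. indicator A x * \<phi> (l + x) \<partial>lborel) - (\<integral>x. indicator A x * \<phi> x \<partial>lborel)\<bar>
    \<le> B * measure lborel (sym_diff ((+) l ` A) A)" .
  have [measurable]: "(\<lambda>x. \<phi> (l + x)) \<in> borel_measurable borel" by measurable
  show ?thesis
    using divide_right_mono[OF *, of "measure lborel A"] A
    by (simp add: integral_uniform_measure diff_divide_distrib[symmetric])
qed

text \<open>A ball is connected, so one that meets \<open>\<omega>\<close> without being contained
  in it meets the frontier, at distance less than \<open>R\<close> from its centre.\<close>

lemma ball_subset_of_inner_part:
  assumes "x \<in> inner_part R \<omega>"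
  shows "ball x R \<subseteq> \<omega>"
proof (rule ccontr)
  assume "\<not> ball x R \<subseteq> \<omega>"
  moreover have x: "x \<in> \<omega>" "infdist x (frontier \<omega>) > R"
    using assms by (auto simp: inner_part_def)
  moreover have "0 < R" using \<open>\<not> ball x R \<subseteq> \<omega>\<close> by (metis ball_empty empty_subsetI not_less)
  ultimately have "x \<in> ball x R \<inter> \<omega>" "ball x R - \<omega> \<noteq> {}" by auto
  then have "ball x R \<inter> frontier \<omega> \<noteq> {}"
    by (intro connected_Int_frontier) (use connected_ball in blast)+
  then obtain y where "y \<in> frontier \<omega>" "dist x y < R" by auto
  then show False using infdist_le[of y "frontier \<omega>" x] x(2) by simp
qed

lemma open_inner_part:
  fixes \<omega> :: "(real^'n) set"
  assumes "open \<omega>"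
  shows "open (inner_part R \<omega>)"
proof -
  have "open {x :: real^'n. R < infdist x (frontier \<omega>)}"
    by (intro open_Collect_less continuous_intros)
  moreover have "inner_part R \<omega> = \<omega> \<inter> {x. R < infdist x (frontier \<omega>)}"
    by (auto simp: inner_part_def)
  ultimately show ?thesis using assms by auto
qed

lemma inner_part_subset: "inner_part R \<omega> \<subseteq> \<omega>"
  by (auto simp: inner_part_def)

lemma inner_part_antimono: "R \<le> S \<Longrightarrow> inner_part S \<omega> \<subseteq> inner_part R \<omega>"
  by (auto simp: inner_part_def)

text \<open>The inner part of width \<open>R\<close> lies both in \<open>\<omega>\<close> and in its
  translate, which have equal volume. Each half of the symmetric difference therefore has at most
  the volume of the boundary layer.\<close>

lemma measure_sym_diff_translate_le:
  fixes \<omega> :: "(real^'n) set"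
  assumes \<omega>: "open \<omega>" "emeasure lborel \<omega> < \<infinity>" and R: "norm l < R"
  shows "measure lborel (sym_diff ((+) l ` \<omega>) \<omega>) \<le>
    2 * (measure lborel \<omega> - measure lborel (inner_part R \<omega>))"
proof -
  let ?A = "inner_part R \<omega>" and ?T = "(+) l ` \<omega>"
  have o: "open ?T" "open ?A"
    using \<omega>(1) by (auto simp: open_translation open_inner_part)
  have eT: "emeasure lborel ?T = emeasure lborel \<omega>"
    by (rule emeasure_lborel_translation) (use \<omega> in auto)
  have fm: "\<omega> \<in> fmeasurable lborel" "?T \<in> fmeasurable lborel"
    using \<omega> o eT by (auto simp: fmeasurable_def)
  have fA: "?A \<in> fmeasurable lborel"
    by (rule fmeasurableI2[OF fm(1) inner_part_subset]) (use o in auto)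
  have AT: "?A \<subseteq> ?T"
  proof
    fix x assume "x \<in> ?A"
    then have "x - l \<in> \<omega>" using ball_subset_of_inner_part[of x R \<omega>] R by (auto simp: dist_norm subset_eq)
    then show "x \<in> ?T" by (intro image_eqI[of _ _ "x - l"]) auto
  qed
  have "sym_diff ?T \<omega> = (?T - \<omega>) \<union> (\<omega> - ?T)" by auto
  then have "measure lborel (sym_diff ?T \<omega>) \<le> measure lborel (?T - \<omega>) + measure lborel (\<omega> - ?T)"
    using o \<omega> by (simp add: measure_Un_le)
  also have "measure lborel (?T - \<omega>) \<le> measure lborel (?T - ?A)"
    by (rule measure_mono_fmeasurable) (use fm fA o \<omega> inner_part_subset in auto)
  also have "measure lborel (\<omega> - ?T) \<le> measure lborel (\<omega> - ?A)"
    by (rule measure_mono_fmeasurable) (use fm fA o \<omega> AT in auto)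
  also have "measure lborel (?T - ?A) = measure lborel \<omega> - measure lborel ?A"
    using measurable_measure_Diff[OF fm(2) fmeasurableD[OF fA] AT] eT by (simp add: measure_def[of _ ?T] measure_def[of _ \<omega>])
  also have "measure lborel (\<omega> - ?A) = measure lborel \<omega> - measure lborel ?A"
    by (rule measurable_measure_Diff[OF fm(1) fmeasurableD[OF fA] inner_part_subset])
  finally show ?thesis by simp
qed

locale measurable_action =
  fixes \<theta> :: "real^'n \<Rightarrow> 'a::polish_space \<Rightarrow> 'a"
  assumes continuous_action: "continuous_action \<theta>"
begin

lemma action_add: "\<theta> l (\<theta> m x) = \<theta> (l + m) x"
  using continuous_action by (auto simp: continuous_action_def)

lemma continuous_on_action: "continuous_on UNIV (\<theta> l)"
  using continuous_action by (auto simp: continuous_action_def)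

lemma measurable_action [measurable (raw)]:
  assumes [measurable]: "a \<in> borel_measurable M" "b \<in> borel_measurable M"
  shows "(\<lambda>x. \<theta> (a x) (b x)) \<in> borel_measurable M"
proof -
  have "(\<lambda>(l, u). \<theta> l u) \<in> borel_measurable (borel \<Otimes>\<^sub>M borel)"
    using continuous_action by (simp add: continuous_action_def borel_prod)
  then have "(\<lambda>x. (\<lambda>(l, u). \<theta> l u) (a x, b x)) \<in> borel_measurable M"
    by (rule measurable_compose[rotated]) measurable
  then show ?thesis by simp
qed

lemma nn_integral_orbit_measure:
  assumes [measurable]: "A \<in> sets borel" "g \<in> borel_measurable borel"
  shows "(\<integral>\<^sup>+x. g x \<partial>orbit_measure \<theta> A u) = orbit_average \<theta> A g u"
  unfolding orbit_measure_def orbit_average_def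
  by (subst nn_integral_distr) (auto simp: nn_integral_uniform_measure)

lemma integral_orbit_measure:
  fixes g :: "'a \<Rightarrow> real"
  assumes [measurable]: "A \<in> sets borel" "g \<in> borel_measurable borel"
  shows "(\<integral>x. g x \<partial>orbit_measure \<theta> A u) = (\<integral>l. g (\<theta> l u) \<partial>uniform_measure lborel A)"
  unfolding orbit_measure_def by (rule integral_distr) auto

lemma prob_space_orbit_measure:
  assumes "A \<in> sets borel" "emeasure lborel A \<noteq> 0" "emeasure lborel A \<noteq> \<infinity>"
  shows "prob_space (orbit_measure \<theta> A u)"
  unfolding orbit_measure_def
  by (intro prob_space.prob_space_distr prob_space_uniform_measure) (use assms in auto)

lemma sets_orbit_measure: "sets (orbit_measure \<theta> A u) = sets borel"
  by (simp add: orbit_measure_def)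

text \<open>Continuity of \<open>\<theta> l\<close> makes \<open>g (\<theta> l x)\<close> another
  admissible test function, so shifted and unshifted integrals both converge; on orbit measures they
  differ by at most \<open>B\<close> times the Folner ratio.\<close>

lemma invariant_of_weakly_converges:
  fixes A :: "nat \<Rightarrow> (real^'n) set"
  assumes A: "\<And>k. A k \<in> sets borel" "\<And>k. emeasure lborel (A k) \<noteq> 0" "\<And>k. emeasure lborel (A k) \<noteq> \<infinity>"
    and Folner: "\<And>l. (\<lambda>k. measure lborel (sym_diff ((+) l ` A k) (A k)) / measure lborel (A k)) \<longlonglongrightarrow> 0"
    and P: "prob_space P" "sets P = sets borel"
    and conv: "weakly_converges (\<lambda>k. orbit_measure \<theta> (A k) (u k)) P"
  shows "distr P borel (\<theta> l) = P"
proof (rule measure_eqI_bounded_continuous)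
  interpret P: prob_space P by fact
  have [measurable_cong]: "sets P = sets borel" by fact
  show "finite_measure (distr P borel (\<theta> l))" by (rule P.finite_measure_distr) simp
  fix g :: "'a \<Rightarrow> real" assume g: "continuous_on UNIV g" "bounded (range g)"
  have [measurable]: "g \<in> borel_measurable borel"
    using g(1) by (rule borel_measurable_continuous_onI)
  note [measurable] = A(1)
  obtain B where B: "\<And>x. \<bar>g x\<bar> \<le> B" using g(2) by (auto simp: bounded_iff)
  have gl: "continuous_on UNIV (\<lambda>x. g (\<theta> l x))"
    by (rule continuous_on_compose2[OF g(1) continuous_on_action]) auto
  have lim1: "(\<lambda>k. \<integral>x. g (\<theta> l x) \<partial>orbit_measure \<theta> (A k) (u k)) \<longlonglongrightarrow> (\<integral>x. g (\<theta> l x) \<partial>P)"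
    using conv gl B unfolding weakly_converges_def by (auto simp: bounded_iff)
  have lim2: "(\<lambda>k. \<integral>x. g x \<partial>orbit_measure \<theta> (A k) (u k)) \<longlonglongrightarrow> (\<integral>x. g x \<partial>P)"
    using conv g unfolding weakly_converges_def by auto
  have bound: "\<bar>(\<integral>x. g (\<theta> l x) \<partial>orbit_measure \<theta> (A k) (u k)) - (\<integral>x. g x \<partial>orbit_measure \<theta> (A k) (u k))\<bar>
      \<le> B * (measure lborel (sym_diff ((+) l ` A k) (A k)) / measure lborel (A k))" for k
    using integral_uniform_measure_translate_le[OF _ A(1,2,3)[of k], of "\<lambda>m. g (\<theta> m (u k))" B l] B
    by (simp add: integral_orbit_measure action_add)
  have lim0: "(\<lambda>k. B * (measure lborel (sym_diff ((+) l ` A k) (A k)) / measure lborel (A k))) \<longlonglongrightarrow> 0"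
    using tendsto_mult_right_zero[OF Folner] .
  have "(\<lambda>k. (\<integral>x. g (\<theta> l x) \<partial>orbit_measure \<theta> (A k) (u k)) -
      (\<integral>x. g x \<partial>orbit_measure \<theta> (A k) (u k))) \<longlonglongrightarrow> 0"
    by (rule Lim_null_comparison[OF always_eventually lim0]) (use bound in simp)
  then have "(\<integral>x. g (\<theta> l x) \<partial>P) - (\<integral>x. g x \<partial>P) = 0"
    by (rule LIMSEQ_unique[OF tendsto_diff[OF lim1 lim2]])
  then show "(\<integral>x. g x \<partial>distr P borel (\<theta> l)) = (\<integral>x. g x \<partial>P)"
    by (subst integral_distr) auto
qed (use P in \<open>auto intro: prob_space.finite_measure\<close>)

text \<open>For \<open>l\<close> in the inner part the whole ball around \<open>l\<close> stays in
  \<open>\<omega>\<close>, so integrating the local integrals over the inner part counts each point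
  of \<open>\<omega>\<close> with weight at most the volume of the ball. Chebyshev gives the last
  term of the bound; the boundary layer, where nothing is known, is paid for in full by the first
  two.\<close>

lemma measure_orbit_measure_large_local_integral:
  fixes \<omega> :: "(real^'n) set"
  assumes \<omega>: "open \<omega>" "\<omega> \<noteq> {}" "emeasure lborel \<omega> < \<infinity>"
    and [measurable]: "g \<in> borel_measurable borel"
    and c: "0 < c" and C: "0 \<le> C" "orbit_average \<theta> \<omega> g u \<le> ennreal C"
  shows "measure (orbit_measure \<theta> \<omega> u) {x. ennreal c < (\<integral>\<^sup>+l\<in>ball 0 R. g (\<theta> l x) \<partial>lborel)} \<le>
    1 - measure lborel (inner_part R \<omega>) / measure lborel \<omega> + measure lborel (ball (0::real^'n) R) * C / c"
proof -
  let ?I = "inner_part R \<omega>" and ?b = "measure lborel (ball (0::real^'n) R)"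
  define \<Phi> where "\<Phi> x = (\<integral>\<^sup>+l\<in>ball 0 R. g (\<theta> l x) \<partial>lborel)" for x
  have [measurable]: "ball (0::real^'n) R \<in> sets borel" by simp
  have [measurable]: "\<Phi> \<in> borel_measurable borel" unfolding \<Phi>_def by measurable
  have [measurable]: "\<omega> \<in> sets borel" "?I \<in> sets borel"
    using \<omega>(1) open_inner_part[OF \<omega>(1)] by auto
  have pos: "0 < emeasure lborel \<omega>"
    by (rule emeasure_lborel_open_pos) fact+
  have fm: "\<omega> \<in> fmeasurable lborel" using \<omega> by (auto simp: fmeasurable_def)
  have fI: "?I \<in> fmeasurable lborel"
    by (rule fmeasurableI2[OF fm inner_part_subset]) auto
  have mpos: "0 < measure lborel \<omega>"
    using pos \<omega>(3) by (simp add: measure_def enn2real_positive_iff)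
  define S where "S = {l \<in> ?I. ennreal c < \<Phi> (\<theta> l u)}"
  have [measurable]: "S \<in> sets borel" unfolding S_def by measurable
  have fS: "S \<in> fmeasurable lborel"
    by (rule fmeasurableI2[OF fI]) (auto simp: S_def)
  have "ennreal c * emeasure lborel S = (\<integral>\<^sup>+l. ennreal c * indicator S l \<partial>lborel)"
    by (simp add: nn_integral_cmult_indicator)
  also have "\<dots> \<le> (\<integral>\<^sup>+l\<in>?I. \<Phi> (\<theta> l u) \<partial>lborel)"
    by (intro nn_integral_mono) (auto simp: S_def indicator_def less_imp_le)
  also have "\<dots> = (\<integral>\<^sup>+l. (\<integral>\<^sup>+m. g (\<theta> (m + l) u) * indicator (ball 0 R) m * indicator ?I l \<partial>lborel) \<partial>lborel)"
    by (intro nn_integral_cong) (simp add: \<Phi>_def action_add nn_integral_multc)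
  also have "\<dots> = (\<integral>\<^sup>+(m::real^'n). (\<integral>\<^sup>+l. g (\<theta> (m + l) u) * indicator (ball 0 R) m * indicator ?I l \<partial>lborel) \<partial>lborel)"
    by (rule lborel_pair.Fubini'[symmetric]) measurable
  also have "\<dots> \<le> (\<integral>\<^sup>+(m::real^'n). (\<integral>\<^sup>+l. g (\<theta> (m + l) u) * indicator \<omega> (m + l) \<partial>lborel) * indicator (ball 0 R) m \<partial>lborel)"
  proof (intro nn_integral_mono)
    fix m :: "real^'n"
    have "indicator (ball 0 R) m * indicator ?I l \<le> (indicator \<omega> (m + l) * indicator (ball 0 R) m :: ennreal)" for l
      using ball_subset_of_inner_part[of l R \<omega>] by (auto simp: indicator_def dist_norm subset_eq)
    then have "g (\<theta> (m + l) u) * (indicator (ball 0 R) m * indicator ?I l) \<le>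
        g (\<theta> (m + l) u) * (indicator \<omega> (m + l) * indicator (ball 0 R) m)" for l
      by (intro mult_left_mono) auto
    then show "(\<integral>\<^sup>+l. g (\<theta> (m + l) u) * indicator (ball 0 R) m * indicator ?I l \<partial>lborel) \<le>
        (\<integral>\<^sup>+l. g (\<theta> (m + l) u) * indicator \<omega> (m + l) \<partial>lborel) * indicator (ball 0 R) m"
      by (subst nn_integral_multc[symmetric]) (auto simp: mult.assoc intro!: nn_integral_mono)
  qed
  also have "\<dots> = (\<integral>\<^sup>+(m::real^'n). (\<integral>\<^sup>+l\<in>\<omega>. g (\<theta> l u) \<partial>lborel) * indicator (ball 0 R) m \<partial>lborel)"
  proof -
    have "(\<integral>\<^sup>+l. g (\<theta> (m + l) u) * indicator \<omega> (m + l) \<partial>lborel) = (\<integral>\<^sup>+l. g (\<theta> l u) * indicator \<omega> l \<partial>distr lborel borel ((+) m))" for m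
      by (subst nn_integral_distr) auto
    then show ?thesis by (simp add: lborel_distr_plus)
  qed
  also have "\<dots> = orbit_average \<theta> \<omega> g u * emeasure lborel \<omega> * emeasure lborel (ball (0::real^'n) R)"
    using pos \<omega>(3) by (simp add: nn_integral_cmult_indicator orbit_average_def ennreal_divide_times ennreal_mult_divide_eq)
  also have "\<dots> \<le> ennreal C * emeasure lborel \<omega> * emeasure lborel (ball (0::real^'n) R)"
    using C by (intro mult_right_mono) auto
  also have "\<dots> = ennreal (C * measure lborel \<omega> * ?b)"
    using \<omega>(3) C emeasure_lborel_ball_finite[of "0::real^'n" R]
    by (simp add: emeasure_eq_ennreal_measure ennreal_mult)
  finally have "c * measure lborel S \<le> C * measure lborel \<omega> * ?b"
    using c C fS by (simp add: emeasure_eq_measure2 flip: ennreal_mult)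
  then have S_le: "measure lborel S / measure lborel \<omega> \<le> ?b * C / c"
    using c mpos by (simp add: field_simps)
  have "measure (orbit_measure \<theta> \<omega> u) {x. ennreal c < \<Phi> x} =
      measure (uniform_measure lborel \<omega>) {l. ennreal c < \<Phi> (\<theta> l u)}"
    unfolding orbit_measure_def by (subst measure_distr) (auto simp: vimage_def)
  also have "\<dots> = measure lborel (\<omega> \<inter> {l. ennreal c < \<Phi> (\<theta> l u)}) / measure lborel \<omega>"
    by (rule measure_uniform_measure) (use pos \<omega>(3) in auto)
  also have "\<dots> \<le> (measure lborel (\<omega> - ?I) + measure lborel S) / measure lborel \<omega>"
  proof (rule divide_right_mono)
    have "measure lborel (\<omega> \<inter> {l. ennreal c < \<Phi> (\<theta> l u)}) \<le> measure lborel ((\<omega> - ?I) \<union> S)"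
      by (rule measure_mono_fmeasurable) (use fm fI fS in \<open>auto simp: S_def\<close>)
    also have "\<dots> \<le> measure lborel (\<omega> - ?I) + measure lborel S"
      by (rule measure_Un_le) auto
    finally show "measure lborel (\<omega> \<inter> {l. ennreal c < \<Phi> (\<theta> l u)}) \<le> measure lborel (\<omega> - ?I) + measure lborel S" .
  qed simp
  finally have 1: "measure (orbit_measure \<theta> \<omega> u) {x. ennreal c < \<Phi> x} \<le>
      (measure lborel (\<omega> - ?I) + measure lborel S) / measure lborel \<omega>" .
  have 2: "measure lborel (\<omega> - ?I) = measure lborel \<omega> - measure lborel ?I"
    by (rule measurable_measure_Diff[OF fm fmeasurableD[OF fI] inner_part_subset])
  have 3: "(measure lborel \<omega> - measure lborel ?I + measure lborel S) / measure lborel \<omega> =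
      1 - measure lborel ?I / measure lborel \<omega> + measure lborel S / measure lborel \<omega>"
    using mpos by (simp add: add_divide_distrib diff_divide_distrib)
  show ?thesis
    using order_trans[OF 1[unfolded 2 3] add_left_mono[OF S_le]] unfolding \<Phi>_def .
qed

end

section \<open>Maximal inequality\<close>

text \<open>A Vitali selection that treats the largest radius first. Among the centres with that
  radius a disjoint family of greatest cardinality is kept; the induction continues with smaller
  radii, restricted to translates that avoid those kept. A discarded \<open>x\<close> meets a kept
  \<open>d\<close> of no smaller radius, say \<open>x + u = d + v\<close>; monotonicity puts
  \<open>u\<close> in \<open>U (\<rho> d)\<close>, so \<open>x\<close> lies in \<open>d\<close> plus
  the difference set.\<close>

lemma disjoint_translates_selection:
  fixes U :: "real \<Rightarrow> 'v::euclidean_space set"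
  assumes "finite F"
    and U: "\<And>R. R \<in> F \<Longrightarrow> open (U R)" "\<And>R. R \<in> F \<Longrightarrow> U R \<noteq> {}"
    and mono: "\<And>R S. R \<in> F \<Longrightarrow> S \<in> F \<Longrightarrow> R \<le> S \<Longrightarrow> U R \<subseteq> U S"
    and E: "\<And>x. x \<in> E \<Longrightarrow> \<rho> x \<in> F" "\<And>x. x \<in> E \<Longrightarrow> (+) x ` U (\<rho> x) \<subseteq> ball 0 T"
  shows "\<exists>D\<subseteq>E. finite D \<and> disjoint_family_on (\<lambda>x. (+) x ` U (\<rho> x)) D \<and>
    (\<forall>x\<in>E. \<exists>d\<in>D. \<exists>a\<in>U (\<rho> d). \<exists>b\<in>U (\<rho> d). x = d + (a - b))"
  using assms
proof (induction F arbitrary: E rule: finite_linorder_max_induct)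
  case empty
  then show ?case by (intro exI[of _ "{}"]) (auto simp: disjoint_family_on_def)
next
  case (insert b A)
  define E1 where "E1 = {x \<in> E. \<rho> x = b}"
  define ok where "ok D \<longleftrightarrow> D \<subseteq> E1 \<and> finite D \<and> disjoint_family_on (\<lambda>x. (+) x ` U (\<rho> x)) D" for D
  have oU: "open (U b)" "U b \<noteq> {}" using insert.prems(1,2)[of b] by auto
  have bT: "(+) x ` U b \<subseteq> ball 0 T" if "x \<in> E1" for x
    using insert.prems(5)[of x] that by (auto simp: E1_def)
  \<comment> \<open>Disjoint translates of one open set inside a fixed ball are bounded in number by
    their volume, so a family of greatest cardinality exists.\<close>
  have card_le: "real (card D) * measure lborel (U b) \<le> measure lborel (ball (0::'v) T)" if "ok D" for D
  proof -
    have D: "D \<subseteq> E1" "finite D" using that by (auto simp: ok_def)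
    have "\<rho> x = b" if "x \<in> D" for x using that D(1) by (auto simp: E1_def)
    then have disj: "disjoint_family_on (\<lambda>x. (+) x ` U b) D"
      using \<open>ok D\<close> by (simp add: ok_def disjoint_family_on_def)
    have bor: "(+) x ` U b \<in> sets borel" for x
      by (rule sets_borel_translation) (use oU in auto)
    have fm: "ball (0::'v) T \<in> fmeasurable lborel"
      using emeasure_lborel_ball_finite[of "0::'v" T] by (simp add: fmeasurable_def)
    have fx: "(+) x ` U b \<in> fmeasurable lborel" if "x \<in> D" for x
      by (rule fmeasurableI2[OF fm bT]) (use that D bor in auto)
    have "measure lborel (\<Union>x\<in>D. (+) x ` U b) = (\<Sum>x\<in>D. measure lborel ((+) x ` U b))"
      by (rule measure_UNION'[OF D(2)]) (use fx disj in \<open>auto simp: disjoint_family_on_def pairwise_def disjnt_def\<close>)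
    also have "\<dots> = real (card D) * measure lborel (U b)"
      by (simp add: measure_def emeasure_lborel_translation oU(1))
    finally have eq: "measure lborel (\<Union>x\<in>D. (+) x ` U b) = real (card D) * measure lborel (U b)" .
    have "(\<Union>x\<in>D. (+) x ` U b) \<in> sets lborel"
      unfolding sets_lborel by (rule sets.finite_UN[OF D(2) bor])
    moreover have "(\<Union>x\<in>D. (+) x ` U b) \<subseteq> ball 0 T" using bT D(1) by blast
    ultimately show ?thesis
      using measure_mono_fmeasurable[OF _ _ fm] unfolding eq[symmetric] by blast
  qed
  have "emeasure lborel (U b) \<noteq> \<infinity>" if "x \<in> E1" for x
    using emeasure_mono[OF bT[OF that], of lborel] emeasure_lborel_ball_finite[of "0::'v" T]
      emeasure_lborel_translation[of "U b" x] oU(1) by (auto simp: top_unique)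
  then have pos: "0 < measure lborel (U b)" if "x \<in> E1" for x
    using that emeasure_lborel_open_pos[OF oU] by (simp add: measure_def enn2real_positive_iff less_top)
  obtain N where N: "card D < N" if "ok D" for D
  proof (cases "E1 = {}")
    case True
    then show thesis by (intro that[of 1]) (auto simp: ok_def)
  next
    case False
    then have "0 < measure lborel (U b)" using pos by blast
    moreover obtain N :: nat where "measure lborel (ball (0::'v) T) / measure lborel (U b) < real N"
      using reals_Archimedean2 by blast
    ultimately have "measure lborel (ball (0::'v) T) < real N * measure lborel (U b)"
      by (simp add: pos_divide_less_eq)
    then have "card D < N" if "ok D" for D
      using card_le[OF that] \<open>0 < measure lborel (U b)\<close>
      by (smt (verit) mult_le_cancel_right of_nat_less_iff)
    then show thesis by (rule that)
  qed
  have "ok {}" by (simp add: ok_def disjoint_family_on_def)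
  then obtain D1 where D1: "ok D1" "\<And>D. ok D \<Longrightarrow> card D \<le> card D1"
    using ex_has_greatest_nat[of ok "{}" card N] N by blast
  have maximal: "\<exists>d\<in>D1. (+) x ` U (\<rho> x) \<inter> (+) d ` U (\<rho> d) \<noteq> {}" if "x \<in> E1" for x
  proof (rule ccontr)
    assume *: "\<not> ?thesis"
    have "x \<notin> D1" using * oU(2) that by (auto simp: E1_def)
    moreover have "ok (insert x D1)"
      using D1(1) that * by (fastforce simp: ok_def disjoint_family_on_def)
    ultimately show False
      using D1(2)[of "insert x D1"] D1(1) by (simp add: ok_def)
  qed
  define E2 where "E2 = {x \<in> E. \<rho> x \<in> A \<and> (\<forall>d\<in>D1. (+) x ` U (\<rho> x) \<inter> (+) d ` U (\<rho> d) = {})}"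
  obtain D2 where D2: "D2 \<subseteq> E2" "finite D2" "disjoint_family_on (\<lambda>x. (+) x ` U (\<rho> x)) D2"
    "\<forall>x\<in>E2. \<exists>d\<in>D2. \<exists>a\<in>U (\<rho> d). \<exists>b\<in>U (\<rho> d). x = d + (a - b)"
    using insert.IH[of E2] insert.prems by (auto simp: E2_def)
  show ?case
  proof (intro exI[of _ "D1 \<union> D2"] conjI ballI)
    show "D1 \<union> D2 \<subseteq> E" "finite (D1 \<union> D2)"
      using D1(1) D2 by (auto simp: ok_def E1_def E2_def)
    show "disjoint_family_on (\<lambda>x. (+) x ` U (\<rho> x)) (D1 \<union> D2)"
      unfolding disjoint_family_on_def
    proof (intro ballI impI)
      fix x y assume "x \<in> D1 \<union> D2" "y \<in> D1 \<union> D2" "x \<noteq> y"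
      moreover have "(+) x ` U (\<rho> x) \<inter> (+) y ` U (\<rho> y) = {}" if "x \<in> D1" "y \<in> D2" for x y
        using that D2(1) by (auto simp: E2_def)
      ultimately show "(+) x ` U (\<rho> x) \<inter> (+) y ` U (\<rho> y) = {}"
        using D1(1) D2(3) unfolding ok_def disjoint_family_on_def by (metis Int_commute Un_iff)
    qed
    fix x assume x: "x \<in> E"
    show "\<exists>d\<in>D1 \<union> D2. \<exists>a\<in>U (\<rho> d). \<exists>b\<in>U (\<rho> d). x = d + (a - b)"
    proof (cases "x \<in> E2")
      case True
      then show ?thesis using D2(4) by blast
    next
      case False
      have "\<exists>d\<in>D1. (+) x ` U (\<rho> x) \<inter> (+) d ` U (\<rho> d) \<noteq> {}"
      proof (cases "\<rho> x = b")
        case True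
        then show ?thesis using maximal x by (simp add: E1_def)
      next
        case neq: False
        then have "\<rho> x \<in> A" using insert.prems(4)[OF x] by auto
        then show ?thesis using False x by (auto simp: E2_def)
      qed
      then obtain d u v where d: "d \<in> D1" and uv: "u \<in> U (\<rho> x)" "v \<in> U (\<rho> d)" "x + u = d + v"
        by auto
      have "\<rho> d = b" using d D1(1) by (auto simp: ok_def E1_def)
      moreover have "\<rho> x \<le> b" using insert.prems(4)[OF x] insert.hyps by (auto simp: less_imp_le)
      ultimately have "u \<in> U (\<rho> d)"
        using insert.prems(3)[of "\<rho> x" b] insert.prems(4)[OF x] uv(1) by auto
      moreover have "x = d + (v - u)" using uv(3) by (simp add: algebra_simps)
      ultimately show ?thesis using d uv(2) by blast
    qed
  qed
qed

lemma open_differences_set: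
  fixes A :: "'v::euclidean_space set"
  assumes "open A"
  shows "open {x - y | x y. x \<in> A \<and> y \<in> A}"
proof -
  have "{x - y | x y. x \<in> A \<and> y \<in> A} = (\<Union>y\<in>A. (\<lambda>x. x - y) ` A)"
    by blast
  also have "open \<dots>" by (rule open_UN) (use assms open_translation_subtract in blast)
  finally show ?thesis .
qed

text \<open>The selected translates are disjoint, so the integrals of \<open>\<phi>\<close> over
  them add up; translates of their difference sets cover the bad centres and cost a factor
  \<open>C\<close> in volume. The radius \<open>2 * T\<close> appears because a centre and its
  window each lie in \<open>ball 0 T\<close>.\<close>

lemma maximal_inequality_on_ball:
  fixes U :: "real \<Rightarrow> 'v::euclidean_space set" and \<phi> :: "'v \<Rightarrow> ennreal"
  assumes [measurable]: "\<phi> \<in> borel_measurable borel"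
    and F: "finite F"
    and U: "\<And>R. R \<in> F \<Longrightarrow> open (U R)" "\<And>R. R \<in> F \<Longrightarrow> U R \<noteq> {}" "\<And>R. R \<in> F \<Longrightarrow> U R \<subseteq> ball 0 T"
    and mono: "\<And>R S. R \<in> F \<Longrightarrow> S \<in> F \<Longrightarrow> R \<le> S \<Longrightarrow> U R \<subseteq> U S"
    and C: "0 \<le> C"
      "\<And>R. R \<in> F \<Longrightarrow> measure lborel {x - y | x y. x \<in> U R \<and> y \<in> U R} \<le> C * measure lborel (U R)"
  shows "ennreal \<alpha> * emeasure lborel {l \<in> ball 0 T. \<exists>R\<in>F. ennreal \<alpha> * emeasure lborel (U R) <
      (\<integral>\<^sup>+m\<in>U R. \<phi> (m + l) \<partial>lborel)} \<le> ennreal C * (\<integral>\<^sup>+m\<in>ball 0 (2 * T). \<phi> m \<partial>lborel)"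
proof -
  define E where "E = {l \<in> ball 0 T. \<exists>R\<in>F. ennreal \<alpha> * emeasure lborel (U R) < (\<integral>\<^sup>+m\<in>U R. \<phi> (m + l) \<partial>lborel)}"
  define W where "W R = {x - y | x y. x \<in> U R \<and> y \<in> U R}" for R
  have "\<forall>x\<in>E. \<exists>R. R \<in> F \<and> ennreal \<alpha> * emeasure lborel (U R) < (\<integral>\<^sup>+m\<in>U R. \<phi> (m + x) \<partial>lborel)"
    by (auto simp: E_def)
  then obtain \<rho> where \<rho>: "\<And>x. x \<in> E \<Longrightarrow> \<rho> x \<in> F"
    "\<And>x. x \<in> E \<Longrightarrow> ennreal \<alpha> * emeasure lborel (U (\<rho> x)) < (\<integral>\<^sup>+m\<in>U (\<rho> x). \<phi> (m + x) \<partial>lborel)"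
    by metis
  have sub: "(+) x ` U (\<rho> x) \<subseteq> ball 0 (2 * T)" if "x \<in> E" for x
  proof
    fix z assume "z \<in> (+) x ` U (\<rho> x)"
    then obtain y where "y \<in> U (\<rho> x)" "z = x + y" by auto
    moreover have "norm x < T" "norm y < T"
      using that U(3)[OF \<rho>(1)[OF that]] \<open>y \<in> U (\<rho> x)\<close> by (auto simp: E_def)
    ultimately show "z \<in> ball 0 (2 * T)" using norm_triangle_ineq[of x y] by simp
  qed
  obtain D where D: "D \<subseteq> E" "finite D" "disjoint_family_on (\<lambda>x. (+) x ` U (\<rho> x)) D"
    "\<forall>x\<in>E. \<exists>d\<in>D. \<exists>a\<in>U (\<rho> d). \<exists>b\<in>U (\<rho> d). x = d + (a - b)"
    using disjoint_translates_selection[OF F U(1,2) mono \<rho>(1) sub, of E] by auto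
  have DF: "\<rho> d \<in> F" if "d \<in> D" for d using that D(1) \<rho>(1) by auto
  have bU [measurable]: "U (\<rho> d) \<in> sets borel" if "d \<in> D" for d using U(1)[OF DF[OF that]] by simp
  have bW: "W (\<rho> d) \<in> sets borel" if "d \<in> D" for d
    unfolding W_def using open_differences_set[OF U(1)[OF DF[OF that]]] by simp
  have eW: "emeasure lborel (W (\<rho> d)) \<le> ennreal C * emeasure lborel (U (\<rho> d))" if "d \<in> D" for d
  proof -
    have "W (\<rho> d) \<subseteq> ball 0 (2 * T)"
    proof
      fix z assume "z \<in> W (\<rho> d)"
      then obtain x y where xy: "x \<in> U (\<rho> d)" "y \<in> U (\<rho> d)" "z = x - y" by (auto simp: W_def)
      then have "norm x < T" "norm y < T" using U(3)[OF DF[OF that]] by auto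
      then show "z \<in> ball 0 (2 * T)" using norm_triangle_ineq4[of x y] xy(3) by simp
    qed
    then have "emeasure lborel (W (\<rho> d)) \<noteq> \<infinity>"
      using emeasure_mono[of "W (\<rho> d)" "ball 0 (2 * T)" lborel] emeasure_lborel_ball_finite[of "0::'v" "2 * T"]
      by (auto simp: top_unique)
    moreover have "emeasure lborel (U (\<rho> d)) \<noteq> \<infinity>"
      using emeasure_mono[OF U(3)[OF DF[OF that]], of lborel] emeasure_lborel_ball_finite[of "0::'v" T]
      by (auto simp: top_unique)
    ultimately show ?thesis
      using C(2)[OF DF[OF that]] C(1)
      by (simp add: emeasure_eq_ennreal_measure W_def ennreal_leI flip: ennreal_mult)
  qed
  have "E \<subseteq> (\<Union>d\<in>D. (+) d ` W (\<rho> d))"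
    using D(4) by (fastforce simp: W_def)
  then have "emeasure lborel E \<le> emeasure lborel (\<Union>d\<in>D. (+) d ` W (\<rho> d))"
    by (rule emeasure_mono) (use D(2) bW sets_borel_translation in auto)
  also have "\<dots> \<le> (\<Sum>d\<in>D. emeasure lborel ((+) d ` W (\<rho> d)))"
    by (rule emeasure_subadditive_finite) (use D(2) bW sets_borel_translation in auto)
  also have "\<dots> \<le> (\<Sum>d\<in>D. ennreal C * emeasure lborel (U (\<rho> d)))"
    by (rule sum_mono) (use bW eW in \<open>simp add: emeasure_lborel_translation\<close>)
  finally have "ennreal \<alpha> * emeasure lborel E \<le> ennreal \<alpha> * (\<Sum>d\<in>D. ennreal C * emeasure lborel (U (\<rho> d)))"
    by (rule mult_left_mono) simp
  also have "\<dots> = ennreal C * (\<Sum>d\<in>D. ennreal \<alpha> * emeasure lborel (U (\<rho> d)))"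
    by (simp add: sum_distrib_left mult.left_commute)
  also have "\<dots> \<le> ennreal C * (\<Sum>d\<in>D. \<integral>\<^sup>+m. \<phi> m * indicator ((+) d ` U (\<rho> d)) m \<partial>lborel)"
  proof (intro mult_left_mono sum_mono)
    fix d assume d: "d \<in> D"
    have [measurable]: "(+) d ` U (\<rho> d) \<in> sets borel"
      by (rule sets_borel_translation) (use bU d in auto)
    have "ennreal \<alpha> * emeasure lborel (U (\<rho> d)) \<le> (\<integral>\<^sup>+m\<in>U (\<rho> d). \<phi> (m + d) \<partial>lborel)"
      using \<rho>(2)[of d] d D(1) by (auto simp: less_imp_le)
    also have "\<dots> = (\<integral>\<^sup>+m. \<phi> (d + m) * indicator ((+) d ` U (\<rho> d)) (d + m) \<partial>lborel)"
      by (intro nn_integral_cong) (auto simp: indicator_def add.commute)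
    also have "\<dots> = (\<integral>\<^sup>+m. \<phi> m * indicator ((+) d ` U (\<rho> d)) m \<partial>distr lborel borel ((+) d))"
      by (subst nn_integral_distr) auto
    finally show "ennreal \<alpha> * emeasure lborel (U (\<rho> d)) \<le> (\<integral>\<^sup>+m. \<phi> m * indicator ((+) d ` U (\<rho> d)) m \<partial>lborel)"
      by (simp add: lborel_distr_plus)
  qed simp
  also have "(\<Sum>d\<in>D. \<integral>\<^sup>+m. \<phi> m * indicator ((+) d ` U (\<rho> d)) m \<partial>lborel) =
      (\<integral>\<^sup>+m. (\<Sum>d\<in>D. \<phi> m * indicator ((+) d ` U (\<rho> d)) m) \<partial>lborel)"
  proof (rule nn_integral_sum[symmetric])
    fix d assume d: "d \<in> D"
    have [measurable]: "(+) d ` U (\<rho> d) \<in> sets borel"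
      by (rule sets_borel_translation) (use bU d in auto)
    show "(\<lambda>m. \<phi> m * indicator ((+) d ` U (\<rho> d)) m) \<in> borel_measurable lborel" by measurable
  qed
  also have "\<dots> \<le> (\<integral>\<^sup>+m\<in>ball 0 (2 * T). \<phi> m \<partial>lborel)"
  proof (rule nn_integral_mono)
    fix m
    have "(\<Sum>d\<in>D. \<phi> m * indicator ((+) d ` U (\<rho> d)) m) = \<phi> m * indicator (\<Union>d\<in>D. (+) d ` U (\<rho> d)) m"
      by (simp add: indicator_UN_disjoint[OF D(2,3)] sum_distrib_left)
    also have "\<dots> \<le> \<phi> m * indicator (ball 0 (2 * T)) m"
      using sub D(1) by (intro mult_left_mono) (auto simp: indicator_def subset_eq)
    finally show "(\<Sum>d\<in>D. \<phi> m * indicator ((+) d ` U (\<rho> d)) m) \<le> \<phi> m * indicator (ball 0 (2 * T)) m" .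
  qed
  finally show ?thesis unfolding E_def by (simp add: mult_left_mono)
qed

section \<open>Averaging families and transference to an invariant measure\<close>

lemma averaging_familyD:
  assumes U: "averaging_family U" and R: "0 < R"
  shows "open (U R)" "bounded (U R)" "U R \<noteq> {}" "U R \<in> sets borel"
    "emeasure lborel (U R) \<noteq> 0" "emeasure lborel (U R) \<noteq> \<infinity>" "0 < measure lborel (U R)"
proof -
  show o: "open (U R)" and b: "bounded (U R)" using U R by (auto simp: averaging_family_def)
  have "(\<Inter>R\<in>{0<..}. closure (U R)) = {0}" using U by (simp add: averaging_family_def)
  then have "0 \<in> closure (U R)" using R by auto
  then show ne: "U R \<noteq> {}" by auto
  show "U R \<in> sets borel" using o by simp
  show pos: "emeasure lborel (U R) \<noteq> 0" using emeasure_lborel_open_pos[OF o ne] by simp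
  show fin: "emeasure lborel (U R) \<noteq> \<infinity>" using emeasure_bounded_finite[OF b] by simp
  show "0 < measure lborel (U R)"
    using pos fin by (simp add: measure_def enn2real_positive_iff less_top zero_less_iff_neq_zero)
qed

lemma averaging_family_mono: "averaging_family U \<Longrightarrow> 0 < R \<Longrightarrow> R \<le> S \<Longrightarrow> U R \<subseteq> U S"
  by (simp add: averaging_family_def)

text \<open>Left continuity of \<open>R \<mapsto> |U R|\<close> reduces suprema over all radii to rational ones.\<close>

lemma set_nn_integral_le_of_rationals:
  assumes U: "averaging_family U" and R: "0 < R"
    and [measurable]: "\<phi> \<in> borel_measurable borel"
    and le: "\<And>q. q \<in> \<rat> \<Longrightarrow> 0 < q \<Longrightarrow> (\<integral>\<^sup>+l\<in>U q. \<phi> l \<partial>lborel) \<le> ennreal \<alpha> * emeasure lborel (U q)"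
  shows "(\<integral>\<^sup>+l\<in>U R. \<phi> l \<partial>lborel) \<le> ennreal \<alpha> * emeasure lborel (U R)"
proof -
  \<comment> \<open>Rational radii interlaced with \<open>R - R / (i + 1)\<close> are increasing and
    tend to \<open>R\<close>; the first lower bound is 0, so all are positive.\<close>
  have "\<exists>q\<in>\<rat>. R - R / (real i + 1) < q \<and> q < R - R / (real i + 2)" for i
    by (rule Rats_dense_in_real) (use R in \<open>simp add: field_simps\<close>)
  then obtain q where q: "\<And>i. q i \<in> \<rat>" "\<And>i. R - R / (real i + 1) < q i" "\<And>i. q i < R - R / (real i + 2)"
    by metis
  have q_pos: "0 < q i" for i
  proof -
    have "R / (real i + 1) \<le> R" using R by (simp add: field_simps)
    then show ?thesis using q(2)[of i] by linarith
  qed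
  have q_less: "q i < R" for i
    using q(3)[of i] R by (smt (verit) divide_pos_pos of_nat_0_le_iff)
  have "q i \<le> q (Suc i)" for i
    using q(3)[of i] q(2)[of "Suc i"] by (simp add: add.commute)
  then have inc: "incseq (\<lambda>i. U (q i))"
    by (intro incseq_SucI averaging_family_mono[OF U q_pos])
  define V where "V = (\<Union>i. U (q i))"
  have oU [measurable]: "U (q i) \<in> sets borel" "U R \<in> sets borel" for i
    using averaging_familyD(4)[OF U] q_pos R by auto
  have [measurable]: "V \<in> sets borel" unfolding V_def by measurable
  have VR: "V \<subseteq> U R"
    unfolding V_def by (rule UN_least) (rule averaging_family_mono[OF U q_pos less_imp_le[OF q_less]])
  have fR: "U R \<in> fmeasurable lborel"
    using averaging_familyD(6)[OF U R] by (auto simp: fmeasurable_def less_top)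
  have fV: "V \<in> fmeasurable lborel" by (rule fmeasurableI2[OF fR VR]) simp
  \<comment> \<open>Left continuity gives the increasing union \<open>V\<close> the full volume of
    \<open>U R\<close>, so the two sets differ by a null set.\<close>
  have "measure lborel (U R) \<le> measure lborel V"
  proof (rule tendsto_upperbound)
    show "((\<lambda>S. measure lborel (U S)) \<longlongrightarrow> measure lborel (U R)) (at_left R)"
      using U R by (simp add: averaging_family_def continuous_within)
    show "\<forall>\<^sub>F S in at_left R. measure lborel (U S) \<le> measure lborel V"
      unfolding eventually_at_left_field
    proof (intro exI[of _ 0] conjI allI impI R)
      fix S assume S: "0 < S" "S < R"
      obtain i :: nat where "R / (R - S) < real i" using reals_Archimedean2 by blast
      then have "R < real i * (R - S)" using S by (simp add: pos_divide_less_eq)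
      also have "\<dots> \<le> (real i + 1) * (R - S)" using S by simp
      finally have "R / (real i + 1) < R - S" by (simp add: pos_divide_less_eq mult.commute)
      then have "S \<le> q i" using q(2)[of i] by linarith
      then have "U S \<subseteq> V" using averaging_family_mono[OF U S(1)] by (auto simp: V_def)
      then show "measure lborel (U S) \<le> measure lborel V"
        using averaging_familyD(4)[OF U S(1)] by (intro measure_mono_fmeasurable fV) auto
    qed
  qed simp
  then have "measure lborel (U R - V) = 0"
    using measurable_measure_Diff[OF fR fmeasurableD[OF fV] VR] measure_nonneg[of lborel "U R - V"] by linarith
  then have null: "emeasure lborel (U R - V) = 0"
    using fmeasurable.Diff[OF fR fV] by (simp add: emeasure_eq_measure2)
  have AE_V: "AE l in lborel. l \<notin> U R - V"
    by (rule AE_not_in) (use null in \<open>auto simp: null_sets_def\<close>)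
  have "(\<integral>\<^sup>+l\<in>U R. \<phi> l \<partial>lborel) = (\<integral>\<^sup>+l\<in>V. \<phi> l \<partial>lborel)"
  proof (intro nn_integral_cong_AE)
    show "AE l in lborel. \<phi> l * indicator (U R) l = \<phi> l * indicator V l"
      using AE_V by eventually_elim (use VR in \<open>auto simp: indicator_def\<close>)
  qed
  also have "\<dots> = emeasure (density lborel \<phi>) V" by (simp add: emeasure_density)
  also have "\<dots> = (SUP i. emeasure (density lborel \<phi>) (U (q i)))"
    unfolding V_def by (rule SUP_emeasure_incseq[symmetric]) (use inc in auto)
  also have "\<dots> \<le> ennreal \<alpha> * emeasure lborel (U R)"
  proof (rule SUP_least)
    fix i
    have "emeasure (density lborel \<phi>) (U (q i)) = (\<integral>\<^sup>+l\<in>U (q i). \<phi> l \<partial>lborel)" by (simp add: emeasure_density)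
    also have "\<dots> \<le> ennreal \<alpha> * emeasure lborel (U (q i))"
      by (rule le[OF q(1) q_pos])
    also have "\<dots> \<le> ennreal \<alpha> * emeasure lborel (U R)"
      by (intro mult_left_mono emeasure_mono averaging_family_mono[OF U q_pos less_imp_le[OF q_less]]) auto
    finally show "emeasure (density lborel \<phi>) (U (q i)) \<le> ennreal \<alpha> * emeasure lborel (U R)" .
  qed
  finally show ?thesis .
qed

locale invariant_action = measurable_action \<theta> + prob_space P
  for \<theta> :: "real^'n \<Rightarrow> 'a::polish_space \<Rightarrow> 'a" and P :: "'a measure" +
  assumes sets_P [measurable_cong]: "sets P = sets borel"
    and invariant: "distr P borel (\<theta> l) = P"
begin

lemma nn_integral_action:
  assumes [measurable]: "g \<in> borel_measurable borel"
  shows "(\<integral>\<^sup>+x. g (\<theta> l x) \<partial>P) = (\<integral>\<^sup>+x. g x \<partial>P)"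
proof -
  have "(\<integral>\<^sup>+x. g x \<partial>P) = (\<integral>\<^sup>+x. g x \<partial>distr P borel (\<theta> l))" by (simp add: invariant)
  also have "\<dots> = (\<integral>\<^sup>+x. g (\<theta> l x) \<partial>P)" by (rule nn_integral_distr) simp_all
  finally show ?thesis by simp
qed

lemma nn_integral_action_set:
  assumes [measurable]: "g \<in> borel_measurable borel" "A \<in> sets borel"
  shows "(\<integral>\<^sup>+x. (\<integral>\<^sup>+l\<in>A. g (\<theta> l x) \<partial>lborel) \<partial>P) = emeasure lborel A * (\<integral>\<^sup>+x. g x \<partial>P)"
proof -
  interpret pair_sigma_finite lborel P by standard
  have "(\<integral>\<^sup>+x. (\<integral>\<^sup>+l\<in>A. g (\<theta> l x) \<partial>lborel) \<partial>P) = (\<integral>\<^sup>+l. (\<integral>\<^sup>+x. g (\<theta> l x) * indicator A l \<partial>P) \<partial>lborel)"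
    by (rule Fubini') measurable
  also have "\<dots> = (\<integral>\<^sup>+l. (\<integral>\<^sup>+x. g x \<partial>P) * indicator A l \<partial>lborel)"
    by (intro nn_integral_cong) (simp add: nn_integral_multc nn_integral_action)
  also have "\<dots> = emeasure lborel A * (\<integral>\<^sup>+x. g x \<partial>P)"
    by (subst nn_integral_cmult_indicator) (simp_all add: mult.commute)
  finally show ?thesis .
qed

lemma nn_integral_orbit_average:
  assumes [measurable]: "g \<in> borel_measurable borel" "A \<in> sets borel"
    and "emeasure lborel A \<noteq> 0" "emeasure lborel A \<noteq> \<infinity>"
  shows "(\<integral>\<^sup>+x. orbit_average \<theta> A g x \<partial>P) = (\<integral>\<^sup>+x. g x \<partial>P)"
proof -
  have "(\<integral>\<^sup>+x. orbit_average \<theta> A g x \<partial>P) = (\<integral>\<^sup>+x. (\<integral>\<^sup>+l\<in>A. g (\<theta> l x) \<partial>lborel) \<partial>P) / emeasure lborel A"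
    unfolding orbit_average_def by (rule nn_integral_divide) measurable
  also have "\<dots> = (\<integral>\<^sup>+x. g x \<partial>P) * emeasure lborel A / emeasure lborel A"
    unfolding nn_integral_action_set[OF assms(1,2)] by (simp only: mult.commute)
  also have "\<dots> = (\<integral>\<^sup>+x. g x \<partial>P)"
    using assms(3,4) by (intro ennreal_mult_divide_eq) auto
  finally show ?thesis .
qed

lemma measurable_orbit_average [measurable]:
  assumes [measurable]: "g \<in> borel_measurable borel" "A \<in> sets borel"
  shows "orbit_average \<theta> A g \<in> borel_measurable borel"
  unfolding orbit_average_def by measurable

text \<open>Transference: the Euclidean maximal inequality is applied along orbits and integrated
  against the invariant measure.\<close>

lemma maximal_inequality_finite:
  assumes U: "averaging_family U"
    and C: "0 \<le> C" "\<And>R. 0 < R \<Longrightarrow> measure lborel {x - y | x y. x \<in> U R \<and> y \<in> U R} \<le> C * measure lborel (U R)"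
    and [measurable]: "g \<in> borel_measurable borel" and F: "finite F" "F \<subseteq> {0<..}"
  shows "ennreal \<alpha> * emeasure P {x. \<exists>R\<in>F. ennreal \<alpha> * emeasure lborel (U R) < (\<integral>\<^sup>+m\<in>U R. g (\<theta> m x) \<partial>lborel)} \<le>
    ennreal (C * 2 ^ CARD('n)) * (\<integral>\<^sup>+x. g x \<partial>P)"
proof -
  have "bounded (\<Union>R\<in>F. U R)"
    using F averaging_familyD(2)[OF U] by (intro bounded_UN) auto
  then obtain T where T: "0 < T" "(\<Union>R\<in>F. U R) \<subseteq> ball 0 T"
    using bounded_subset_ballD by blast
  define Z where "Z = {x. \<exists>R\<in>F. ennreal \<alpha> * emeasure lborel (U R) < (\<integral>\<^sup>+m\<in>U R. g (\<theta> m x) \<partial>lborel)}"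
  have Zm: "{x. ennreal \<alpha> * emeasure lborel (U R) < (\<integral>\<^sup>+m\<in>U R. g (\<theta> m x) \<partial>lborel)} \<in> sets borel" if "R \<in> F" for R
  proof -
    have [measurable]: "U R \<in> sets borel" using averaging_familyD(4)[OF U] F that by auto
    show ?thesis by measurable
  qed
  have "Z = (\<Union>R\<in>F. {x. ennreal \<alpha> * emeasure lborel (U R) < (\<integral>\<^sup>+m\<in>U R. g (\<theta> m x) \<partial>lborel)})"
    by (auto simp: Z_def)
  then have [measurable]: "Z \<in> sets borel"
    using Zm F(1) by (simp add: sets.finite_UN)
  define b where "b = emeasure lborel (ball (0::real^'n) T)"
  have b: "b \<noteq> 0" "b \<noteq> top"
    using emeasure_lborel_open_pos[of "ball (0::real^'n) T"] T(1) emeasure_lborel_ball_finite[of "0::real^'n" T]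
    by (auto simp: b_def)
  \<comment> \<open>Doubling the radius multiplies the volume by \<open>2 ^ CARD('n)\<close>; this
    is the factor lost in passing from orbits to \<open>P\<close>.\<close>
  have b2: "emeasure lborel (ball (0::real^'n) (2 * T)) = ennreal (2 ^ CARD('n)) * b"
    using T(1) by (simp add: b_def emeasure_ball power_mult_distrib mult_ac flip: ennreal_mult)
  have [measurable]: "ball (0::real^'n) r \<in> sets borel" for r by simp
  have bound: "ennreal \<alpha> * (\<integral>\<^sup>+l\<in>ball 0 T. indicator Z (\<theta> l x) \<partial>lborel) \<le>
      ennreal C * (\<integral>\<^sup>+m\<in>ball 0 (2 * T). g (\<theta> m x) \<partial>lborel)" for x
  proof -
    have [measurable]: "{l \<in> ball 0 T. \<theta> l x \<in> Z} \<in> sets borel" by measurable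
    have "(\<integral>\<^sup>+l\<in>ball 0 T. indicator Z (\<theta> l x) \<partial>lborel) = (\<integral>\<^sup>+l. indicator {l \<in> ball 0 T. \<theta> l x \<in> Z} l \<partial>lborel)"
      by (intro nn_integral_cong) (auto simp: indicator_def)
    also have "\<dots> = emeasure lborel {l \<in> ball 0 T. \<theta> l x \<in> Z}" by simp
    also have "{l \<in> ball 0 T. \<theta> l x \<in> Z} = {l \<in> ball 0 T. \<exists>R\<in>F. ennreal \<alpha> * emeasure lborel (U R) <
        (\<integral>\<^sup>+m\<in>U R. g (\<theta> (m + l) x) \<partial>lborel)}"
      by (simp add: Z_def action_add)
    finally have "(\<integral>\<^sup>+l\<in>ball 0 T. indicator Z (\<theta> l x) \<partial>lborel) = emeasure lborel {l \<in> ball 0 T. \<exists>R\<in>F.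
        ennreal \<alpha> * emeasure lborel (U R) < (\<integral>\<^sup>+m\<in>U R. g (\<theta> (m + l) x) \<partial>lborel)}" .
    moreover have F0: "0 < R" if "R \<in> F" for R using F(2) that by auto
    have "ennreal \<alpha> * emeasure lborel {l \<in> ball 0 T. \<exists>R\<in>F. ennreal \<alpha> * emeasure lborel (U R) <
        (\<integral>\<^sup>+m\<in>U R. g (\<theta> (m + l) x) \<partial>lborel)} \<le> ennreal C * (\<integral>\<^sup>+m\<in>ball 0 (2 * T). g (\<theta> m x) \<partial>lborel)"
    proof (rule maximal_inequality_on_ball[OF _ F(1) _ _ _ _ C(1)])
      show "U R \<subseteq> ball 0 T" if "R \<in> F" for R using T(2) that by auto
    qed (measurable, use averaging_familyD(1,3)[OF U F0] averaging_family_mono[OF U F0] C(2)[OF F0] in auto)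
    ultimately show ?thesis by simp
  qed
  \<comment> \<open>Integration over \<open>P\<close> and invariance produce the factor
    \<open>b\<close> on both sides; it cancels because the ball has positive finite volume.\<close>
  have "b * (ennreal \<alpha> * emeasure P Z) = ennreal \<alpha> * (b * (\<integral>\<^sup>+x. indicator Z x \<partial>P))"
    by (simp add: mult.left_commute)
  also have "\<dots> = (\<integral>\<^sup>+x. ennreal \<alpha> * (\<integral>\<^sup>+l\<in>ball 0 T. indicator Z (\<theta> l x) \<partial>lborel) \<partial>P)"
    by (simp add: nn_integral_cmult nn_integral_action_set b_def)
  also have "\<dots> \<le> (\<integral>\<^sup>+x. ennreal C * (\<integral>\<^sup>+m\<in>ball 0 (2 * T). g (\<theta> m x) \<partial>lborel) \<partial>P)"
    by (intro nn_integral_mono bound)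
  also have "\<dots> = ennreal C * (ennreal (2 ^ CARD('n)) * b * (\<integral>\<^sup>+x. g x \<partial>P))"
    by (simp add: nn_integral_cmult nn_integral_action_set b2)
  also have "\<dots> = b * (ennreal (C * 2 ^ CARD('n)) * (\<integral>\<^sup>+x. g x \<partial>P))"
    using C(1) by (simp add: ennreal_mult mult_ac)
  finally show ?thesis
    using b by (simp add: ennreal_mult_le_mult_iff Z_def)
qed

text \<open>The bound for finitely many radii does not depend on their choice, so it passes to an
  exhaustion of the positive rationals, and left continuity covers the other radii. The exceptional
  set is supplied as a Borel set \<open>N\<close>, which avoids measuring a level set of a supremum
  over uncountably many radii. \<open>K\<close> is fixed before \<open>g\<close> and
  \<open>\<alpha>\<close>, so that it can be used along sequences of functions.\<close>

lemma maximal_inequality: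
  assumes U: "averaging_family U"
  obtains K :: real where "0 \<le> K"
    "\<And>g \<alpha>. g \<in> borel_measurable borel \<Longrightarrow> 0 < \<alpha> \<Longrightarrow> \<exists>N\<in>sets borel. ennreal \<alpha> * emeasure P N \<le> ennreal K * (\<integral>\<^sup>+x. g x \<partial>P) \<and>
      (\<forall>x. x \<notin> N \<longrightarrow> (\<forall>R>0. orbit_average \<theta> (U R) g x \<le> ennreal \<alpha>))"
proof -
  obtain C where C: "\<And>R. 0 < R \<Longrightarrow> measure lborel {x - y | x y. x \<in> U R \<and> y \<in> U R} \<le> C * measure lborel (U R)"
    using U by (auto simp: averaging_family_def)
  \<comment> \<open>The definition does not fix the sign of \<open>C\<close>; a window of positive
    volume forces it to be nonnegative.\<close>
  have "0 \<le> C * measure lborel (U 1)"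
    by (rule order_trans[OF measure_nonneg C]) simp
  then have C0: "0 \<le> C"
    using averaging_familyD(7)[OF U, of 1] by (simp add: zero_le_mult_iff)
  show thesis
  proof (rule that)
    show "0 \<le> C * 2 ^ CARD('n)" using C0 by simp
    fix g :: "'a \<Rightarrow> ennreal" and \<alpha> :: real
    assume g [measurable]: "g \<in> borel_measurable borel" and \<alpha>: "0 < \<alpha>"
    define q where "q = from_nat_into (\<rat> \<inter> {0::real<..})"
    have "(1::real) \<in> \<rat> \<inter> {0<..}" by simp
    then have ne: "\<rat> \<inter> {0::real<..} \<noteq> {}" by blast
    have cnt: "countable (\<rat> \<inter> {0::real<..})" using countable_rat by blast
    have q_range: "q i \<in> \<rat> \<inter> {0<..}" for i
      unfolding q_def by (rule from_nat_into[OF ne])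
    define Z where "Z F = {x. \<exists>R\<in>F. ennreal \<alpha> * emeasure lborel (U R) < (\<integral>\<^sup>+m\<in>U R. g (\<theta> m x) \<partial>lborel)}" for F
    have [measurable]: "U (q i) \<in> sets borel" for i
      using averaging_familyD(4)[OF U] q_range[of i] by auto
    have Zi [measurable]: "Z (q ` {..n}) \<in> sets borel" for n :: nat
    proof -
      have "Z (q ` {..n}) = (\<Union>i\<le>n. {x. ennreal \<alpha> * emeasure lborel (U (q i)) < (\<integral>\<^sup>+m\<in>U (q i). g (\<theta> m x) \<partial>lborel)})"
        by (auto simp: Z_def)
      also have "\<dots> \<in> sets borel" by measurable
      finally show ?thesis .
    qed
    define N where "N = (\<Union>n. Z (q ` {..n}))"
    have "emeasure P N = (SUP n. emeasure P (Z (q ` {..n})))"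
      unfolding N_def by (rule SUP_emeasure_incseq[symmetric])
        (use Zi in \<open>auto simp: sets_P incseq_def Z_def\<close>)
    then have "ennreal \<alpha> * emeasure P N = (SUP n. ennreal \<alpha> * emeasure P (Z (q ` {..n})))"
      by (simp add: SUP_mult_left_ennreal)
    also have "\<dots> \<le> ennreal (C * 2 ^ CARD('n)) * (\<integral>\<^sup>+x. g x \<partial>P)"
    proof (rule SUP_least)
      fix n
      show "ennreal \<alpha> * emeasure P (Z (q ` {..n})) \<le> ennreal (C * 2 ^ CARD('n)) * (\<integral>\<^sup>+x. g x \<partial>P)"
        unfolding Z_def by (rule maximal_inequality_finite[OF U C0 C g]) (use q_range in auto)
    qed
    finally have 1: "ennreal \<alpha> * emeasure P N \<le> ennreal (C * 2 ^ CARD('n)) * (\<integral>\<^sup>+x. g x \<partial>P)" .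
    have 2: "orbit_average \<theta> (U R) g x \<le> ennreal \<alpha>" if x: "x \<notin> N" and R: "0 < R" for x R
    proof -
      have le: "(\<integral>\<^sup>+l\<in>U p. g (\<theta> l x) \<partial>lborel) \<le> ennreal \<alpha> * emeasure lborel (U p)" if p: "p \<in> \<rat>" "0 < p" for p
      proof -
        obtain i where "p = q i"
          unfolding q_def using from_nat_into_surj[OF cnt, of p] p by auto
        then show ?thesis using x by (force simp: N_def Z_def not_less)
      qed
      have "(\<integral>\<^sup>+l\<in>U R. g (\<theta> l x) \<partial>lborel) \<le> ennreal \<alpha> * emeasure lborel (U R)"
        by (rule set_nn_integral_le_of_rationals[OF U R _ le]) measurable
      then show ?thesis
        unfolding orbit_average_def using averaging_familyD(5,6)[OF U R]
        by (simp add: divide_le_posI_ennreal mult.commute zero_less_iff_neq_zero)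
    qed
    have "N \<in> sets borel" unfolding N_def by measurable
    then show "\<exists>N\<in>sets borel. ennreal \<alpha> * emeasure P N \<le> ennreal (C * 2 ^ CARD('n)) * (\<integral>\<^sup>+x. g x \<partial>P) \<and>
        (\<forall>x. x \<notin> N \<longrightarrow> (\<forall>R>0. orbit_average \<theta> (U R) g x \<le> ennreal \<alpha>))"
      using 1 2 by blast
  qed
qed

end

section \<open>Ergodic theorem\<close>

lemma (in prob_space) integrable_bounded:
  fixes X :: "'a \<Rightarrow> real"
  assumes "X \<in> borel_measurable M" "\<And>x. \<bar>X x\<bar> \<le> B"
  shows "integrable M X"
  by (rule integrable_const_bound[of _ B]) (use assms in auto)

lemma (in prob_space) abs_expectation_le:
  fixes X :: "'a \<Rightarrow> real"
  assumes "X \<in> borel_measurable M" "\<And>x. \<bar>X x\<bar> \<le> B"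
  shows "\<bar>expectation X\<bar> \<le> B"
proof -
  have "integrable M X" by (rule integrable_bounded) fact+
  moreover have "X x \<le> B" "- B \<le> X x" for x using assms(2)[of x] by linarith+
  ultimately show ?thesis
    using integral_le_const[of X B] integral_ge_const[of X "- B"] by (auto simp: abs_le_iff)
qed

lemma (in prob_space) expectation_square_le:
  fixes X :: "'a \<Rightarrow> real"
  assumes X [measurable]: "X \<in> borel_measurable M" "\<And>x. \<bar>X x\<bar> \<le> B"
  shows "(expectation X)\<^sup>2 \<le> expectation (\<lambda>x. (X x)\<^sup>2)"
proof -
  have "\<bar>(X x)\<^sup>2\<bar> \<le> B\<^sup>2" for x
    using power_mono[OF X(2)[of x], of 2] by simp
  then have "integrable M (\<lambda>x. (X x)\<^sup>2)" by (intro integrable_bounded) auto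
  then show ?thesis
    using variance_positive[of X] integrable_bounded[OF X] by (simp add: variance_eq)
qed

section \<open>Averages of bounded functions\<close>

locale averaged_action = invariant_action \<theta> P
  for \<theta> :: "real^'n \<Rightarrow> 'a::polish_space \<Rightarrow> 'a" and P :: "'a measure" +
  fixes U :: "real \<Rightarrow> (real^'n) set"
  assumes averaging: "averaging_family U"
begin

abbreviation \<nu> :: "real \<Rightarrow> (real^'n) measure" where
  "\<nu> R \<equiv> uniform_measure lborel (U R)"

text \<open>Real-valued, unlike \<open>orbit_average\<close>, because the bounded case works with
  differences and squares.\<close>

definition avg :: "real \<Rightarrow> ('a \<Rightarrow> real) \<Rightarrow> 'a \<Rightarrow> real" where
  "avg R g x = (\<integral>l. g (\<theta> l x) \<partial>\<nu> R)"

definition \<tau> :: "real \<Rightarrow> real^'n \<Rightarrow> real" where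
  "\<tau> R l = measure lborel (sym_diff ((+) l ` U R) (U R)) / measure lborel (U R)"

lemma prob_space_\<nu>: "0 < R \<Longrightarrow> prob_space (\<nu> R)"
  using averaging_familyD[OF averaging] by (intro prob_space_uniform_measure) auto

lemma sets_\<nu> [measurable_cong]: "sets (\<nu> R) = sets borel"
  by simp

lemma measurable_avg [measurable (raw)]:
  assumes R: "0 < R" and [measurable]: "g \<in> borel_measurable borel"
  shows "avg R g \<in> borel_measurable borel"
proof -
  interpret \<nu>: prob_space "\<nu> R" by (rule prob_space_\<nu>[OF R])
  show ?thesis unfolding avg_def by measurable
qed

lemma abs_avg_le:
  assumes R: "0 < R" and [measurable]: "g \<in> borel_measurable borel" and B: "\<And>x. \<bar>g x\<bar> \<le> B"
  shows "\<bar>avg R g x\<bar> \<le> B"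
proof -
  interpret \<nu>: prob_space "\<nu> R" by (rule prob_space_\<nu>[OF R])
  show ?thesis unfolding avg_def by (rule \<nu>.abs_expectation_le) (use B in auto)
qed

lemma avg_diff:
  assumes R: "0 < R" and [measurable]: "g \<in> borel_measurable borel" "h \<in> borel_measurable borel"
    and B: "\<And>x. \<bar>g x\<bar> \<le> B" "\<And>x. \<bar>h x\<bar> \<le> B'"
  shows "avg R (\<lambda>x. g x - h x) x = avg R g x - avg R h x"
proof -
  interpret \<nu>: prob_space "\<nu> R" by (rule prob_space_\<nu>[OF R])
  show ?thesis unfolding avg_def
    by (rule Bochner_Integration.integral_diff; rule \<nu>.integrable_bounded) (use B in auto)
qed

lemma avg_midpoint:
  assumes R: "0 < R" and [measurable]: "g \<in> borel_measurable borel" "h \<in> borel_measurable borel"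
    and B: "\<And>x. \<bar>g x\<bar> \<le> B" "\<And>x. \<bar>h x\<bar> \<le> B"
  shows "avg R (\<lambda>x. (g x + h x) / 2) x = (avg R g x + avg R h x) / 2"
proof -
  interpret \<nu>: prob_space "\<nu> R" by (rule prob_space_\<nu>[OF R])
  have "integrable (\<nu> R) (\<lambda>l. g (\<theta> l x))" "integrable (\<nu> R) (\<lambda>l. h (\<theta> l x))"
    by (rule \<nu>.integrable_bounded; use B in auto)+
  then show ?thesis unfolding avg_def by simp
qed

lemma orbit_average_eq_nn_integral:
  assumes R: "0 < R" and [measurable]: "g \<in> borel_measurable borel"
  shows "orbit_average \<theta> (U R) g x = (\<integral>\<^sup>+l. g (\<theta> l x) \<partial>\<nu> R)"
  using averaging_familyD(4)[OF averaging R]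
  by (simp add: orbit_average_def nn_integral_uniform_measure)

lemma ennreal_avg:
  assumes R: "0 < R" and [measurable]: "g \<in> borel_measurable borel"
    and B: "\<And>x. 0 \<le> g x" "\<And>x. g x \<le> B"
  shows "orbit_average \<theta> (U R) (\<lambda>y. ennreal (g y)) x = ennreal (avg R g x)"
proof -
  interpret \<nu>: prob_space "\<nu> R" by (rule prob_space_\<nu>[OF R])
  have "integrable (\<nu> R) (\<lambda>l. g (\<theta> l x))"
    by (rule \<nu>.integrable_bounded[of _ B]) (use B in auto)
  then show ?thesis
    using B(1) R by (simp add: orbit_average_eq_nn_integral avg_def nn_integral_eq_integral)
qed

lemma ennreal_abs_avg_le:
  assumes R: "0 < R" and [measurable]: "g \<in> borel_measurable borel" and B: "\<And>x. \<bar>g x\<bar> \<le> B"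
  shows "ennreal \<bar>avg R g x\<bar> \<le> orbit_average \<theta> (U R) (\<lambda>y. ennreal \<bar>g y\<bar>) x"
proof -
  interpret \<nu>: prob_space "\<nu> R" by (rule prob_space_\<nu>[OF R])
  have "integrable (\<nu> R) (\<lambda>l. g (\<theta> l x))"
    by (rule \<nu>.integrable_bounded[of _ B]) (use B in auto)
  then have "ennreal (norm (\<integral>l. g (\<theta> l x) \<partial>\<nu> R)) \<le> (\<integral>\<^sup>+l. ennreal (norm (g (\<theta> l x))) \<partial>\<nu> R)"
    by (rule integral_norm_bound_ennreal)
  then show ?thesis
    using R by (simp add: orbit_average_eq_nn_integral avg_def)
qed

lemma avg_shift:
  assumes R: "0 < R" and [measurable]: "g \<in> borel_measurable borel" and B: "\<And>x. \<bar>g x\<bar> \<le> B"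
  shows "\<bar>avg R g (\<theta> l x) - avg R g x\<bar> \<le> B * \<tau> R l"
  using integral_uniform_measure_translate_le[of "\<lambda>m. g (\<theta> m x)" "U R" B l]
    averaging_familyD(4-6)[OF averaging R] B
  by (simp add: avg_def \<tau>_def action_add add.commute)

lemma tendsto_\<tau>: "((\<lambda>R. \<tau> R l) \<longlongrightarrow> 0) at_top"
  using averaging by (simp add: averaging_family_def \<tau>_def)

lemma \<tau>_nonneg: "0 \<le> \<tau> R l"
  by (simp add: \<tau>_def)

lemma \<tau>_le_2:
  assumes R: "0 < R"
  shows "\<tau> R l \<le> 2"
proof -
  note U = averaging_familyD[OF averaging R]
  have [measurable]: "U R \<in> sets borel" "(+) l ` U R \<in> sets borel"
    using U(4) sets_borel_translation by auto
  have fm: "U R \<in> fmeasurable lborel" "(+) l ` U R \<in> fmeasurable lborel"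
    using U(4,6) by (auto simp: fmeasurable_def emeasure_lborel_translation less_top sets_borel_translation)
  have "measure lborel (sym_diff ((+) l ` U R) (U R)) \<le> measure lborel ((+) l ` U R \<union> U R)"
    by (rule measure_mono_fmeasurable) (use fm in auto)
  also have "\<dots> \<le> measure lborel ((+) l ` U R) + measure lborel (U R)"
    by (rule measure_Un_le) auto
  also have "measure lborel ((+) l ` U R) = measure lborel (U R)"
    using U(4) by (simp add: measure_def emeasure_lborel_translation)
  finally show ?thesis
    using U(7) by (simp add: \<tau>_def field_simps)
qed

text \<open>Written as a membership condition, the symmetric difference depends measurably on
  \<open>l\<close> and \<open>m\<close> jointly, so its volume is measurable in
  \<open>l\<close>.\<close>

lemma measurable_\<tau>:
  assumes R: "0 < R"
  shows "\<tau> R \<in> borel_measurable borel"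
proof -
  have [measurable]: "U R \<in> sets borel" using averaging_familyD(4)[OF averaging R] .
  have [measurable]: "(\<lambda>l. \<integral>\<^sup>+m. indicator {m. (m - l \<in> U R) \<noteq> (m \<in> U R)} m \<partial>lborel) \<in> borel_measurable borel"
    by measurable
  have "sym_diff ((+) l ` U R) (U R) = {m. (m - l \<in> U R) \<noteq> (m \<in> U R)}" for l
    by (force simp: image_iff)
  moreover have "{m. (m - l \<in> U R) \<noteq> (m \<in> U R)} \<in> sets lborel" for l
    by measurable
  ultimately have "emeasure lborel (sym_diff ((+) l ` U R) (U R)) =
      (\<integral>\<^sup>+m. indicator {m. (m - l \<in> U R) \<noteq> (m \<in> U R)} m \<partial>lborel)" for l
    by simp
  then have "\<tau> R = (\<lambda>l. enn2real (\<integral>\<^sup>+m. indicator {m. (m - l \<in> U R) \<noteq> (m \<in> U R)} m \<partial>lborel) / measure lborel (U R))"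
    by (simp add: \<tau>_def measure_def fun_eq_iff)
  also have "\<dots> \<in> borel_measurable borel" by measurable
  finally show ?thesis .
qed

lemma avg_avg:
  assumes R: "0 < R" and S: "0 < S"
    and [measurable]: "g \<in> borel_measurable borel" and B: "\<And>x. \<bar>g x\<bar> \<le> B"
  shows "avg R (avg S g) x = (\<integral>l. avg R g (\<theta> l x) \<partial>\<nu> S)"
proof -
  interpret R: prob_space "\<nu> R" by (rule prob_space_\<nu>[OF R])
  interpret S: prob_space "\<nu> S" by (rule prob_space_\<nu>[OF S])
  interpret pair: pair_prob_space "\<nu> S" "\<nu> R" ..
  have "avg R (avg S g) x = (\<integral>m. (\<integral>l. g (\<theta> (l + m) x) \<partial>\<nu> S) \<partial>\<nu> R)"
    by (simp add: avg_def action_add)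
  also have "\<dots> = (\<integral>l. (\<integral>m. g (\<theta> (l + m) x) \<partial>\<nu> R) \<partial>\<nu> S)"
    by (rule pair.Fubini_integral, rule pair.integrable_bounded[of _ B]) (use B in auto)
  also have "\<dots> = (\<integral>l. avg R g (\<theta> l x) \<partial>\<nu> S)"
    by (simp add: avg_def action_add add.commute)
  finally show ?thesis .
qed

text \<open>By Fubini the iterated average is the \<open>\<nu> S\<close>-mean over \<open>l\<close>
  of the shifted averages \<open>avg R g (\<theta> l x)\<close>, each within
  \<open>B * \<tau> R l\<close> of \<open>avg R g x\<close>. Since \<open>\<tau>\<close> is at most
  2, dominated convergence in \<open>l\<close> makes the mean error vanish; it does not involve
  \<open>x\<close>, whence the uniformity.\<close>

lemma avg_avg_asymptotic:
  assumes S: "0 < S" and g [measurable]: "g \<in> borel_measurable borel" and B: "\<And>x. \<bar>g x\<bar> \<le> B"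
    and e: "0 < e"
  shows "\<forall>\<^sub>F R in at_top. \<forall>x. \<bar>avg R (avg S g) x - avg R g x\<bar> \<le> e"
proof -
  interpret S: prob_space "\<nu> S" by (rule prob_space_\<nu>[OF S])
  have [measurable]: "\<tau> (max R 1) \<in> borel_measurable borel" for R
    by (rule measurable_\<tau>) simp
  \<comment> \<open>\<open>max R 1\<close> keeps the radius positive, as the measurability and the
    bound of \<open>\<tau>\<close> require; for large \<open>R\<close> it changes nothing.\<close>
  have "((\<lambda>R. \<integral>l. B * \<tau> (max R 1) l \<partial>\<nu> S) \<longlongrightarrow> (\<integral>l. 0 \<partial>\<nu> S)) at_top"
  proof (rule integral_dominated_convergence_at_top[where w = "\<lambda>_. \<bar>B\<bar> * 2"])
    show "AE l in \<nu> S. ((\<lambda>R. B * \<tau> (max R 1) l) \<longlongrightarrow> 0) at_top"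
    proof (rule AE_I2)
      fix l
      have "((\<lambda>R. B * \<tau> R l) \<longlongrightarrow> 0) at_top"
        by (rule tendsto_mult_right_zero[OF tendsto_\<tau>])
      moreover have "\<forall>\<^sub>F R in at_top. B * \<tau> R l = B * \<tau> (max R 1) l"
        using eventually_ge_at_top[of "1::real"] by eventually_elim (simp add: max_absorb1)
      ultimately show "((\<lambda>R. B * \<tau> (max R 1) l) \<longlongrightarrow> 0) at_top"
        by (rule Lim_transform_eventually)
    qed
    show "\<forall>\<^sub>F R in at_top. AE l in \<nu> S. norm (B * \<tau> (max R 1) l) \<le> \<bar>B\<bar> * 2"
      using \<tau>_nonneg \<tau>_le_2 by (intro always_eventually allI AE_I2) (auto simp: abs_mult intro!: mult_left_mono)
  qed auto
  then have "((\<lambda>R. \<integral>l. B * \<tau> (max R 1) l \<partial>\<nu> S) \<longlongrightarrow> 0) at_top" by simp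
  then have "\<forall>\<^sub>F R in at_top. (\<integral>l. B * \<tau> (max R 1) l \<partial>\<nu> S) < e"
    using e by (rule order_tendstoD(2))
  moreover have "\<forall>\<^sub>F R in at_top. (1::real) \<le> R" by (rule eventually_ge_at_top)
  ultimately show ?thesis
  proof eventually_elim
    case (elim R)
    then have R: "0 < R" "max R 1 = R" by auto
    show ?case
    proof
      fix x
      have bd: "\<bar>avg R g y\<bar> \<le> B" for y by (rule abs_avg_le[OF R(1) g B])
      have [measurable]: "avg R g \<in> borel_measurable borel" by (rule measurable_avg[OF R(1) g])
      have i1: "integrable (\<nu> S) (\<lambda>l. avg R g (\<theta> l x))"
        by (rule S.integrable_bounded[of _ B]) (use bd in auto)
      have "avg R (avg S g) x - avg R g x = (\<integral>l. avg R g (\<theta> l x) - avg R g x \<partial>\<nu> S)"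
        using i1 S.prob_space by (simp add: avg_avg[OF R(1) S g B])
      also have "\<bar>\<dots>\<bar> \<le> (\<integral>l. B * \<tau> R l \<partial>\<nu> S)"
      proof (rule integral_abs_bound_integral)
        show "integrable (\<nu> S) (\<lambda>l. avg R g (\<theta> l x) - avg R g x)" using i1 by simp
        have "\<bar>B * \<tau> R l\<bar> \<le> \<bar>B\<bar> * 2" for l
          using \<tau>_nonneg \<tau>_le_2[OF R(1)] by (auto simp: abs_mult intro!: mult_left_mono)
        then show "integrable (\<nu> S) (\<lambda>l. B * \<tau> R l)"
          using measurable_\<tau>[OF R(1)] by (intro S.integrable_bounded) auto
        show "\<bar>avg R g (\<theta> l x) - avg R g x\<bar> \<le> B * \<tau> R l" for l
          by (rule avg_shift[OF R(1) g B])
      qed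
      also have "\<dots> < e" using elim R(2) by simp
      finally show "\<bar>avg R (avg S g) x - avg R g x\<bar> \<le> e" by simp
    qed
  qed
qed

lemma expectation_avg:
  assumes R: "0 < R" and g [measurable]: "g \<in> borel_measurable borel" and B: "\<And>x. \<bar>g x\<bar> \<le> B"
  shows "expectation (avg R g) = expectation g"
proof -
  interpret R: prob_space "\<nu> R" by (rule prob_space_\<nu>[OF R])
  interpret pair: pair_prob_space "\<nu> R" P ..
  have "expectation (avg R g) = (\<integral>l. (\<integral>x. g (\<theta> l x) \<partial>P) \<partial>\<nu> R)"
    unfolding avg_def by (rule pair.Fubini_integral, rule pair.integrable_bounded[of _ B]) (use B in auto)
  also have "\<dots> = (\<integral>l. expectation g \<partial>\<nu> R)"
  proof (rule Bochner_Integration.integral_cong[OF refl])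
    fix l
    have "expectation g = (\<integral>x. g x \<partial>distr P borel (\<theta> l))" by (simp add: invariant)
    also have "\<dots> = (\<integral>x. g (\<theta> l x) \<partial>P)" by (rule integral_distr) simp_all
    finally show "(\<integral>x. g (\<theta> l x) \<partial>P) = expectation g" by simp
  qed
  finally show ?thesis using R.prob_space by simp
qed

text \<open>Jensen's inequality along each orbit, followed by invariance of \<open>P\<close>:
  averaging is a contraction in quadratic mean.\<close>

lemma expectation_avg_square_le:
  assumes R: "0 < R" and g [measurable]: "g \<in> borel_measurable borel" and B: "\<And>x. \<bar>g x\<bar> \<le> B"
  shows "expectation (\<lambda>x. (avg R g x)\<^sup>2) \<le> expectation (\<lambda>x. (g x)\<^sup>2)"
proof -
  interpret R: prob_space "\<nu> R" by (rule prob_space_\<nu>[OF R])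
  have B2: "\<bar>(g x)\<^sup>2\<bar> \<le> B\<^sup>2" for x using power_mono[OF B[of x], of 2] by simp
  have A2: "\<bar>(avg R g x)\<^sup>2\<bar> \<le> B\<^sup>2" for x
    using power_mono[OF abs_avg_le[OF R g B, of x], of 2] by simp
  have m: "avg R g \<in> borel_measurable borel" "avg R (\<lambda>x. (g x)\<^sup>2) \<in> borel_measurable borel"
    by (rule measurable_avg[OF R]; measurable)+
  have "expectation (\<lambda>x. (avg R g x)\<^sup>2) \<le> expectation (avg R (\<lambda>x. (g x)\<^sup>2))"
  proof (rule integral_mono)
    show "integrable P (\<lambda>x. (avg R g x)\<^sup>2)" using m A2 by (intro integrable_bounded[of _ "B\<^sup>2"]) auto
    show "integrable P (avg R (\<lambda>x. (g x)\<^sup>2))"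
      using m abs_avg_le[OF R _ B2] by (intro integrable_bounded[of _ "B\<^sup>2"]) auto
    show "(avg R g x)\<^sup>2 \<le> avg R (\<lambda>x. (g x)\<^sup>2) x" for x
      unfolding avg_def by (rule R.expectation_square_le[of _ B]) (use B in auto)
  qed
  also have "\<dots> = expectation (\<lambda>x. (g x)\<^sup>2)" by (rule expectation_avg[OF R _ B2]) measurable
  finally show ?thesis .
qed

text \<open>Among all bounded functions with asymptotically the same averages as \<open>g\<close>, those of almost
  minimal norm in \<open>L\<^sup>2\<close> are close to each other by the parallelogram identity; long averages of
  \<open>g\<close> are of this kind.\<close>

lemma avg_Cauchy_L1:
  assumes g [measurable]: "g \<in> borel_measurable borel" and B: "\<And>x. \<bar>g x\<bar> \<le> B" and e: "0 < e"
  shows "\<exists>R0>0. \<forall>R\<ge>R0. \<forall>S\<ge>R0. expectation (\<lambda>x. \<bar>avg R g x - avg S g x\<bar>) < e"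
proof -
  have B0: "0 \<le> B" using order_trans[OF abs_ge_zero B] .
  \<comment> \<open>The class contains every \<open>avg S g\<close> and is closed under midpoints,
    so the infimum \<open>m\<close> still bounds the midpoint term in the parallelogram identity
    from below.\<close>
  define H where "H = {h. h \<in> borel_measurable borel \<and> (\<forall>x. \<bar>h x\<bar> \<le> B) \<and>
    (\<forall>e>0. \<forall>\<^sub>F R in at_top. \<forall>x. \<bar>avg R h x - avg R g x\<bar> \<le> e)}"
  have gH: "g \<in> H" using g B by (auto simp: H_def)
  have avgH: "avg S g \<in> H" if "0 < S" for S
    using that abs_avg_le[OF that g B] measurable_avg[OF that g] avg_avg_asymptotic[OF that g B]
    by (auto simp: H_def)
  have midH: "(\<lambda>x. (h x + k x) / 2) \<in> H" if h: "h \<in> H" and k: "k \<in> H" for h k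
  proof -
    have [measurable]: "h \<in> borel_measurable borel" "k \<in> borel_measurable borel"
      and b: "\<And>x. \<bar>h x\<bar> \<le> B" "\<And>x. \<bar>k x\<bar> \<le> B"
      using h k by (auto simp: H_def)
    have "\<forall>\<^sub>F R in at_top. \<forall>x. \<bar>avg R (\<lambda>x. (h x + k x) / 2) x - avg R g x\<bar> \<le> e" if "0 < e" for e
    proof -
      have "\<forall>\<^sub>F R in at_top. \<forall>x. \<bar>avg R h x - avg R g x\<bar> \<le> e"
        "\<forall>\<^sub>F R in at_top. \<forall>x. \<bar>avg R k x - avg R g x\<bar> \<le> e"
        using h k that by (auto simp: H_def)
      moreover have "\<forall>\<^sub>F R in at_top. (0::real) < R" by (rule eventually_gt_at_top)
      ultimately show ?thesis
      proof eventually_elim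
        case (elim R)
        show ?case
        proof
          fix x
          have "\<bar>avg R h x - avg R g x\<bar> \<le> e" "\<bar>avg R k x - avg R g x\<bar> \<le> e" using elim by auto
          moreover have "avg R (\<lambda>x. (h x + k x) / 2) x = (avg R h x + avg R k x) / 2"
            by (rule avg_midpoint[OF elim(3) _ _ b]) measurable
          ultimately show "\<bar>avg R (\<lambda>x. (h x + k x) / 2) x - avg R g x\<bar> \<le> e"
            by (simp add: abs_le_iff field_simps)
        qed
      qed
    qed
    moreover have "\<bar>(h x + k x) / 2\<bar> \<le> B" for x using b(1)[of x] b(2)[of x] by (simp add: abs_le_iff)
    ultimately show ?thesis by (auto simp: H_def)
  qed
  have HD: "h \<in> borel_measurable borel" "\<bar>h x\<bar> \<le> B" if "h \<in> H" for h x
    using that by (auto simp: H_def)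
  have int2: "integrable P (\<lambda>x. (h x)\<^sup>2)" if "h \<in> H" for h
  proof (rule integrable_bounded[of _ "B\<^sup>2"])
    show "(\<lambda>x. (h x)\<^sup>2) \<in> borel_measurable P" using HD(1)[OF that] by measurable
    show "\<bar>(h x)\<^sup>2\<bar> \<le> B\<^sup>2" for x using power_mono[OF HD(2)[OF that, of x], of 2] by simp
  qed
  define q where "q h = expectation (\<lambda>x. (h x)\<^sup>2)" for h :: "'a \<Rightarrow> real"
  define m where "m = Inf (q ` H)"
  have q0: "0 \<le> q h" for h by (simp add: q_def)
  have bdd: "bdd_below (q ` H)" using q0 by (intro bdd_belowI[of _ 0]) auto
  have m_le: "m \<le> q h" if "h \<in> H" for h
    unfolding m_def by (rule cInf_lower[OF _ bdd]) (use that in auto)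
  \<comment> \<open>Chosen so that \<open>8 * d = e^2\<close> in the final estimate.\<close>
  define d where "d = e\<^sup>2 / 8"
  have d: "0 < d" using e by (simp add: d_def)
  have "\<exists>h\<in>H. q h < m + d / 2"
    using cInf_lessD[of "q ` H" "m + d / 2"] gH d by (auto simp: m_def)
  then obtain h where h: "h \<in> H" "q h < m + d / 2" by blast
  note [measurable] = HD(1)[OF h(1)]
  \<comment> \<open>Makes the change of squares, at most \<open>2 * B * \<eta>\<close>, no larger
    than \<open>d / 2\<close>; adding 1 avoids a division by zero when \<open>B = 0\<close>.\<close>
  define \<eta> where "\<eta> = d / (4 * (B + 1))"
  have \<eta>: "0 < \<eta>" "2 * B * \<eta> \<le> d / 2"
    using d B0 by (auto simp: \<eta>_def field_simps)
  have "\<forall>\<^sub>F R in at_top. \<forall>x. \<bar>avg R h x - avg R g x\<bar> \<le> \<eta>"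
    using h(1) \<eta>(1) by (auto simp: H_def)
  then obtain R1 where R1: "\<And>R x. R \<ge> R1 \<Longrightarrow> \<bar>avg R h x - avg R g x\<bar> \<le> \<eta>"
    by (auto simp: eventually_at_top_linorder)
  define R0 where "R0 = max R1 1"
  \<comment> \<open>\<open>avg R\<close> does not increase the quadratic mean, so
    \<open>avg R h\<close> is as nearly minimal as \<open>h\<close>; for large \<open>R\<close> the
    function \<open>avg R g\<close> is uniformly close to it.\<close>
  have near_min: "q (avg R g) < m + d" if R: "R \<ge> R0" for R
  proof -
    have R_pos: "0 < R" using R by (simp add: R0_def)
    have bh: "\<bar>avg R h x\<bar> \<le> B" and bg: "\<bar>avg R g x\<bar> \<le> B" for x
      using abs_avg_le[OF R_pos HD[OF h(1)]] abs_avg_le[OF R_pos g B] by auto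
    have [measurable]: "avg R h \<in> borel_measurable borel" "avg R g \<in> borel_measurable borel"
      using measurable_avg[OF R_pos] g HD(1)[OF h(1)] by auto
    have pw: "(avg R g x)\<^sup>2 \<le> (avg R h x)\<^sup>2 + d / 2" for x
    proof -
      have "(avg R g x)\<^sup>2 - (avg R h x)\<^sup>2 = (avg R g x - avg R h x) * (avg R g x + avg R h x)"
        by (simp add: power2_eq_square algebra_simps)
      also have "\<dots> \<le> \<bar>avg R g x - avg R h x\<bar> * \<bar>avg R g x + avg R h x\<bar>"
        by (metis abs_ge_self abs_mult)
      also have "\<dots> \<le> \<eta> * (2 * B)"
        using R1[of R x] R bh[of x] bg[of x] \<eta>(1)
        by (intro mult_mono) (auto simp: R0_def abs_minus_commute)
      finally show ?thesis using \<eta>(2) by (simp add: mult.commute mult.left_commute)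
    qed
    have sq: "integrable P (\<lambda>x. (avg R h x)\<^sup>2)"
    proof (rule integrable_bounded[of _ "B\<^sup>2"])
      show "\<bar>(avg R h x)\<^sup>2\<bar> \<le> B\<^sup>2" for x using power_mono[OF bh[of x], of 2] by simp
    qed measurable
    have "q (avg R g) \<le> expectation (\<lambda>x. (avg R h x)\<^sup>2 + d / 2)"
      unfolding q_def by (rule integral_mono) (use int2[OF avgH[OF R_pos]] sq pw in auto)
    also have "\<dots> = expectation (\<lambda>x. (avg R h x)\<^sup>2) + d / 2"
      using sq by (simp add: prob_space)
    also have "\<dots> \<le> q h + d / 2"
      unfolding q_def using expectation_avg_square_le[OF R_pos HD[OF h(1)]] by simp
    finally show ?thesis using h(2) by simp
  qed
  have "expectation (\<lambda>x. \<bar>avg R g x - avg S g x\<bar>) < e" if RS: "R \<ge> R0" "S \<ge> R0" for R S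
  proof -
    have pos: "0 < R" "0 < S" using RS by (auto simp: R0_def)
    let ?a = "avg R g" and ?b = "avg S g"
    have ab: "?a \<in> H" "?b \<in> H" using avgH pos by auto
    note [measurable] = HD(1)[OF ab(1)] HD(1)[OF ab(2)]
    have mid: "m \<le> q (\<lambda>x. (?a x + ?b x) / 2)" by (rule m_le[OF midH[OF ab]])
    have "(?a x - ?b x)\<^sup>2 = 2 * (?a x)\<^sup>2 + 2 * (?b x)\<^sup>2 - 4 * ((?a x + ?b x) / 2)\<^sup>2" for x
      by (simp add: power2_eq_square field_simps)
    then have "expectation (\<lambda>x. (?a x - ?b x)\<^sup>2) =
        expectation (\<lambda>x. 2 * (?a x)\<^sup>2 + 2 * (?b x)\<^sup>2 - 4 * ((?a x + ?b x) / 2)\<^sup>2)"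
      by (simp only:)
    also have "\<dots> = 2 * q ?a + 2 * q ?b - 4 * q (\<lambda>x. (?a x + ?b x) / 2)"
      unfolding q_def using int2[OF ab(1)] int2[OF ab(2)] int2[OF midH[OF ab]]
      by (subst Bochner_Integration.integral_diff Bochner_Integration.integral_add; (intro Bochner_Integration.integrable_add integrable_mult_right)?; simp?)+
    also have "\<dots> < 8 * d" using near_min[OF RS(1)] near_min[OF RS(2)] mid d by linarith
    finally have sq: "expectation (\<lambda>x. (?a x - ?b x)\<^sup>2) < e\<^sup>2" by (simp add: d_def)
    have "\<bar>\<bar>?a x - ?b x\<bar>\<bar> \<le> 2 * B" for x using HD(2)[OF ab(1), of x] HD(2)[OF ab(2), of x] by linarith
    then have "(expectation (\<lambda>x. \<bar>?a x - ?b x\<bar>))\<^sup>2 \<le> expectation (\<lambda>x. \<bar>?a x - ?b x\<bar>\<^sup>2)"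
      by (intro expectation_square_le) auto
    then have "(expectation (\<lambda>x. \<bar>?a x - ?b x\<bar>))\<^sup>2 < e\<^sup>2" using sq by simp
    then show ?thesis by (rule power2_less_imp_less) (use e in simp)
  qed
  then show ?thesis by (intro exI[of _ R0]) (auto simp: R0_def)
qed

text \<open>Cauchy convergence in mean gives an almost everywhere convergent subsequence
  \<open>s (r i)\<close> of integer averages, with an invariant limit \<open>h\<close>. Since
  \<open>avg R h = h\<close>, the error \<open>avg R g - h\<close> splits into
  \<open>avg R g - avg R (s (r i))\<close>, uniformly small for large \<open>R\<close>, and the
  average of \<open>s (r i) - h\<close>, which the maximal inequality controls for all
  \<open>R\<close> at once.\<close>

lemma ergodic_theorem_bounded:
  assumes g [measurable]: "g \<in> borel_measurable borel" and B: "\<And>x. \<bar>g x\<bar> \<le> B"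
  shows "\<exists>h\<in>borel_measurable borel. AE x in P. ((\<lambda>R. avg R g x) \<longlongrightarrow> h x) at_top"
proof -
  have B0: "0 \<le> B" using order_trans[OF abs_ge_zero B] .
  define s where "s n = avg (real (Suc n)) g" for n
  have s_meas [measurable]: "s n \<in> borel_measurable borel" for n
    unfolding s_def by (rule measurable_avg[OF _ g]) simp
  have s_bd: "\<bar>s n x\<bar> \<le> B" for n x
    unfolding s_def by (rule abs_avg_le[OF _ g B]) simp
  have s_int: "integrable P (s n)" for n
    by (rule integrable_bounded[of _ B]) (use s_bd in auto)
  have s_Cauchy: "\<exists>N. \<forall>i\<ge>N. \<forall>j\<ge>N. (LINT x|P. norm (s i x - s j x)) < e" if "0 < e" for e
  proof -
    obtain R0 where "0 < R0" and R0: "\<forall>R\<ge>R0. \<forall>S\<ge>R0. expectation (\<lambda>x. \<bar>avg R g x - avg S g x\<bar>) < e"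
      using avg_Cauchy_L1[OF g B \<open>0 < e\<close>] by blast
    obtain N :: nat where "R0 \<le> real N" using real_arch_simple by blast
    then have "R0 \<le> real (Suc i)" if "N \<le> i" for i
      using that by simp
    then show ?thesis using R0 by (intro exI[of _ N]) (simp add: s_def)
  qed
  obtain r where r: "strict_mono r" "AE x in P. Cauchy (\<lambda>i. s (r i) x)"
    using cauchy_L1_AE_cauchy_subseq[of P s] s_int s_Cauchy by blast
  \<comment> \<open>Clipping keeps \<open>h\<close> within \<open>[-B, B]\<close> also where the
    subsequence diverges and \<open>lim\<close> is unspecified.\<close>
  define h where "h x = max (- B) (min B (lim (\<lambda>i. s (r i) x)))" for x
  have h_meas [measurable]: "h \<in> borel_measurable borel" unfolding h_def by measurable
  have h_bd: "\<bar>h x\<bar> \<le> B" for x using B0 by (auto simp: h_def)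
  have lim_r: "filterlim (\<lambda>i. real (Suc (r i))) at_top sequentially"
    by (rule filterlim_compose[OF filterlim_real_sequentially])
      (rule filterlim_compose[OF filterlim_Suc filterlim_subseq[OF r(1)]])
  have h_inv: "h (\<theta> l x) = h x" for l x
  proof -
    have "(\<lambda>i. \<tau> (real (Suc (r i))) l) \<longlonglongrightarrow> 0"
      by (rule filterlim_compose[OF tendsto_\<tau> lim_r])
    then have lim0: "(\<lambda>i. B * \<tau> (real (Suc (r i))) l) \<longlonglongrightarrow> 0"
      by (rule tendsto_mult_right_zero)
    have "norm (s (r i) (\<theta> l x) - s (r i) x) \<le> B * \<tau> (real (Suc (r i))) l" for i
      unfolding s_def using avg_shift[OF _ g B, of "real (Suc (r i))" l x] by simp
    then have diff: "(\<lambda>i. s (r i) (\<theta> l x) - s (r i) x) \<longlonglongrightarrow> 0"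
      by (rule Lim_null_comparison[OF always_eventually lim0, OF allI])
    \<comment> \<open>Shifted and unshifted sequences have the same limits, so the two
      \<open>lim\<close> terms agree even without convergence. Invariance thus holds at every point,
      and \<open>h\<close> is constant on each orbit.\<close>
    have "(\<lambda>i. s (r i) (\<theta> l x)) \<longlonglongrightarrow> L \<longleftrightarrow> (\<lambda>i. s (r i) x) \<longlonglongrightarrow> L" for L
      using tendsto_diff[of _ L sequentially _ 0, OF _ diff] tendsto_add[of _ L sequentially _ 0, OF _ diff]
      by fastforce
    then have "lim (\<lambda>i. s (r i) (\<theta> l x)) = lim (\<lambda>i. s (r i) x)"
      unfolding lim_def by simp
    then show ?thesis by (simp add: h_def)
  qed
  have avg_h: "avg R h x = h x" if R: "0 < R" for R x
  proof -
    interpret R: prob_space "\<nu> R" by (rule prob_space_\<nu>[OF R])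
    show ?thesis using R.prob_space by (simp add: avg_def h_inv)
  qed
  have s_lim: "AE x in P. (\<lambda>i. s (r i) x) \<longlonglongrightarrow> h x"
    using r(2)
  proof eventually_elim
    case (elim x)
    then have conv: "(\<lambda>i. s (r i) x) \<longlonglongrightarrow> lim (\<lambda>i. s (r i) x)"
      by (simp add: Cauchy_convergent convergent_LIMSEQ_iff[symmetric])
    have "- B \<le> s (r i) x" "s (r i) x \<le> B" for i using s_bd[of "r i" x] by linarith+
    then have "- B \<le> lim (\<lambda>i. s (r i) x)" "lim (\<lambda>i. s (r i) x) \<le> B"
      using LIMSEQ_le_const[OF conv, of "- B"] LIMSEQ_le_const2[OF conv, of B] by blast+
    then show ?case using conv by (simp add: h_def)
  qed
  define D where "D i x = \<bar>s (r i) x - h x\<bar>" for i x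
  have [measurable]: "D i \<in> borel_measurable borel" for i unfolding D_def by measurable
  have D_bd: "\<bar>D i x\<bar> \<le> 2 * B" for i x using s_bd[of "r i" x] h_bd[of x] by (simp add: D_def abs_le_iff)
  have "(\<lambda>i. expectation (D i)) \<longlonglongrightarrow> expectation (\<lambda>x. 0)"
  proof (rule integral_dominated_convergence[where w = "\<lambda>_. 2 * B"])
    show "AE x in P. (\<lambda>i. D i x) \<longlonglongrightarrow> 0"
      using s_lim unfolding D_def by eventually_elim (simp add: tendsto_rabs_zero_iff LIM_zero_iff)
  qed (use D_bd in auto)
  then have D_lim: "(\<lambda>i. expectation (D i)) \<longlonglongrightarrow> 0" by simp
  obtain K where K: "0 \<le> K"
    "\<And>g \<alpha>. g \<in> borel_measurable borel \<Longrightarrow> 0 < \<alpha> \<Longrightarrow> \<exists>N\<in>sets borel. ennreal \<alpha> * emeasure P N \<le> ennreal K * (\<integral>\<^sup>+x. g x \<partial>P) \<and>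
      (\<forall>x. x \<notin> N \<longrightarrow> (\<forall>R>0. orbit_average \<theta> (U R) g x \<le> ennreal \<alpha>))"
    using maximal_inequality[OF averaging] by blast
  have small: "AE x in P. \<forall>\<^sub>F R in at_top. \<bar>avg R g x - h x\<bar> \<le> 2 * \<alpha>" if \<alpha>: "0 < \<alpha>" for \<alpha>
  proof -
    have "\<forall>i. \<exists>N\<in>sets borel. ennreal \<alpha> * emeasure P N \<le> ennreal K * (\<integral>\<^sup>+x. ennreal (D i x) \<partial>P) \<and>
        (\<forall>x. x \<notin> N \<longrightarrow> (\<forall>R>0. orbit_average \<theta> (U R) (\<lambda>x. ennreal (D i x)) x \<le> ennreal \<alpha>))"
      using \<alpha> by (intro allI K(2)) measurable
    then obtain N where N: "\<And>i. N i \<in> sets borel"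
      "\<And>i. ennreal \<alpha> * emeasure P (N i) \<le> ennreal K * (\<integral>\<^sup>+x. ennreal (D i x) \<partial>P)"
      "\<And>i x R. x \<notin> N i \<Longrightarrow> 0 < R \<Longrightarrow> orbit_average \<theta> (U R) (\<lambda>x. ennreal (D i x)) x \<le> ennreal \<alpha>"
      by metis
    \<comment> \<open>Each \<open>N i\<close> has measure at most \<open>K / \<alpha>\<close> times
      the mean of \<open>D i\<close>, which tends to 0, so the intersection is null. A point outside
      it escapes some \<open>N i\<close>, and that one index suffices.\<close>
    have "prob (\<Inter>i. N i) \<le> K / \<alpha> * expectation (D i)" for i
    proof -
      have "(\<integral>\<^sup>+x. ennreal (D i x) \<partial>P) = ennreal (expectation (D i))"
        by (rule nn_integral_eq_integral)
          (use D_bd in \<open>auto intro: integrable_bounded[of _ "2 * B"] simp: D_def\<close>)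
      then have "\<alpha> * prob (N i) \<le> K * expectation (D i)"
        using N(2)[of i] \<alpha> K(1)
        by (simp add: emeasure_eq_measure ennreal_mult[symmetric] D_def)
      moreover have "prob (\<Inter>i. N i) \<le> prob (N i)"
        using N(1) by (intro finite_measure_mono) (auto simp: sets_P)
      ultimately show ?thesis
        using \<alpha> by (simp add: field_simps) (meson mult_left_mono less_imp_le order_trans)
    qed
    then have "prob (\<Inter>i. N i) \<le> 0"
      using LIMSEQ_le_const[OF tendsto_mult_right_zero[OF D_lim, of "K / \<alpha>"]] by blast
    then have null: "(\<Inter>i. N i) \<in> null_sets P"
      using N(1) by (intro null_setsI) (auto simp: emeasure_eq_measure sets_P measure_le_0_iff)
    have "AE x in P. x \<notin> (\<Inter>i. N i)" by (rule AE_not_in[OF null])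
    then show ?thesis
    proof eventually_elim
      case (elim x)
      then obtain i where i: "x \<notin> N i" by blast
      have "\<forall>\<^sub>F R in at_top. \<forall>x. \<bar>avg R (s (r i)) x - avg R g x\<bar> \<le> \<alpha>"
        unfolding s_def by (rule avg_avg_asymptotic[OF _ g B \<alpha>]) simp
      moreover have "\<forall>\<^sub>F R in at_top. (0::real) < R" by (rule eventually_gt_at_top)
      ultimately show ?case
      proof eventually_elim
        case (elim R)
        have "avg R (\<lambda>x. s (r i) x - h x) x = avg R (s (r i)) x - avg R h x"
          by (rule avg_diff[OF elim(2) s_meas h_meas s_bd h_bd])
        then have "avg R (\<lambda>x. s (r i) x - h x) x = avg R (s (r i)) x - h x"
          by (simp add: avg_h[OF elim(2)])
        moreover have "ennreal \<bar>avg R (\<lambda>x. s (r i) x - h x) x\<bar> \<le> ennreal \<alpha>"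
        proof (rule order_trans[OF ennreal_abs_avg_le[OF elim(2)]])
          show "(\<lambda>x. s (r i) x - h x) \<in> borel_measurable borel" by measurable
          show "\<bar>s (r i) x - h x\<bar> \<le> 2 * B" for x using D_bd[of i x] by (simp add: D_def)
          show "orbit_average \<theta> (U R) (\<lambda>y. ennreal \<bar>s (r i) y - h y\<bar>) x \<le> ennreal \<alpha>"
            using N(3)[OF i elim(2)] by (simp add: D_def)
        qed
        ultimately have "\<bar>avg R (s (r i)) x - h x\<bar> \<le> \<alpha>"
          using \<alpha> by simp
        moreover have "\<bar>avg R (s (r i)) x - avg R g x\<bar> \<le> \<alpha>" using elim by blast
        ultimately show ?case by linarith
      qed
    qed
  qed
  have "AE x in P. \<forall>n. \<forall>\<^sub>F R in at_top. \<bar>avg R g x - h x\<bar> \<le> 2 * inverse (real (Suc n))"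
    unfolding AE_all_countable by (intro allI small) simp
  then have "AE x in P. ((\<lambda>R. avg R g x) \<longlongrightarrow> h x) at_top"
  proof eventually_elim
    case (elim x)
    show ?case
    proof (rule tendstoI)
      fix e :: real assume "0 < e"
      then obtain n where "inverse (real (Suc n)) < e / 2" using reals_Archimedean[of "e / 2"] by auto
      then have n: "2 * inverse (real (Suc n)) < e" by simp
      show "\<forall>\<^sub>F R in at_top. dist (avg R g x) (h x) < e"
        by (rule eventually_mono[OF elim[rule_format, of n]]) (use n in \<open>simp add: dist_real_def\<close>)
    qed
  qed
  then show ?thesis using h_meas by blast
qed

text \<open>The truncations \<open>fn n\<close> are covered by the bounded case. The remainders
  \<open>d n\<close> have integrals tending to 0, so the maximal inequality bounds their averages
  for all radii outside small sets. For the integrals, Fatou's lemma gives one inequality and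
  dominated convergence for the truncations the other.\<close>

lemma pointwise_ergodic_theorem:
  assumes f [measurable]: "f \<in> borel_measurable borel" and fin: "(\<integral>\<^sup>+x. f x \<partial>P) < \<infinity>"
  shows "AE x in P. \<exists>L<\<infinity>. ((\<lambda>R. orbit_average \<theta> (U R) f x) \<longlongrightarrow> L) at_top"
    and "(\<integral>\<^sup>+x. ergodic_limit \<theta> U f x \<partial>P) = (\<integral>\<^sup>+x. f x \<partial>P)"
proof -
  define fn where "fn n x = min (f x) (of_nat n)" for n :: nat and x
  define g where "g n x = enn2real (fn n x)" for n :: nat and x
  define d where "d n x = f x - fn n x" for n x
  have fn_meas [measurable]: "fn n \<in> borel_measurable borel" for n unfolding fn_def by measurable
  have [measurable]: "g n \<in> borel_measurable borel" for n unfolding g_def by measurable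
  have d_meas [measurable]: "d n \<in> borel_measurable borel" for n unfolding d_def by measurable
  have fn_le: "fn n x \<le> f x" "fn n x \<le> of_nat n" for n x by (simp_all add: fn_def)
  have fn_top: "fn n x < top" for n x
    using le_less_trans[OF fn_le(2)] by (simp add: of_nat_less_top)
  have ennreal_g: "ennreal (g n x) = fn n x" for n x
    using fn_top[of n x] by (simp add: g_def)
  have g_bd: "0 \<le> g n x" "g n x \<le> real n" for n x
  proof -
    show "0 \<le> g n x" by (simp add: g_def)
    show "g n x \<le> real n"
      using fn_le(2)[of n x] by (simp add: ennreal_of_nat_eq_real_of_nat flip: ennreal_g)
  qed
  have f_eq: "f x = fn n x + d n x" for n x
    unfolding d_def using fn_le(1)[of n x] fn_top[of n x] by (simp add: add_diff_inverse_ennreal)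
  have "\<forall>n. \<exists>h\<in>borel_measurable borel. AE x in P. ((\<lambda>R. avg R (g n) x) \<longlongrightarrow> h x) at_top"
  proof
    fix n
    have "\<bar>g n x\<bar> \<le> real n" for x using g_bd[of n x] by simp
    then show "\<exists>h\<in>borel_measurable borel. AE x in P. ((\<lambda>R. avg R (g n) x) \<longlongrightarrow> h x) at_top"
      by (intro ergodic_theorem_bounded) measurable
  qed
  then obtain h where h [measurable]: "\<And>n. h n \<in> borel_measurable borel"
    and h_lim: "\<And>n. AE x in P. ((\<lambda>R. avg R (g n) x) \<longlongrightarrow> h n x) at_top"
    by metis
  have b_eq: "orbit_average \<theta> (U R) (fn n) x = ennreal (avg R (g n) x)" if "0 < R" for R n x
    using ennreal_avg[OF that, of "g n" "real n" x] g_bd by (simp add: ennreal_g)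
  have b_lim: "((\<lambda>R. orbit_average \<theta> (U R) (fn n) x) \<longlongrightarrow> ennreal (h n x)) at_top"
    if "((\<lambda>R. avg R (g n) x) \<longlongrightarrow> h n x) at_top" for n x
  proof (rule Lim_transform_eventually[OF tendsto_ennrealI[OF that]])
    show "\<forall>\<^sub>F R in at_top. ennreal (avg R (g n) x) = orbit_average \<theta> (U R) (fn n) x"
      using eventually_gt_at_top[of "0::real"] by eventually_elim (simp add: b_eq)
  qed
  have avg_split: "orbit_average \<theta> (U R) f x = orbit_average \<theta> (U R) (fn n) x + orbit_average \<theta> (U R) (d n) x"
    if "0 < R" for R n x
  proof -
    have "orbit_average \<theta> (U R) f x = (\<integral>\<^sup>+l. fn n (\<theta> l x) + d n (\<theta> l x) \<partial>\<nu> R)"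
      unfolding orbit_average_eq_nn_integral[OF that f] by (simp flip: f_eq)
    also have "\<dots> = (\<integral>\<^sup>+l. fn n (\<theta> l x) \<partial>\<nu> R) + (\<integral>\<^sup>+l. d n (\<theta> l x) \<partial>\<nu> R)"
      by (rule nn_integral_add) measurable
    finally show ?thesis using that by (simp add: orbit_average_eq_nn_integral)
  qed
  have d_int: "(\<lambda>n. \<integral>\<^sup>+x. d n x \<partial>P) \<longlonglongrightarrow> 0"
  proof -
    have "(\<lambda>n. \<integral>\<^sup>+x. d n x \<partial>P) \<longlonglongrightarrow> (\<integral>\<^sup>+x. 0 \<partial>P)"
    proof (rule nn_integral_dominated_convergence[where w = f])
      have "AE x in P. f x \<noteq> \<infinity>"
        by (rule nn_integral_noteq_infinite) (use fin in auto)
      then show "AE x in P. (\<lambda>n. d n x) \<longlonglongrightarrow> 0"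
      proof eventually_elim
        case (elim x)
        then obtain r where r: "0 \<le> r" "f x = ennreal r" by (cases "f x" rule: ennreal_cases) auto
        obtain N :: nat where N: "r \<le> real N" using real_arch_simple by blast
        have "d n x = 0" if "N \<le> n" for n
        proof -
          have "r \<le> real n" using N that by simp
          then have "f x \<le> of_nat n" by (simp add: r ennreal_of_nat_eq_real_of_nat ennreal_leI)
          then show ?thesis using r by (simp add: d_def fn_def min_absorb1)
        qed
        then show ?case
          by (intro tendsto_eventually) (auto simp: eventually_sequentially)
      qed
      show "AE x in P. d n x \<le> f x" for n by (simp add: d_def diff_le_self_ennreal)
    qed (use fin in auto)
    then show ?thesis by simp
  qed
  obtain K where K: "0 \<le> K"
    "\<And>g \<alpha>. g \<in> borel_measurable borel \<Longrightarrow> 0 < \<alpha> \<Longrightarrow> \<exists>N\<in>sets borel. ennreal \<alpha> * emeasure P N \<le> ennreal K * (\<integral>\<^sup>+x. g x \<partial>P) \<and>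
      (\<forall>x. x \<notin> N \<longrightarrow> (\<forall>R>0. orbit_average \<theta> (U R) g x \<le> ennreal \<alpha>))"
    using maximal_inequality[OF averaging] by blast
  \<comment> \<open>The index \<open>n\<close> may depend on the point: it is enough to avoid one of
    the exceptional sets, and their intersection is null.\<close>
  have small: "AE x in P. \<exists>n. \<forall>R>0. orbit_average \<theta> (U R) (d n) x \<le> ennreal \<alpha>" if \<alpha>: "0 < \<alpha>" for \<alpha>
  proof -
    have "\<forall>n. \<exists>N\<in>sets borel. ennreal \<alpha> * emeasure P N \<le> ennreal K * (\<integral>\<^sup>+x. d n x \<partial>P) \<and>
        (\<forall>x. x \<notin> N \<longrightarrow> (\<forall>R>0. orbit_average \<theta> (U R) (d n) x \<le> ennreal \<alpha>))"
      using \<alpha> by (intro allI K(2)) measurable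
    then obtain N where N: "\<And>n. N n \<in> sets borel"
      "\<And>n. ennreal \<alpha> * emeasure P (N n) \<le> ennreal K * (\<integral>\<^sup>+x. d n x \<partial>P)"
      "\<And>n x R. x \<notin> N n \<Longrightarrow> 0 < R \<Longrightarrow> orbit_average \<theta> (U R) (d n) x \<le> ennreal \<alpha>"
      by metis
    have Nm: "N n \<in> sets P" for n using N(1) by (simp add: sets_P)
    have "ennreal \<alpha> * emeasure P (\<Inter>n. N n) \<le> ennreal K * (\<integral>\<^sup>+x. d n x \<partial>P)" for n
      by (rule order_trans[OF mult_left_mono[OF emeasure_mono] N(2)]) (use Nm in auto)
    moreover have "(\<lambda>n. ennreal K * (\<integral>\<^sup>+x. d n x \<partial>P)) \<longlonglongrightarrow> ennreal K * 0"
      by (rule ennreal_tendsto_cmult[OF _ d_int]) simp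
    ultimately have "ennreal \<alpha> * emeasure P (\<Inter>n. N n) \<le> ennreal K * 0"
      by (intro LIMSEQ_le_const) auto
    then have null: "(\<Inter>n. N n) \<in> null_sets P"
      using \<alpha> Nm by (intro null_setsI) auto
    have "AE x in P. x \<notin> (\<Inter>n. N n)" by (rule AE_not_in[OF null])
    then show ?thesis by eventually_elim (use N(3) in blast)
  qed
  have ev: "\<forall>\<^sub>F R in at_top. (0::real) < R" by (rule eventually_gt_at_top)
  have good: "AE x in P. (\<forall>n. ((\<lambda>R. avg R (g n) x) \<longlongrightarrow> h n x) at_top) \<and>
      (\<forall>k. \<exists>n. \<forall>R>0. orbit_average \<theta> (U R) (d n) x \<le> ennreal (inverse (real (Suc k))))"
  proof -
    have "AE x in P. \<forall>n. ((\<lambda>R. avg R (g n) x) \<longlongrightarrow> h n x) at_top"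
      unfolding AE_all_countable using h_lim by blast
    moreover have "AE x in P. \<forall>k. \<exists>n. \<forall>R>0. orbit_average \<theta> (U R) (d n) x \<le> ennreal (inverse (real (Suc k)))"
      unfolding AE_all_countable by (intro allI small) simp
    ultimately show ?thesis by eventually_elim blast
  qed
  have lower: "ennreal (h n x) \<le> Liminf at_top (\<lambda>R. orbit_average \<theta> (U R) f x)"
    if "((\<lambda>R. avg R (g n) x) \<longlongrightarrow> h n x) at_top" for n x
  proof -
    have "ennreal (h n x) = Liminf at_top (\<lambda>R. orbit_average \<theta> (U R) (fn n) x)"
      using b_lim[OF that] by (intro lim_imp_Liminf[symmetric]) auto
    also have "\<dots> \<le> Liminf at_top (\<lambda>R. orbit_average \<theta> (U R) f x)"
      by (rule Liminf_mono, rule eventually_mono[OF ev]) (simp add: avg_split[of _ _ n])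
    finally show ?thesis .
  qed
  show lim: "AE x in P. \<exists>L<\<infinity>. ((\<lambda>R. orbit_average \<theta> (U R) f x) \<longlongrightarrow> L) at_top"
    using good
  proof eventually_elim
    case (elim x)
    let ?a = "\<lambda>R. orbit_average \<theta> (U R) f x"
    have upper: "\<exists>n. Limsup at_top ?a \<le> ennreal (h n x) + ennreal (inverse (real (Suc k)))" for k
    proof -
      obtain n where n: "\<forall>R>0. orbit_average \<theta> (U R) (d n) x \<le> ennreal (inverse (real (Suc k)))"
        using elim by blast
      have "Limsup at_top ?a \<le> Limsup at_top (\<lambda>R. ennreal (inverse (real (Suc k))) + orbit_average \<theta> (U R) (fn n) x)"
        by (rule Limsup_mono, rule eventually_mono[OF ev])
          (use n in \<open>auto simp: avg_split[of _ _ n] add.commute intro: add_left_mono\<close>)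
      also have "\<dots> = ennreal (inverse (real (Suc k))) + Limsup at_top (\<lambda>R. orbit_average \<theta> (U R) (fn n) x)"
        by (rule Limsup_const_add) simp
      also have "Limsup at_top (\<lambda>R. orbit_average \<theta> (U R) (fn n) x) = ennreal (h n x)"
        using b_lim elim by (intro lim_imp_Limsup) auto
      finally show ?thesis by (intro exI[of _ n]) (simp add: add.commute)
    qed
    have "Limsup at_top ?a < \<infinity>"
      using upper[of 0] by (auto intro: le_less_trans simp: less_top)
    moreover have "Limsup at_top ?a \<le> Liminf at_top ?a"
    proof (rule ennreal_le_epsilon)
      fix e :: real assume "0 < e"
      then obtain k where k: "inverse (real (Suc k)) < e" using reals_Archimedean by blast
      obtain n where "Limsup at_top ?a \<le> ennreal (h n x) + ennreal (inverse (real (Suc k)))"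
        using upper by blast
      also have "\<dots> \<le> Liminf at_top ?a + ennreal e"
        using lower[of n x] elim k by (intro add_mono ennreal_leI) auto
      finally show "Limsup at_top ?a \<le> Liminf at_top ?a + ennreal e" .
    qed
    moreover have "Liminf at_top ?a \<le> Limsup at_top ?a"
      by (rule Liminf_le_Limsup) simp
    ultimately show ?case
      by (intro exI[of _ "Limsup at_top ?a"] conjI Liminf_eq_Limsup) auto
  qed
  \<comment> \<open>\<open>Lim\<close> is unspecified where no limit exists; almost everywhere it is
    the limit, which is all the integrals see.\<close>
  have erg: "AE x in P. ((\<lambda>R. orbit_average \<theta> (U R) f x) \<longlongrightarrow> ergodic_limit \<theta> U f x) at_top"
    using lim by eventually_elim (auto simp: ergodic_limit_def tendsto_Lim)
  have at: "filterlim (\<lambda>k. real (Suc k)) at_top sequentially"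
    by (rule filterlim_compose[OF filterlim_real_sequentially filterlim_Suc])
  have U_meas [measurable]: "U (real (Suc k)) \<in> sets borel" for k
    by (rule averaging_familyD(4)[OF averaging]) simp
  have int_avg: "(\<integral>\<^sup>+x. orbit_average \<theta> (U (real (Suc k))) u x \<partial>P) = (\<integral>\<^sup>+x. u x \<partial>P)"
    if "u \<in> borel_measurable borel" for u k
    by (rule nn_integral_orbit_average[OF that averaging_familyD(4-6)[OF averaging]]) simp_all
  show "(\<integral>\<^sup>+x. ergodic_limit \<theta> U f x \<partial>P) = (\<integral>\<^sup>+x. f x \<partial>P)"
  proof (rule antisym)
    \<comment> \<open>Integer radii replace the continuum by a sequence of measurable functions, to
      which Fatou's lemma applies.\<close>
    have "(\<integral>\<^sup>+x. ergodic_limit \<theta> U f x \<partial>P) = (\<integral>\<^sup>+x. liminf (\<lambda>k. orbit_average \<theta> (U (real (Suc k))) f x) \<partial>P)"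
    proof (rule nn_integral_cong_AE)
      show "AE x in P. ergodic_limit \<theta> U f x = liminf (\<lambda>k. orbit_average \<theta> (U (real (Suc k))) f x)"
        using erg
      proof eventually_elim
        case (elim x)
        have "(\<lambda>k. orbit_average \<theta> (U (real (Suc k))) f x) \<longlonglongrightarrow> ergodic_limit \<theta> U f x"
          by (rule filterlim_compose[OF elim at])
        then show ?case by (intro lim_imp_Liminf[symmetric]) auto
      qed
    qed
    also have "\<dots> \<le> liminf (\<lambda>k. \<integral>\<^sup>+x. orbit_average \<theta> (U (real (Suc k))) f x \<partial>P)"
      by (rule nn_integral_liminf) measurable
    also have "\<dots> = (\<integral>\<^sup>+x. f x \<partial>P)"
      by (simp add: int_avg[OF f] Liminf_const del: of_nat_Suc)
    finally show "(\<integral>\<^sup>+x. ergodic_limit \<theta> U f x \<partial>P) \<le> (\<integral>\<^sup>+x. f x \<partial>P)" .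
    have "(\<integral>\<^sup>+x. fn n x \<partial>P) \<le> (\<integral>\<^sup>+x. ergodic_limit \<theta> U f x \<partial>P)" for n
    proof -
      have "(\<lambda>k. \<integral>\<^sup>+x. orbit_average \<theta> (U (real (Suc k))) (fn n) x \<partial>P) \<longlonglongrightarrow> (\<integral>\<^sup>+x. ennreal (h n x) \<partial>P)"
      proof (rule nn_integral_dominated_convergence[where w = "\<lambda>_. of_nat n"])
        show "AE x in P. (\<lambda>k. orbit_average \<theta> (U (real (Suc k))) (fn n) x) \<longlonglongrightarrow> ennreal (h n x)"
          using h_lim[of n]
        proof eventually_elim
          case (elim x)
          show ?case by (rule filterlim_compose[OF b_lim[OF elim] at])
        qed
        show "AE x in P. orbit_average \<theta> (U (real (Suc k))) (fn n) x \<le> of_nat n" for k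
        proof (rule AE_I2)
          fix x
          have "\<bar>avg (real (Suc k)) (g n) x\<bar> \<le> real n"
            by (rule abs_avg_le) (use g_bd in auto)
          then show "orbit_average \<theta> (U (real (Suc k))) (fn n) x \<le> of_nat n"
            by (simp add: b_eq ennreal_of_nat_eq_real_of_nat ennreal_leI del: of_nat_Suc)
        qed
      qed (auto simp: emeasure_space_1 of_nat_less_top simp del: of_nat_Suc)
      then have "(\<integral>\<^sup>+x. fn n x \<partial>P) = (\<integral>\<^sup>+x. ennreal (h n x) \<partial>P)"
        by (simp add: int_avg[OF fn_meas] LIMSEQ_const_iff del: of_nat_Suc)
      also have "\<dots> \<le> (\<integral>\<^sup>+x. ergodic_limit \<theta> U f x \<partial>P)"
      proof (rule nn_integral_mono_AE)
        show "AE x in P. ennreal (h n x) \<le> ergodic_limit \<theta> U f x"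
          using h_lim[of n] erg
        proof eventually_elim
          case (elim x)
          have "Liminf at_top (\<lambda>R. orbit_average \<theta> (U R) f x) = ergodic_limit \<theta> U f x"
            by (rule lim_imp_Liminf[OF _ elim(2)]) simp
          then show ?case using lower[OF elim(1)] by simp
        qed
      qed
      finally show ?thesis .
    qed
    then show "(\<integral>\<^sup>+x. f x \<partial>P) \<le> (\<integral>\<^sup>+x. ergodic_limit \<theta> U f x \<partial>P)"
      by (subst nn_integral_SUP_min) (auto intro: SUP_least simp: fn_def)
  qed
qed

end

section \<open>Limit of the orbit measures\<close>

lemma inner_part_ratio_tendsto:
  assumes \<omega>: "domain_family \<omega>" and R: "0 < R"
  shows "((\<lambda>\<epsilon>. 1 - measure lborel (inner_part R (\<omega> \<epsilon>)) / measure lborel (\<omega> \<epsilon>)) \<longlongrightarrow> 0) (at_right 0)"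
proof -
  have pos: "0 < measure lborel (\<omega> \<epsilon>)" if "0 < \<epsilon>" for \<epsilon>
    using emeasure_lborel_open_pos[of "\<omega> \<epsilon>"] \<omega> that
    by (auto simp: domain_family_def measure_def enn2real_positive_iff)
  have "(\<lambda>\<epsilon>. measure lborel (inner_part R (\<omega> \<epsilon>))) \<sim>[at_right 0] (\<lambda>\<epsilon>. measure lborel (\<omega> \<epsilon>))"
    using \<omega> R by (subst asymp_equiv_sym) (auto simp: domain_family_def)
  then have "((\<lambda>\<epsilon>. measure lborel (inner_part R (\<omega> \<epsilon>)) / measure lborel (\<omega> \<epsilon>)) \<longlongrightarrow> 1) (at_right 0)"
    unfolding asymp_equiv_def
  \<comment> \<open>By convention the ratio in \<open>asymp_equiv_def\<close> is 1 for
    \<open>0 / 0\<close>; the positive volume of \<open>\<omega> \<epsilon>\<close> excludes that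
    case.\<close>
  proof (rule Lim_transform_eventually)
    show "\<forall>\<^sub>F \<epsilon> in at_right 0. (if measure lborel (inner_part R (\<omega> \<epsilon>)) = 0 \<and> measure lborel (\<omega> \<epsilon>) = 0 then 1
        else measure lborel (inner_part R (\<omega> \<epsilon>)) / measure lborel (\<omega> \<epsilon>)) =
        measure lborel (inner_part R (\<omega> \<epsilon>)) / measure lborel (\<omega> \<epsilon>)"
      using eventually_at_right_less[of "0::real"] by eventually_elim (use pos in force)
  qed
  then show ?thesis using tendsto_diff[OF tendsto_const[of 1]] by fastforce
qed

text \<open>One set per stage must control all radii. At stage \<open>k\<close> the radii
  \<open>1, ..., k\<close> are handled together; a fixed radius is below \<open>t j\<close> for
  large \<open>j\<close>, so every limsup is finite. The factor \<open>1 / (real k + 1)\<close> in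
  the assumption on boundary layers pays for the \<open>k\<close> radii, leaving at most
  \<open>(1/2)^k\<close>.\<close>

lemma (in measurable_action) ex_locally_bounded_sets:
  fixes A :: "nat \<Rightarrow> (real^'n) set" and g :: "nat \<Rightarrow> 'a \<Rightarrow> ennreal"
  assumes A: "\<And>k. open (A k)" "\<And>k. A k \<noteq> {}" "\<And>k. emeasure lborel (A k) < \<infinity>"
    and g [measurable]: "\<And>k. g k \<in> borel_measurable borel"
    and C: "0 < C" "\<And>k. orbit_average \<theta> (A k) (g k) (x k) \<le> ennreal C"
    and inner: "\<And>k. 1 - measure lborel (inner_part (real k) (A k)) / measure lborel (A k) \<le> (1/2)^k / (real k + 1)"
    and d: "0 < d"
  shows "\<exists>Y. (\<forall>k. Y k \<in> sets borel \<and> measure (orbit_measure \<theta> (A k) (x k)) (- Y k) \<le> 2 * d) \<and>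
    (\<forall>t v R. strict_mono t \<longrightarrow> (\<forall>j. v j \<in> Y (t j)) \<longrightarrow> 0 < R \<longrightarrow>
      limsup (\<lambda>j. \<integral>\<^sup>+l\<in>ball 0 R. g (t j) (\<theta> l (v j)) \<partial>lborel) < \<infinity>)"
proof -
  have [measurable]: "ball (0::real^'n) r \<in> sets borel" for r by simp
  have Apos: "0 < measure lborel (A k)" for k
    using emeasure_lborel_open_pos[OF A(1,2)] A(3) by (simp add: measure_def enn2real_positive_iff)
  interpret Q: prob_space "orbit_measure \<theta> (A k) (x k)" for k
    using emeasure_lborel_open_pos[OF A(1,2), of k] A(1,3)[of k]
    by (intro prob_space_orbit_measure) auto
  have [measurable_cong]: "sets (orbit_measure \<theta> (A k) (x k)) = sets borel" for k
    by (rule sets_orbit_measure)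
  define b where "b m = measure lborel (ball (0::real^'n) (real m))" for m :: nat
  have b: "0 < b m" if "1 \<le> m" for m
    unfolding b_def using that by (intro content_ball_pos) simp
  \<comment> \<open>Chosen so that Chebyshev's bound \<open>b m * C / c m\<close> equals
    \<open>d * (1/2)^m\<close>; over \<open>m \<ge> 1\<close> these sum to at most
    \<open>d\<close>.\<close>
  define c where "c m = b m * C * 2 ^ m / d" for m
  have c: "0 < c m" if "1 \<le> m" for m using b[OF that] C(1) d by (simp add: c_def)
  obtain k0 :: nat where k0: "(1/2::real) ^ k0 < d"
    using real_arch_pow_inv[OF d, of "1/2"] by auto
  define Z where "Z k m = {y. ennreal (c m) < (\<integral>\<^sup>+l\<in>ball 0 (real m). g k (\<theta> l y) \<partial>lborel)}" for k m
  have Z_meas [measurable]: "Z k m \<in> sets borel" for k m unfolding Z_def by measurable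
  \<comment> \<open>Before stage \<open>k0\<close> the layers may cost more than \<open>d\<close>;
    these finitely many stages are left unrestricted, which no limsup notices.\<close>
  define Y where "Y k = (if k0 \<le> k then - (\<Union>m\<in>{1..k}. Z k m) else UNIV)" for k
  have Y_meas: "Y k \<in> sets borel" for k
  proof -
    have univ: "(UNIV :: 'a set) \<in> sets borel" by simp
    have "- (\<Union>m\<in>{1..k}. Z k m) \<in> sets borel" by (rule borel_comp) measurable
    then show ?thesis unfolding Y_def by (cases "k0 \<le> k") (simp_all only: if_True if_False univ)
  qed
  have Z_le: "measure (orbit_measure \<theta> (A k) (x k)) (Z k m) \<le> (1/2)^k / (real k + 1) + d * (1/2)^m"
    if m: "1 \<le> m" "m \<le> k" for k m
  proof -
    have "measure (orbit_measure \<theta> (A k) (x k)) (Z k m) \<le>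
        1 - measure lborel (inner_part (real m) (A k)) / measure lborel (A k) + b m * C / c m"
      unfolding Z_def b_def
      by (rule measure_orbit_measure_large_local_integral) (use A g C c[OF m(1)] in auto)
    moreover have "measure lborel (inner_part (real k) (A k)) / measure lborel (A k) \<le>
        measure lborel (inner_part (real m) (A k)) / measure lborel (A k)"
    proof (rule divide_right_mono[OF measure_mono_fmeasurable])
      show "inner_part (real k) (A k) \<subseteq> inner_part (real m) (A k)"
        using m(2) by (intro inner_part_antimono) simp
      show "inner_part (real k) (A k) \<in> sets lborel" using open_inner_part[OF A(1)] by simp
      have "A k \<in> fmeasurable lborel" using A(1,3)[of k] by (auto simp: fmeasurable_def)
      then show "inner_part (real m) (A k) \<in> fmeasurable lborel"
        by (rule fmeasurableI2[OF _ inner_part_subset]) (use open_inner_part[OF A(1)] in simp)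
    qed simp
    moreover have "b m * C / c m = d * (1/2)^m"
      using b[OF m(1)] C(1) d by (simp add: c_def field_simps power_divide)
    ultimately show ?thesis using inner[of k] by linarith
  qed
  have Y_le: "measure (orbit_measure \<theta> (A k) (x k)) (- Y k) \<le> 2 * d" for k
  proof (cases "k0 \<le> k")
    case True
    have "measure (orbit_measure \<theta> (A k) (x k)) (- Y k) = measure (orbit_measure \<theta> (A k) (x k)) (\<Union>m\<in>{1..k}. Z k m)"
      using True by (simp add: Y_def)
    also have "\<dots> \<le> (\<Sum>m\<in>{1..k}. measure (orbit_measure \<theta> (A k) (x k)) (Z k m))"
      by (rule Q.finite_measure_subadditive_finite) (auto simp: sets_orbit_measure)
    also have "\<dots> \<le> (\<Sum>m\<in>{1..k}. (1/2)^k / (real k + 1) + d * (1/2)^m)"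
      by (rule sum_mono) (use Z_le in auto)
    also have "\<dots> = real k * ((1/2)^k / (real k + 1)) + d * (\<Sum>m\<in>{1..k}. (1/2)^m)"
      by (simp add: sum.distrib sum_distrib_left)
    also have "\<dots> \<le> d + d * 1"
    proof (rule add_mono[OF _ mult_left_mono])
      have "real k * ((1/2)^k / (real k + 1)) = (real k / (real k + 1)) * (1/2)^k" by simp
      also have "\<dots> \<le> (1/2)^k" by (rule mult_left_le_one_le) auto
      also have "(1/2::real)^k \<le> (1/2)^k0" using True by (intro power_decreasing) auto
      finally show "real k * ((1/2)^k / (real k + 1)) \<le> d" using k0 by linarith
      have "(\<Sum>m\<in>{1..k}. (1/2::real)^m) = 1 - (1/2)^k"
        by (induction k) (auto simp: field_simps)
      then show "(\<Sum>m\<in>{1..k}. (1/2::real)^m) \<le> 1" by simp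
    qed (use d in simp)
    finally show ?thesis by simp
  qed (use d in \<open>simp add: Y_def\<close>)
  have "limsup (\<lambda>j. \<integral>\<^sup>+l\<in>ball 0 R. g (t j) (\<theta> l (v j)) \<partial>lborel) < \<infinity>"
    if t: "strict_mono t" and v: "\<And>j. v j \<in> Y (t j)" and R: "0 < R" for t v R
  proof -
    obtain m0 :: nat where "R \<le> real m0" using real_arch_simple by blast
    define m where "m = Suc m0"
    have m: "R \<le> real m" "1 \<le> m" using \<open>R \<le> real m0\<close> by (auto simp: m_def)
    have "limsup (\<lambda>j. \<integral>\<^sup>+l\<in>ball 0 R. g (t j) (\<theta> l (v j)) \<partial>lborel) \<le> ennreal (c m)"
    proof (rule Limsup_bounded, rule eventually_sequentiallyI[of "max k0 m"])
      fix j assume j: "max k0 m \<le> j"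
      have "j \<le> t j" using t by (rule strict_mono_imp_increasing)
      then have "v j \<notin> Z (t j) m"
        using v[of j] j m(2) by (auto simp: Y_def split: if_splits)
      then have "(\<integral>\<^sup>+l\<in>ball 0 (real m). g (t j) (\<theta> l (v j)) \<partial>lborel) \<le> ennreal (c m)"
        by (simp add: Z_def not_less)
      moreover have "(\<integral>\<^sup>+l\<in>ball 0 R. g (t j) (\<theta> l (v j)) \<partial>lborel) \<le> (\<integral>\<^sup>+l\<in>ball 0 (real m). g (t j) (\<theta> l (v j)) \<partial>lborel)"
        using m(1) by (intro nn_integral_mono mult_left_mono) (auto simp: indicator_def)
      ultimately show "(\<integral>\<^sup>+l\<in>ball 0 R. g (t j) (\<theta> l (v j)) \<partial>lborel) \<le> ennreal (c m)" by (rule order_trans[rotated])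
    qed
    then show ?thesis by (rule le_less_trans) simp
  qed
  then show ?thesis using Y_meas Y_le by (intro exI[of _ Y]) auto
qed

theorem theorem3:
  fixes \<theta> :: "real^'n \<Rightarrow> 'a::polish_space \<Rightarrow> 'a"
    and \<omega> :: "real \<Rightarrow> (real^'n) set"
    and fe :: "real \<Rightarrow> 'a \<Rightarrow> ennreal"
    and f :: "'a \<Rightarrow> ennreal"
    and u :: "real \<Rightarrow> 'a"
  assumes "continuous_action \<theta>"
    and "domain_family \<omega>"
    and "\<And>\<epsilon>. 0 < \<epsilon> \<Longrightarrow> fe \<epsilon> \<in> borel_measurable borel"
    and "f \<in> borel_measurable borel"
    and "coercive_Gamma_liminf \<theta> fe f"
    and "\<exists>C::real. \<forall>\<epsilon>>0. orbit_average \<theta> (\<omega> \<epsilon>) (fe \<epsilon>) (u \<epsilon>) \<le> ennreal C"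
  shows "\<exists>(e :: nat \<Rightarrow> real) (P :: 'a measure).
      (\<forall>k. 0 < e k) \<and> e \<longlonglongrightarrow> 0 \<and>
      prob_space P \<and> sets P = sets borel \<and>
      weakly_converges (\<lambda>k. orbit_measure \<theta> (\<omega> (e k)) (u (e k))) P \<and>
      (\<forall>l. distr P borel (\<theta> l) = P) \<and>
      (\<integral>\<^sup>+ x. f x \<partial>P) \<le> Liminf (at_right 0) (\<lambda>\<epsilon>. orbit_average \<theta> (\<omega> \<epsilon>) (fe \<epsilon>) (u \<epsilon>)) \<and>
      (\<forall>U. averaging_family U \<longrightarrow>
         (AE x in P. \<exists>L<\<infinity>. ((\<lambda>R. orbit_average \<theta> (U R) f x) \<longlongrightarrow> L) at_top) \<and>
         (\<integral>\<^sup>+ x. f x \<partial>P) = (\<integral>\<^sup>+ x. ergodic_limit \<theta> U f x \<partial>P)) \<and>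
      (\<forall>U V. averaging_family U \<and> averaging_family V \<longrightarrow>
         (\<integral>\<^sup>+ x. ergodic_limit \<theta> U f x \<partial>P) = (\<integral>\<^sup>+ x. ergodic_limit \<theta> V f x \<partial>P))"
proof -
  interpret measurable_action \<theta> by standard fact
  note fe = assms(3) and [measurable] = assms(4)
  obtain C0 :: real where C0: "\<And>\<epsilon>. 0 < \<epsilon> \<Longrightarrow> orbit_average \<theta> (\<omega> \<epsilon>) (fe \<epsilon>) (u \<epsilon>) \<le> ennreal C0"
    using assms(6) by blast
  \<comment> \<open>\<open>C0\<close> may be nonpositive, since \<open>ennreal\<close> sends
    negative reals to 0; the thresholds on local integrals require a positive constant.\<close>
  define C where "C = max C0 1"
  have C: "0 < C" by (simp add: C_def)
  define F where "F \<epsilon> = orbit_average \<theta> (\<omega> \<epsilon>) (fe \<epsilon>) (u \<epsilon>)" for \<epsilon>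
  have F_le: "F \<epsilon> \<le> ennreal C" if "0 < \<epsilon>" for \<epsilon>
    unfolding F_def using C0[OF that] by (rule order_trans) (simp add: C_def ennreal_leI)
  have \<omega>: "open (\<omega> \<epsilon>)" "\<omega> \<epsilon> \<noteq> {}" "emeasure lborel (\<omega> \<epsilon>) < \<infinity>" if "0 < \<epsilon>" for \<epsilon>
    using assms(2) that by (auto simp: domain_family_def)
  define L where "L = Liminf (at_right 0) F"
  \<comment> \<open>Finiteness of \<open>L\<close> gives the strict inequality
    \<open>L < L + 1 / (k + 1)\<close> below and, later, integrability of \<open>f\<close>.\<close>
  have "L \<le> Liminf (at_right (0::real)) (\<lambda>_. ennreal C)"
    unfolding L_def by (rule Liminf_mono)
      (use eventually_at_right_less[of "0::real"] in \<open>auto elim!: eventually_mono intro: F_le\<close>)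
  then have L_fin: "L \<noteq> top" by (auto simp: Liminf_const top_unique)
  \<comment> \<open>Realising the liminf over the whole family along \<open>e\<close> lets the
    measure obtained on a subsequence satisfy the bound for the full liminf. Closeness to
    \<open>L\<close> holds only frequently near 0, the other conditions eventually, so all can be
    met together.\<close>
  have "\<exists>\<epsilon>. 0 < \<epsilon> \<and> \<epsilon> < inverse (real (Suc k)) \<and> F \<epsilon> < L + ennreal (inverse (real (Suc k))) \<and>
      1 - measure lborel (inner_part (real k) (\<omega> \<epsilon>)) / measure lborel (\<omega> \<epsilon>) \<le> (1/2)^k / (real k + 1)" for k
  proof -
    have "\<exists>\<^sub>F \<epsilon> in at_right 0. F \<epsilon> < L + ennreal (inverse (real (Suc k)))"
    proof (rule ccontr)
      assume "\<not> ?thesis"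
      then have "L + ennreal (inverse (real (Suc k))) \<le> L"
        unfolding L_def by (intro Liminf_bounded) (simp add: not_frequently not_less L_def)
      moreover have "L < L + ennreal (inverse (real (Suc k)))"
        using L_fin by (cases L rule: ennreal_cases) (auto simp: ennreal_less_iff simp flip: ennreal_plus)
      ultimately show False by simp
    qed
    moreover have "\<forall>\<^sub>F \<epsilon> in at_right 0. 1 - measure lborel (inner_part (real k) (\<omega> \<epsilon>)) / measure lborel (\<omega> \<epsilon>) \<le> (1/2)^k / (real k + 1)"
    proof -
      \<comment> \<open>Width \<open>k + 1\<close> treats \<open>k = 0\<close> as well, since the
        limit of the ratios is stated for positive widths; the inner part of width \<open>k\<close>
        is larger.\<close>
      have "\<forall>\<^sub>F \<epsilon> in at_right 0. 1 - measure lborel (inner_part (real (Suc k)) (\<omega> \<epsilon>)) / measure lborel (\<omega> \<epsilon>) < (1/2)^k / (real k + 1)"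
        using inner_part_ratio_tendsto[OF assms(2), of "real (Suc k)"] by (rule order_tendstoD(2)) auto
      then show ?thesis
        using eventually_at_right_less[of "0::real"]
      proof eventually_elim
        case (elim \<epsilon>)
        have fm: "\<omega> \<epsilon> \<in> fmeasurable lborel" using \<omega>[OF elim(2)] by (auto simp: fmeasurable_def)
        have "measure lborel (inner_part (real (Suc k)) (\<omega> \<epsilon>)) \<le> measure lborel (inner_part (real k) (\<omega> \<epsilon>))"
          using open_inner_part[OF \<omega>(1)[OF elim(2)]]
          by (intro measure_mono_fmeasurable inner_part_antimono fmeasurableI2[OF fm inner_part_subset]) auto
        then have "measure lborel (inner_part (real (Suc k)) (\<omega> \<epsilon>)) / measure lborel (\<omega> \<epsilon>) \<le>
            measure lborel (inner_part (real k) (\<omega> \<epsilon>)) / measure lborel (\<omega> \<epsilon>)"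
          by (rule divide_right_mono) simp
        then show ?case using elim(1) by linarith
      qed
    qed
    moreover have "\<forall>\<^sub>F \<epsilon> in at_right 0. \<epsilon> < inverse (real (Suc k))"
      by (rule order_tendstoD(2)[OF tendsto_ident_at]) auto
    moreover have "\<forall>\<^sub>F \<epsilon> in at_right 0. (0::real) < \<epsilon>" by (rule eventually_at_right_less)
    ultimately have "\<exists>\<^sub>F \<epsilon> in at_right 0. F \<epsilon> < L + ennreal (inverse (real (Suc k))) \<and>
        (1 - measure lborel (inner_part (real k) (\<omega> \<epsilon>)) / measure lborel (\<omega> \<epsilon>) \<le> (1/2)^k / (real k + 1) \<and>
         \<epsilon> < inverse (real (Suc k)) \<and> 0 < \<epsilon>)"
      by (intro frequently_eventually_frequently eventually_conj)
    then show ?thesis by (auto dest!: frequently_ex)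
  qed
  then obtain e where e_pos: "\<And>k. 0 < e k" and e_less: "\<And>k. e k < inverse (real (Suc k))"
    and F_e: "\<And>k. F (e k) < L + ennreal (inverse (real (Suc k)))"
    and inner: "\<And>k. 1 - measure lborel (inner_part (real k) (\<omega> (e k))) / measure lborel (\<omega> (e k)) \<le> (1/2)^k / (real k + 1)"
    by metis
  have e_lim: "e \<longlonglongrightarrow> 0"
    by (rule tendsto_sandwich[OF _ _ tendsto_const LIMSEQ_inverse_real_of_nat])
      (use e_pos e_less in \<open>auto simp: less_imp_le intro!: always_eventually\<close>)
  define Q where "Q k = orbit_measure \<theta> (\<omega> (e k)) (u (e k))" for k
  have Q_prob: "prob_space (Q k)" for k
    unfolding Q_def using emeasure_lborel_open_pos[OF \<omega>(1,2)[OF e_pos]] \<omega>(1,3)[OF e_pos[of k]]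
    by (intro prob_space_orbit_measure) (auto simp: less_le)
  have Q_sets: "sets (Q k) = sets borel" for k
    by (simp add: Q_def sets_orbit_measure)
  \<comment> \<open>The same good sets serve tightness, through coercivity, and the lower bound,
    through the liminf inequality.\<close>
  have good: "\<exists>Y. (\<forall>k. Y k \<in> sets borel \<and> measure (Q k) (- Y k) \<le> d) \<and>
      (\<forall>t v. strict_mono t \<longrightarrow> (\<forall>j. v j \<in> Y (t j)) \<longrightarrow>
        (\<exists>r w. strict_mono r \<and> (\<lambda>j. v (r j)) \<longlonglongrightarrow> w) \<and>
        (\<forall>w. v \<longlonglongrightarrow> w \<longrightarrow> f w \<le> liminf (\<lambda>j. fe (e (t j)) (v j))))" if "0 < d" for d
  proof -
    have "\<exists>Y. (\<forall>k. Y k \<in> sets borel \<and> measure (orbit_measure \<theta> (\<omega> (e k)) (u (e k))) (- Y k) \<le> 2 * (d / 2)) \<and>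
      (\<forall>t v R. strict_mono t \<longrightarrow> (\<forall>j. v j \<in> Y (t j)) \<longrightarrow> 0 < R \<longrightarrow>
        limsup (\<lambda>j. \<integral>\<^sup>+l\<in>ball 0 R. fe (e (t j)) (\<theta> l (v j)) \<partial>lborel) < \<infinity>)"
      using \<omega> fe e_pos C F_le inner that unfolding F_def
      by (intro ex_locally_bounded_sets[where C = C]) auto
    then obtain Y where Y: "\<forall>k. Y k \<in> sets borel \<and> measure (Q k) (- Y k) \<le> d"
      and bdd: "\<forall>t v R. strict_mono t \<longrightarrow> (\<forall>j. v j \<in> Y (t j)) \<longrightarrow> 0 < R \<longrightarrow>
        limsup (\<lambda>j. \<integral>\<^sup>+l\<in>ball 0 R. fe (e (t j)) (\<theta> l (v j)) \<partial>lborel) < \<infinity>"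
      unfolding Q_def by auto
    have "(\<exists>r w. strict_mono r \<and> (\<lambda>j. v (r j)) \<longlonglongrightarrow> w) \<and>
        (\<forall>w. v \<longlonglongrightarrow> w \<longrightarrow> f w \<le> liminf (\<lambda>j. fe (e (t j)) (v j)))"
      if t: "strict_mono t" and v: "\<forall>j. v j \<in> Y (t j)" for t v
    proof -
      have "(\<lambda>j. e (t j)) \<longlonglongrightarrow> 0"
        using LIMSEQ_subseq_LIMSEQ[OF e_lim t] by (simp add: o_def)
      then have *: "(\<exists>r w. strict_mono r \<and> (\<lambda>k. v (r k)) \<longlonglongrightarrow> w) \<and>
        (\<forall>r w. strict_mono r \<and> (\<lambda>k. v (r k)) \<longlonglongrightarrow> w \<longrightarrow>
           f w \<le> liminf (\<lambda>k. fe (e (t (r k))) (v (r k))))"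
        using assms(5)[unfolded coercive_Gamma_liminf_def, rule_format, of "\<lambda>j. e (t j)" v]
          e_pos bdd[rule_format, OF t v[rule_format]] by blast
      have "f w \<le> liminf (\<lambda>j. fe (e (t j)) (v j))" if "v \<longlonglongrightarrow> w" for w
        using *[THEN conjunct2, rule_format, of id w] that by (simp add: strict_mono_id)
      then show ?thesis using * by blast
    qed
    then show ?thesis using Y by blast
  qed
  have tight: "\<exists>K. compact K \<and> (\<forall>k. measure (Q k) (- K) \<le> d)" if "0 < d" for d
  proof -
    \<comment> \<open>Half of \<open>d\<close>, since the passage to compact sets doubles the
      loss.\<close>
    obtain Y where Y: "\<forall>k. Y k \<in> sets borel \<and> measure (Q k) (- Y k) \<le> d / 2"
      "\<forall>(t :: nat \<Rightarrow> nat) v. strict_mono t \<longrightarrow> (\<forall>j. v j \<in> Y (t j)) \<longrightarrow> (\<exists>(r :: nat \<Rightarrow> nat) w. strict_mono r \<and> (\<lambda>j. v (r j)) \<longlonglongrightarrow> w)"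
      using good[of "d / 2"] \<open>0 < d\<close> by auto
    have "\<exists>K. compact K \<and> (\<forall>k. measure (Q k) (- K) \<le> 2 * (d / 2))"
      by (rule tight_of_sequentially_precompact[OF Q_prob Q_sets, of Y]) (use Y \<open>0 < d\<close> in auto)
    then show ?thesis by simp
  qed
  obtain r P where r: "strict_mono r" and P: "prob_space P" "sets P = sets borel"
    and conv: "weakly_converges (\<lambda>k. Q (r k)) P"
    using tight_imp_weakly_convergent_subsequence[OF Q_prob Q_sets tight] by blast
  have er_lim: "(\<lambda>k. e (r k)) \<longlonglongrightarrow> 0"
    using LIMSEQ_subseq_LIMSEQ[OF e_lim r] by (simp add: o_def)
  have er_right: "filterlim (\<lambda>k. e (r k)) (at_right 0) sequentially"
    by (rule tendsto_imp_filterlim_at_right[OF er_lim]) (simp add: e_pos)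
  have inv: "distr P borel (\<theta> l) = P" for l
  proof (rule invariant_of_weakly_converges[OF _ _ _ _ P conv[unfolded Q_def]])
    show "\<omega> (e (r k)) \<in> sets borel" "emeasure lborel (\<omega> (e (r k))) \<noteq> 0" "emeasure lborel (\<omega> (e (r k))) \<noteq> \<infinity>" for k
      using \<omega>[OF e_pos[of "r k"]] emeasure_lborel_open_pos[OF \<omega>(1,2)[OF e_pos[of "r k"]]] by auto
    fix l :: "real^'n"
    let ?R = "norm l + 1"
    have "((\<lambda>\<epsilon>. 1 - measure lborel (inner_part ?R (\<omega> \<epsilon>)) / measure lborel (\<omega> \<epsilon>)) \<longlongrightarrow> 0) (at_right 0)"
      by (rule inner_part_ratio_tendsto[OF assms(2)]) (simp add: add_nonneg_pos)
    then have "(\<lambda>k. 1 - measure lborel (inner_part ?R (\<omega> (e (r k)))) / measure lborel (\<omega> (e (r k)))) \<longlonglongrightarrow> 0"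
      by (rule filterlim_compose[OF _ er_right])
    then have lim0: "(\<lambda>k. 2 * (1 - measure lborel (inner_part ?R (\<omega> (e (r k)))) / measure lborel (\<omega> (e (r k))))) \<longlonglongrightarrow> 0"
      by (rule tendsto_mult_right_zero)
    have "norm (measure lborel (sym_diff ((+) l ` \<omega> (e (r k))) (\<omega> (e (r k)))) / measure lborel (\<omega> (e (r k)))) \<le>
        2 * (1 - measure lborel (inner_part ?R (\<omega> (e (r k)))) / measure lborel (\<omega> (e (r k))))" for k
    proof -
      let ?A = "\<omega> (e (r k))"
      note A = \<omega>[OF e_pos[of "r k"]]
      have pos: "0 < measure lborel ?A"
        using emeasure_lborel_open_pos[OF A(1,2)] A(3) by (simp add: measure_def enn2real_positive_iff)
      have "measure lborel (sym_diff ((+) l ` ?A) ?A) \<le> 2 * (measure lborel ?A - measure lborel (inner_part ?R ?A))"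
        by (rule measure_sym_diff_translate_le[OF A(1,3)]) simp
      then show ?thesis using pos by (simp add: field_simps)
    qed
    then show "(\<lambda>k. measure lborel (sym_diff ((+) l ` \<omega> (e (r k))) (\<omega> (e (r k)))) / measure lborel (\<omega> (e (r k)))) \<longlonglongrightarrow> 0"
      by (intro Lim_null_comparison[OF always_eventually lim0] allI)
  qed
  have "(\<integral>\<^sup>+x. f x \<partial>P) \<le> liminf (\<lambda>k. \<integral>\<^sup>+x. fe (e (r k)) x \<partial>Q (r k))"
  proof (rule nn_integral_le_liminf_of_Gamma_liminf[OF Q_prob Q_sets P conv])
    fix d :: real assume "0 < d"
    then obtain Y where Y: "\<forall>k. Y k \<in> sets borel \<and> measure (Q k) (- Y k) \<le> d"
      "\<forall>t v. strict_mono t \<longrightarrow> (\<forall>j. v j \<in> Y (t j)) \<longrightarrow>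
        (\<forall>w. v \<longlonglongrightarrow> w \<longrightarrow> f w \<le> liminf (\<lambda>j. fe (e (t j)) (v j)))"
      using good[of d] by blast
    show "\<exists>Y. (\<forall>k. Y k \<in> sets borel \<and> measure (Q (r k)) (- Y k) \<le> d) \<and>
      (\<forall>t v w. strict_mono t \<longrightarrow> (\<forall>j. v j \<in> Y (t j)) \<longrightarrow> v \<longlonglongrightarrow> w \<longrightarrow>
        f w \<le> liminf (\<lambda>j. fe (e (r (t j))) (v j)))"
    \<comment> \<open>The good sets were built for arbitrary increasing stages, so after relabelling
      by \<open>r\<close> the stages \<open>r \<circ> t\<close> are admissible.\<close>
    proof (intro exI[of _ "\<lambda>k. Y (r k)"] conjI allI impI)
      fix t :: "nat \<Rightarrow> nat" and v w assume "strict_mono t" "\<forall>j. v j \<in> Y (r (t j))" "v \<longlonglongrightarrow> w"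
      then show "f w \<le> liminf (\<lambda>j. fe (e (r (t j))) (v j))"
        using Y(2)[rule_format, of "r \<circ> t" v w] strict_mono_o[OF r \<open>strict_mono t\<close>] by simp
    qed (use Y in auto)
  qed (use fe e_pos in auto)
  also have "\<dots> = liminf (\<lambda>k. F (e (r k)))"
    unfolding Q_def F_def using \<omega>(1) e_pos fe by (simp add: nn_integral_orbit_measure)
  also have "\<dots> \<le> liminf (\<lambda>k. L + ennreal (inverse (real (Suc (r k)))))"
    by (intro Liminf_mono always_eventually allI less_imp_le F_e)
  also have "\<dots> = L"
  proof (rule lim_imp_Liminf)
    have "(\<lambda>k. inverse (real (Suc (r k)))) \<longlonglongrightarrow> 0"
      using LIMSEQ_subseq_LIMSEQ[OF LIMSEQ_inverse_real_of_nat r] by (simp add: o_def)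
    then have "(\<lambda>k. ennreal (inverse (real (Suc (r k))))) \<longlonglongrightarrow> ennreal 0"
      by (rule tendsto_ennrealI)
    then have "(\<lambda>k. L + ennreal (inverse (real (Suc (r k))))) \<longlonglongrightarrow> L + ennreal 0"
      by (rule tendsto_add[OF tendsto_const])
    then show "(\<lambda>k. L + ennreal (inverse (real (Suc (r k))))) \<longlonglongrightarrow> L" by simp
  qed simp
  finally have int_le: "(\<integral>\<^sup>+x. f x \<partial>P) \<le> L" .
  then have int_fin: "(\<integral>\<^sup>+x. f x \<partial>P) < \<infinity>"
    using L_fin by (auto simp: less_top top_unique)
  have ergodic: "(AE x in P. \<exists>L<\<infinity>. ((\<lambda>R. orbit_average \<theta> (U R) f x) \<longlongrightarrow> L) at_top) \<and>
      (\<integral>\<^sup>+ x. f x \<partial>P) = (\<integral>\<^sup>+ x. ergodic_limit \<theta> U f x \<partial>P)" if U: "averaging_family U" for U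
  proof -
    interpret P: prob_space P by fact
    interpret averaged_action \<theta> P U by standard (use P(2) inv U in auto)
    show ?thesis using pointwise_ergodic_theorem[OF assms(4) int_fin] by simp
  qed
  show ?thesis
  proof (intro exI[of _ "\<lambda>k. e (r k)"] exI[of _ P] conjI allI)
    show "weakly_converges (\<lambda>k. orbit_measure \<theta> (\<omega> (e (r k))) (u (e (r k)))) P"
      using conv by (simp add: Q_def)
    show "(\<integral>\<^sup>+ x. f x \<partial>P) \<le> Liminf (at_right 0) (\<lambda>\<epsilon>. orbit_average \<theta> (\<omega> \<epsilon>) (fe \<epsilon>) (u \<epsilon>))"
      using int_le unfolding L_def F_def[abs_def] .
    show "averaging_family U \<longrightarrow>
         (AE x in P. \<exists>L<\<infinity>. ((\<lambda>R. orbit_average \<theta> (U R) f x) \<longlongrightarrow> L) at_top) \<and>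
         (\<integral>\<^sup>+ x. f x \<partial>P) = (\<integral>\<^sup>+ x. ergodic_limit \<theta> U f x \<partial>P)" for U
      using ergodic by blast
    show "averaging_family U \<and> averaging_family V \<longrightarrow>
         (\<integral>\<^sup>+ x. ergodic_limit \<theta> U f x \<partial>P) = (\<integral>\<^sup>+ x. ergodic_limit \<theta> V f x \<partial>P)" for U V
      using ergodic by metis
  qed (use e_pos er_lim P inv in auto)
qed

end
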